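(* Let $\Gamma\subset\mathrm{PSL}(2,\mathbb R)$ be a discrete subgroup of finite covolume. Then there is an exact sequence $$0\longrightarrow M_2(\Gamma)\longrightarrow\widetilde M_2(\Gamma)\stackrel{\delta}{\longrightarrow}\mathbb C ,$$ and, writing $I=\bigoplus_{k>0}M_k(\Gamma)$, one has the (internal) direct sum decomposition $$\widetilde M_*(\Gamma)=\mathbb C\oplus\bigoplus_{i=0}^\infty D^i(I)\oplus\begin{cases}0&\text{if }\dim\delta(\widetilde M_2(\Gamma))=0,\\[2mm]\displaystyle\bigoplus_{i=0}^\infty\mathbb C\,D^i(\phi)&\text{if there exists }\phi\in\widetilde M_2(\Gamma)\text{ with }\delta(\phi)=1.\end{cases}$$
   Context: $\mathcal H$ is the upper half plane. A modular form of weight $k$ over $\Gamma$ is a holomorphic $f:\mathcal H\to\mathbb C$ of moderate growth (the usual polynomial growth condition, $|f(z)|=O(((1+|z|^2)/\operatorname{Im} z)^N)$ for some $N$) with $(cz+d)^{-k}f(\frac{az+b}{cz+d})=f(z)$ for all $\begin{pmatrix}a&b\\c&d\end{pmatrix}\in\Gamma$. A quasimodular form of weight $k$ and depth $\le p$ over $\Gamma$ is a holomorphic $f:\mathcal H\to\mathbb C$ of moderate growth for which there are functions $f_0,\dots,f_p:\mathcal H\to\mathbb C$ with $(cz+d)^{-k}f(\frac{az+b}{cz+d})=\sum_{j=0}^p f_j(z)\left(\frac{c}{cz+d}\right)^j$ for all $z\in\mathcal H$ and all $\begin{pmatrix}a&b\\c&d\end{pmatrix}\in\Gamma$. The $f_j$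 are uniquely determined by $f$, and $f_0=f$. $M_*=\bigoplus_{k\ge0}M_k$ and $\widetilde M_*=\bigoplus_{k\ge0}\widetilde M_k$ are the graded rings of modular and quasimodular forms over $\Gamma$. $D=d/dz$. The operator $\delta:\widetilde M_k\to\widetilde M_{k-2}$ is $\delta(f)=f_1$; in weight $2$ it takes values in $\widetilde M_0=M_0=\mathbb C$. *)

theory Defs
  imports
    "HOL-Analysis.Analysis"
    "HOL-Algebra.Coset"
    "HOL-Algebra.Exact_Sequence"
    "HOL-Library.Function_Algebras"
begin

subsection \<open>Discrete subgroups of finite covolume in \<open>PSL(2,\<real>)\<close>\<close>

definition SL2R :: "(real^2^2) monoid" where
  "SL2R = \<lparr>carrier = {A. det A = 1}, monoid.mult = (**), one = mat 1\<rparr>"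

text \<open>
  An element of \<open>PSL2R\<close> is a coset, i.e. a set \<open>{A, -A}\<close>. Hence for a subgroup \<open>\<Gamma>\<close> of \<open>PSL2R\<close>
  the matrices that represent elements of \<open>\<Gamma>\<close> are exactly the elements of \<open>\<Union>\<Gamma>\<close>. In particular
  \<open>-1\<close> is always among them, and so there are no nonzero modular forms of odd weight.
\<close>

definition PSL2R :: "(real^2^2) set monoid" where
  "PSL2R = SL2R Mod {mat 1, - mat 1}"

definition uhp :: "complex set" where
  "uhp = {z. Im z > 0}"

definition autom :: "real^2^2 \<Rightarrow> complex \<Rightarrow> complex" where
  "autom A z = of_real (A$2$1) * z + of_real (A$2$2)"

definition moebius :: "real^2^2 \<Rightarrow> complex \<Rightarrow> complex" where
  "moebius A z = (of_real (A$1$1) * z + of_real (A$1$2)) / autom A z"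

definition hyp_area :: "complex measure" where
  "hyp_area = density lborel (\<lambda>z. indicator uhp z * ennreal (1 / (Im z)\<^sup>2))"

definition fundamental_domain :: "(real^2^2) set set \<Rightarrow> complex set \<Rightarrow> bool" where
  "fundamental_domain \<Gamma> F \<longleftrightarrow>
     F \<in> sets borel \<and> F \<subseteq> uhp \<and> (\<Union>A\<in>\<Union>\<Gamma>. moebius A ` F) = uhp \<and>
     (\<forall>A\<in>\<Union>\<Gamma>. A \<notin> {mat 1, - mat 1} \<longrightarrow> emeasure hyp_area (F \<inter> moebius A ` F) = 0)"

definition finite_covolume :: "(real^2^2) set set \<Rightarrow> bool" where
  "finite_covolume \<Gamma> \<longleftrightarrow> (\<exists>F. fundamental_domain \<Gamma> F \<and> emeasure hyp_area F < \<infinity>)"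

text \<open>
  \<open>PSL(2,\<real>)\<close> is the quotient of \<open>SL(2,\<real>)\<close> by a finite group, so \<open>\<Gamma>\<close> is discrete
  iff its preimage \<open>\<Union>\<Gamma>\<close> is a discrete set of matrices.
\<close>

definition discrete_finite_covolume :: "(real^2^2) set set \<Rightarrow> bool" where
  "discrete_finite_covolume \<Gamma> \<longleftrightarrow>
     subgroup \<Gamma> PSL2R \<and> discrete (\<Union>\<Gamma>) \<and> finite_covolume \<Gamma>"


subsection \<open>Modular and quasimodular forms\<close>

text \<open>
  A function on the upper half plane is represented by its extension by zero
  to \<^typ>\<open>complex\<close>, so that equality of representatives is equality of functions.
\<close>

definition hfun :: "(complex \<Rightarrow> complex) \<Rightarrow> bool" where
  "hfun f \<longleftrightarrow> (\<forall>z. z \<notin> uhp \<longrightarrow> f z = 0)"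

definition moderate_growth :: "(complex \<Rightarrow> complex) \<Rightarrow> bool" where
  "moderate_growth f \<longleftrightarrow>
     (\<exists>(N::nat) C. \<forall>z\<in>uhp. norm (f z) \<le> C * ((1 + (norm z)\<^sup>2) / Im z) ^ N)"

definition modular_forms :: "(real^2^2) set set \<Rightarrow> int \<Rightarrow> (complex \<Rightarrow> complex) set" where
  "modular_forms \<Gamma> k = {f. hfun f \<and> f holomorphic_on uhp \<and> moderate_growth f \<and>
     (\<forall>A\<in>\<Union>\<Gamma>. \<forall>z\<in>uhp. autom A z powi (- k) * f (moebius A z) = f z)}"

text \<open>The coefficients \<open>f\<^sub>0, \<dots>, f\<^sub>p\<close> are continued by \<open>f\<^sub>j = 0\<close> for \<open>j > p\<close>.\<close>

definition quasi_expansion ::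
  "(real^2^2) set set \<Rightarrow> int \<Rightarrow> nat \<Rightarrow> (complex \<Rightarrow> complex) \<Rightarrow> (nat \<Rightarrow> complex \<Rightarrow> complex) \<Rightarrow> bool" where
  "quasi_expansion \<Gamma> k p f g \<longleftrightarrow> (\<forall>j. hfun (g j)) \<and> (\<forall>j>p. g j = 0) \<and>
     (\<forall>A\<in>\<Union>\<Gamma>. \<forall>z\<in>uhp. autom A z powi (- k) * f (moebius A z) =
        (\<Sum>j\<le>p. g j z * (of_real (A$2$1) / autom A z) ^ j))"

definition quasimodular_forms_depth ::
  "(real^2^2) set set \<Rightarrow> int \<Rightarrow> nat \<Rightarrow> (complex \<Rightarrow> complex) set" where
  "quasimodular_forms_depth \<Gamma> k p = {f. hfun f \<and> f holomorphic_on uhp \<and> moderate_growth f \<and>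
     (\<exists>g. quasi_expansion \<Gamma> k p f g)}"

definition quasimodular_forms :: "(real^2^2) set set \<Rightarrow> int \<Rightarrow> (complex \<Rightarrow> complex) set" where
  "quasimodular_forms \<Gamma> k = (\<Union>p. quasimodular_forms_depth \<Gamma> k p)"

definition quasi_coeffs ::
  "(real^2^2) set set \<Rightarrow> int \<Rightarrow> (complex \<Rightarrow> complex) \<Rightarrow> nat \<Rightarrow> complex \<Rightarrow> complex" where
  "quasi_coeffs \<Gamma> k f = (THE g. \<exists>p. quasi_expansion \<Gamma> k p f g)"

definition delta ::
  "(real^2^2) set set \<Rightarrow> int \<Rightarrow> (complex \<Rightarrow> complex) \<Rightarrow> complex \<Rightarrow> complex" where
  "delta \<Gamma> k f = quasi_coeffs \<Gamma> k f 1"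

definition Dz :: "(complex \<Rightarrow> complex) \<Rightarrow> complex \<Rightarrow> complex" where
  "Dz f = (\<lambda>z. if z \<in> uhp then deriv f z else 0)"

definition const_hfun :: "complex \<Rightarrow> complex \<Rightarrow> complex" where
  "const_hfun c = (\<lambda>z. if z \<in> uhp then c else 0)"


subsection \<open>Complex vector spaces of functions and of graded elements\<close>

definition (in vector_space) internal_direct_sum :: "'b set \<Rightarrow> ('i \<Rightarrow> 'b set) \<Rightarrow> bool" where
  "internal_direct_sum V W \<longleftrightarrow>
     subspace V \<and> (\<forall>i. subspace (W i) \<and> W i \<subseteq> V) \<and>
     (\<forall>v\<in>V. \<exists>!w. (\<forall>i. w i \<in> W i) \<and> finite {i. w i \<noteq> 0} \<and> v = (\<Sum>i | w i \<noteq> 0. w i))"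

definition fscale :: "complex \<Rightarrow> (complex \<Rightarrow> complex) \<Rightarrow> complex \<Rightarrow> complex" where
  "fscale c f = (\<lambda>z. c * f z)"

definition gscale :: "complex \<Rightarrow> (nat \<Rightarrow> complex \<Rightarrow> complex) \<Rightarrow> nat \<Rightarrow> complex \<Rightarrow> complex" where
  "gscale c F = (\<lambda>k. fscale c (F k))"

global_interpretation cfun: vector_space fscale
  by unfold_locales (auto simp: fscale_def fun_eq_iff algebra_simps)

global_interpretation cgr: vector_space gscale
  by unfold_locales (auto simp: gscale_def fscale_def fun_eq_iff algebra_simps)

definition add_group :: "(complex \<Rightarrow> complex) set \<Rightarrow> (complex \<Rightarrow> complex) monoid" where
  "add_group V = \<lparr>carrier = V, monoid.mult = (+), one = 0\<rparr>"


subsection \<open>The graded rings and the derivation \<open>D\<close>\<close>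

text \<open>
  An element of a direct sum over the weights \<open>k \<ge> 0\<close> is a finitely supported family
  \<open>F\<close> whose component \<open>F k\<close> has weight \<open>k\<close>.
\<close>

definition graded_sum :: "(nat \<Rightarrow> (complex \<Rightarrow> complex) set) \<Rightarrow> (nat \<Rightarrow> complex \<Rightarrow> complex) set" where
  "graded_sum W = {F. finite {k. F k \<noteq> 0} \<and> (\<forall>k. F k \<in> W k)}"

definition homog :: "nat \<Rightarrow> (complex \<Rightarrow> complex) \<Rightarrow> nat \<Rightarrow> complex \<Rightarrow> complex" where
  "homog k f = (\<lambda>n. if n = k then f else 0)"

definition quasimodular_ring :: "(real^2^2) set set \<Rightarrow> (nat \<Rightarrow> complex \<Rightarrow> complex) set" where
  "quasimodular_ring \<Gamma> = graded_sum (\<lambda>k. quasimodular_forms \<Gamma> (int k))"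

definition modular_pos :: "(real^2^2) set set \<Rightarrow> (nat \<Rightarrow> complex \<Rightarrow> complex) set" where
  "modular_pos \<Gamma> = graded_sum (\<lambda>k. if k > 0 then modular_forms \<Gamma> (int k) else {0})"

text \<open>\<open>D\<close> raises the weight by 2.\<close>

definition Dgr :: "(nat \<Rightarrow> complex \<Rightarrow> complex) \<Rightarrow> nat \<Rightarrow> complex \<Rightarrow> complex" where
  "Dgr F = (\<lambda>k. if k < 2 then 0 else Dz (F (k - 2)))"

text \<open>The family of subspaces \<open>\<complex>, D\<^sup>0(I), D\<^sup>1(I), D\<^sup>2(I), \<dots>\<close>\<close>

definition modular_summands ::
  "(real^2^2) set set \<Rightarrow> nat option \<Rightarrow> (nat \<Rightarrow> complex \<Rightarrow> complex) set" where
  "modular_summands \<Gamma> s = (case s of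
       None \<Rightarrow> range (\<lambda>c. homog 0 (const_hfun c))
     | Some i \<Rightarrow> (Dgr ^^ i) ` modular_pos \<Gamma>)"

definition phi_summands :: "(complex \<Rightarrow> complex) \<Rightarrow> nat \<Rightarrow> (nat \<Rightarrow> complex \<Rightarrow> complex) set" where
  "phi_summands \<phi> i = range (\<lambda>c. gscale c ((Dgr ^^ i) (homog 2 \<phi>)))"

end

theory Submission
  imports Defs "HOL-Complex_Analysis.Conformal_Mappings"
begin

text \<open>
  Write \<open>f|\<gamma>\<close> for the action of weight \<open>k\<close> and \<open>X = c/(cz+d)\<close>, so that a quasimodular form satisfies
  \<open>f|\<gamma> = \<Sum> f\<^sub>j X\<^sup>j\<close>. The theorem rests on two properties of a lattice: for each \<open>z\<close> the number \<open>X\<close>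
  takes infinitely many values (\<open>infinite_slopes\<close>), and there are no modular forms of negative weight
  and only constants in weight \<open>0\<close> (\<open>modular_forms_neg\<close>, \<open>modular_forms_0\<close>).

  The first property makes identities between polynomials in \<open>X\<close> equivalent to identities between
  coefficients. Comparing \<open>f|(AB)\<close> with \<open>(f|A)|B\<close> shows that \<open>f\<^sub>j\<close> is again quasimodular, of weight
  \<open>k - 2j\<close> (\<open>quasi_coeff_expansion\<close>); in particular the top coefficient of a form of depth \<open>p\<close> is modular
  of weight \<open>k - 2p\<close>, which by the second property forces \<open>p \<le> k/2\<close>. Differentiating the transformation
  law shows that \<open>D\<close> raises the depth by one and multiplies the top coefficient by \<open>k - p\<close>
  (\<open>quasi_expansion_Dz\<close>). Hence, as long as \<open>p < k/2\<close>, a multiple of \<open>D\<^sup>p f\<^sub>p\<close> has the top coefficient of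
  \<open>f\<close>, and subtracting it lowers the depth. If \<open>p = k/2 > 0\<close>, then \<open>f\<^sub>p\<close> is a constant, and
  \<open>f\<^sub>p\<^sub>-\<^sub>1\<close> is an element of weight \<open>2\<close> whose image under \<open>\<delta>\<close> is \<open>p f\<^sub>p\<close>. So either \<open>f\<^sub>p = 0\<close>, or \<open>\<phi>\<close> exists and
  \<open>D\<^sup>p\<^sup>-\<^sup>1 \<phi>\<close> can be used instead. Induction on the depth gives the decomposition (\<open>decompose\<close>), and it is direct
  because the summands have different depths in each weight (\<open>decompose_unique\<close>).

  Both properties of the lattice follow from finite covolume through the mass transport principle
  (\<open>mass_transport\<close>): if \<open>K(z,w) \<ge> 0\<close> is invariant under the diagonal action, then on average over a fundamental domain \<open>F\<close> the mass
  \<open>\<integral> K(z,w) dw\<close> sent out equals the mass \<open>\<integral> K(w,z) dw\<close> received.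

  If \<open>X\<close> took only finitely many values, the orbit of \<open>\<infinity>\<close> would be finite. Let each \<open>z\<close> send mass, for each
  point \<open>p\<close> of the orbit, to those points of a fixed hyperbolic disc around \<open>z\<close> that are closer to \<open>p\<close> than
  \<open>z\<close> in the sense of horocycles. It sends out the part of a disc inside a horocycle through its centre and receives the
  part outside, which is larger.

  For a modular form \<open>f\<close> of weight \<open>-n \<le> 0\<close> the function \<open>q = |f|\<^sup>2 / y\<^sup>n\<close> is invariant, and
  \<open>v = log max(1, q)\<close> is at most its mean over hyperbolic discs. Moderate growth bounds \<open>v\<close> by a linear function of
  the distance \<open>h\<close> to the orbit of \<open>\<i>\<close>. Transport \<open>v(w) \<phi>\<^sub>R(z)\<close> between close points, where the cutoff
  \<open>\<phi>\<^sub>R\<close> decreases from \<open>1\<close> at \<open>h = R\<close> to \<open>0\<close> at \<open>h = 2R\<close>: the defect in the mean value inequality, integrated over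
  \<open>h \<le> R\<close>, is at most a constant times \<open>(1/R) R\<close> times the area of the part of \<open>F\<close> with
  \<open>h \<ge> R - O(1)\<close>, and so tends to \<open>0\<close> (\<open>submean_imp_mean\<close>). Hence \<open>v\<close> equals its means. Applied to all
  multiples of \<open>f\<close> this makes \<open>q\<close> constant, and the maximum principle for \<open>f(z) / (z+\<i>)\<^sup>n\<close> finishes the proof.
\<close>

section \<open>Moebius transformations of the upper half plane\<close>

lemma open_uhp: "open uhp"
  unfolding uhp_def by (rule open_halfspace_Im_gt)

lemma connected_uhp: "connected uhp"
  unfolding uhp_def by (intro convex_connected convex_halfspace_Im_gt)

lemma borel_uhp [measurable]: "uhp \<in> sets borel"
  using open_uhp by (rule borel_open)

lemma uhpD: "z \<in> uhp \<Longrightarrow> Im z > 0"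
  by (simp add: uhp_def)

lemma mat2_mult_entry: "(A ** B) $ i $ j = A$i$1 * B$1$j + A$i$2 * B$2$(j::2)" for A B :: "real^2^2"
  by (simp add: matrix_matrix_mult_def sum_2)

lemma mat2_eq_iff: "A = B \<longleftrightarrow> A$1$1 = B$1$1 \<and> A$1$2 = B$1$2 \<and> A$2$1 = B$2$1 \<and> A$2$2 = B$2$2"
  for A B :: "real^2^2"
  by (auto simp: vec_eq_iff forall_2)

lemma det_2_eq_1D: "det (A::real^2^2) = 1 \<Longrightarrow> A$1$1 * A$2$2 = 1 + A$1$2 * A$2$1"
  by (simp add: det_2)

lemma Im_autom: "Im (autom A z) = A$2$1 * Im z"
  by (simp add: autom_def)

lemma autom_nonzero:
  assumes "det A = 1" "z \<in> uhp" shows "autom A z \<noteq> 0"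
proof
  assume *: "autom A z = 0"
  hence "A$2$1 = 0" using Im_autom[of A z] uhpD[OF assms(2)] by auto
  moreover from this * have "A$2$2 = 0" by (simp add: autom_def)
  ultimately show False using det_2_eq_1D[OF assms(1)] by simp
qed

lemma moebius_diff:
  assumes "det A = 1" "z \<in> uhp" "w \<in> uhp"
  shows "moebius A z - moebius A w = (z - w) / (autom A z * autom A w)"
proof -
  have "(of_real (A$1$1) * z + of_real (A$1$2)) * autom A w -
         (of_real (A$1$1) * w + of_real (A$1$2)) * autom A z
        = of_real (A$1$1 * A$2$2 - A$1$2 * A$2$1) * (z - w)"
    unfolding autom_def by (simp add: algebra_simps)
  hence "(of_real (A$1$1) * z + of_real (A$1$2)) * autom A w -
         (of_real (A$1$1) * w + of_real (A$1$2)) * autom A z = z - w"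
    using det_2_eq_1D[OF assms(1)] by simp
  thus ?thesis using autom_nonzero[OF assms(1)] assms(2,3)
    by (simp add: moebius_def diff_frac_eq)
qed

lemma Im_moebius:
  assumes "det A = 1"
  shows "Im (moebius A z) = Im z / (cmod (autom A z))\<^sup>2"
proof -
  have e: "Im (u / v) = (Im u * Re v - Re u * Im v) / (cmod v)\<^sup>2" for u v
    by (simp add: Im_divide cmod_power2)
  have "Im (moebius A z) = ((A$1$1*A$2$2 - A$1$2*A$2$1) * Im z) / (cmod (autom A z))\<^sup>2"
    unfolding moebius_def e by (simp add: autom_def algebra_simps)
  thus ?thesis using det_2_eq_1D[OF assms] by simp
qed

lemma moebius_uhp: "det A = 1 \<Longrightarrow> z \<in> uhp \<Longrightarrow> moebius A z \<in> uhp"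
  using autom_nonzero[of A z] by (simp add: uhp_def Im_moebius)

lemma autom_mult:
  assumes "det B = 1" "z \<in> uhp"
  shows "autom (A ** B) z = autom A (moebius B z) * autom B z"
  using autom_nonzero[OF assms]
  by (simp add: autom_def[of A] autom_def[of "A ** B"] moebius_def mat2_mult_entry field_simps)
     (simp add: autom_def algebra_simps)

lemma moebius_mult:
  assumes "det A = 1" "det B = 1" "z \<in> uhp"
  shows "moebius (A ** B) z = moebius A (moebius B z)"
proof -
  have b: "autom B z \<noteq> 0" "autom A (moebius B z) \<noteq> 0"
    using assms by (simp_all add: autom_nonzero moebius_uhp)
  have "of_real ((A**B)$1$1) * z + of_real ((A**B)$1$2)
        = (of_real (A$1$1) * moebius B z + of_real (A$1$2)) * autom B z"
    using b(1) by (simp add: moebius_def mat2_mult_entry field_simps) (simp add: autom_def algebra_simps)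
  thus ?thesis using b by (simp add: moebius_def[of "A ** B"] moebius_def[of A] autom_mult[OF assms(2,3)])
qed

lemma moebius_one [simp]: "moebius (mat 1) z = z"
  by (simp add: moebius_def autom_def mat_def)

lemma autom_one [simp]: "autom (mat 1) z = 1"
  by (simp add: autom_def mat_def)

lemma autom_uminus [simp]: "autom (- A) z = - autom A z"
  by (simp add: autom_def)

lemma moebius_uminus [simp]: "moebius (- A) z = moebius A z"
proof -
  have "of_real ((-A)$1$1) * z + of_real ((-A)$1$2) = - (of_real (A$1$1) * z + of_real (A$1$2))"
    by simp
  thus ?thesis unfolding moebius_def autom_uminus by (metis minus_divide_divide)
qed

lemma moebius_inverse:
  assumes "det A = 1" "det B = 1" "A ** B = mat 1" "z \<in> uhp"
  shows "moebius A (moebius B z) = z"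
  using moebius_mult[OF assms(1,2,4)] assms(3) by simp

lemma moebius_has_derivative:
  assumes "det A = 1" "z \<in> uhp"
  shows "(moebius A has_field_derivative 1 / (autom A z)\<^sup>2) (at z)"
proof -
  have "of_real (A$1$1) * autom A z - (of_real (A$1$1) * z + of_real (A$1$2)) * of_real (A$2$1)
        = of_real (A$1$1 * A$2$2 - A$1$2 * A$2$1)"
    unfolding autom_def by (simp add: algebra_simps)
  hence "of_real (A$1$1) * autom A z - (of_real (A$1$1) * z + of_real (A$1$2)) * of_real (A$2$1) = 1"
    using det_2_eq_1D[OF assms(1)] by simp
  moreover have "((\<lambda>z. (of_real (A$1$1) * z + of_real (A$1$2)) / autom A z) has_field_derivative
      (of_real (A$1$1) * autom A z - (of_real (A$1$1) * z + of_real (A$1$2)) * of_real (A$2$1))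
        / (autom A z * autom A z)) (at z)"
    using autom_nonzero[OF assms] unfolding autom_def
    by (auto intro!: derivative_eq_intros)
  ultimately show ?thesis
    by (simp add: moebius_def[abs_def] power2_eq_square)
qed

lemma autom_has_derivative: "(autom A has_field_derivative of_real (A$2$1)) (at z)"
  unfolding autom_def[abs_def] by (auto intro!: derivative_eq_intros)

lemma holomorphic_moebius: "det A = 1 \<Longrightarrow> moebius A holomorphic_on uhp"
  by (meson field_differentiable_at_within field_differentiable_def holomorphic_on_def moebius_has_derivative)

text \<open>
  On matrices of determinant \<open>1\<close> the adjugate is the inverse.
\<close>

definition mat2_adj :: "real^2^2 \<Rightarrow> real^2^2" where
  "mat2_adj A = vector [vector [A$2$2, - A$1$2], vector [- A$2$1, A$1$1]]"

lemma mat2_adj_inverse: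
  assumes "det A = 1"
  shows "A ** mat2_adj A = mat 1" "mat2_adj A ** A = mat 1"
  using assms by (simp_all add: det_2 mat2_eq_iff mat2_mult_entry mat_def mat2_adj_def algebra_simps)

lemma det_mat2_adj [simp]: "det (mat2_adj A) = det A"
  by (simp add: det_2 mat2_adj_def algebra_simps)

lemma mat2_adj_adj [simp]: "mat2_adj (mat2_adj A) = A"
  by (simp add: mat2_eq_iff mat2_adj_def)

lemma moebius_adj:
  assumes "det A = 1" "z \<in> uhp"
  shows "moebius A (moebius (mat2_adj A) z) = z" "moebius (mat2_adj A) (moebius A z) = z"
  using assms by (simp_all add: moebius_inverse mat2_adj_inverse)

section \<open>Invariance of the hyperbolic area\<close>

definition plane_of_vec :: "real^2 \<Rightarrow> complex" where
  "plane_of_vec x = Complex (x$1) (x$2)"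

definition vec_of_plane :: "complex \<Rightarrow> real^2" where
  "vec_of_plane z = vector [Re z, Im z]"

lemma plane_of_vec_inverse [simp]: "plane_of_vec (vec_of_plane z) = z"
  by (simp add: plane_of_vec_def vec_of_plane_def)

lemma vec_of_plane_inverse [simp]: "vec_of_plane (plane_of_vec x) = x"
  by (simp add: plane_of_vec_def vec_of_plane_def vec_eq_iff forall_2)

lemma linear_plane_of_vec: "bounded_linear plane_of_vec"
  by (rule linear_conv_bounded_linear[THEN iffD1], rule linearI)
     (auto simp: plane_of_vec_def complex_eq_iff)

lemma linear_vec_of_plane: "bounded_linear vec_of_plane"
  by (rule linear_conv_bounded_linear[THEN iffD1], rule linearI)
     (auto simp: vec_of_plane_def vec_eq_iff forall_2)

lemma measurable_plane_of_vec [measurable]: "plane_of_vec \<in> borel_measurable borel"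
  by (intro borel_measurable_continuous_onI linear_continuous_on linear_plane_of_vec)

lemma measurable_vec_of_plane [measurable]: "vec_of_plane \<in> borel_measurable borel"
  by (intro borel_measurable_continuous_onI linear_continuous_on linear_vec_of_plane)

lemma lborel_complex_eq_distr: "(lborel :: complex measure) = distr lborel borel plane_of_vec"
proof (rule lborel_eqI)
  fix l u :: complex
  assume le: "\<And>b. b \<in> Basis \<Longrightarrow> l \<bullet> b \<le> u \<bullet> b"
  have le': "Re l \<le> Re u" "Im l \<le> Im u" using le[of 1] le[of \<i>] by (auto simp: Basis_complex_def)
  have "plane_of_vec -` box l u = box (vec_of_plane l) (vec_of_plane u)"
    by (auto simp: mem_box plane_of_vec_def vec_of_plane_def Basis_complex_def Basis_vec_def
          inner_axis forall_2 cart_eq_inner_axis[symmetric])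
  hence "emeasure (distr lborel borel plane_of_vec) (box l u) = emeasure lborel (box (vec_of_plane l) (vec_of_plane u))"
    by (simp add: emeasure_distr)
  also have "\<dots> = (\<Prod>b\<in>Basis. (vec_of_plane u - vec_of_plane l) \<bullet> b)"
  proof (rule emeasure_lborel_box)
    have "\<forall>i. vec_of_plane l $ i \<le> vec_of_plane u $ i"
      using le' by (simp add: forall_2 vec_of_plane_def)
    thus "vec_of_plane l \<bullet> b \<le> vec_of_plane u \<bullet> b" if "b \<in> Basis" for b
      using that by (auto simp: Basis_vec_def inner_axis)
  qed
  also have "(\<Prod>b\<in>Basis. (vec_of_plane u - vec_of_plane l) \<bullet> b) = (Re u - Re l) * (Im u - Im l)"
  proof -
    have B: "(Basis :: (real^2) set) = {axis 1 1, axis 2 1}"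
      by (auto simp: Basis_vec_def UNIV_2)
    have "axis 1 1 \<noteq> (axis 2 1 :: real^2)" by (simp add: axis_eq_axis)
    thus ?thesis unfolding B by (simp add: inner_axis vec_of_plane_def)
  qed
  also have "\<dots> = (\<Prod>b\<in>Basis. (u - l) \<bullet> b)"
    by (simp add: Basis_complex_def)
  finally show "emeasure (distr lborel borel plane_of_vec) (box l u) = (\<Prod>b\<in>Basis. (u - l) \<bullet> b)" .
qed simp

lemma det_complex_mult:
  "det (matrix (\<lambda>x. vec_of_plane (c * plane_of_vec x))) = (cmod c)\<^sup>2"
  by (simp add: det_2 matrix_def vec_of_plane_def plane_of_vec_def axis_def cmod_power2 flip: power2_eq_square)

text \<open>
  The change of variables theorem for finite measures is an equivalence, and so it also decides
  whether both sides are infinite.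
\<close>

lemma emeasure_lborel_differentiable_image:
  fixes g :: "real^2 \<Rightarrow> real^2"
  assumes S: "S \<in> sets borel" and gS: "g ` S \<in> sets borel"
    and der: "\<And>x. x \<in> S \<Longrightarrow> (g has_derivative g' x) (at x within S)"
    and inj: "inj_on g S"
    and J: "J \<in> borel_measurable borel" "\<And>x. 0 \<le> J x" "\<And>x. x \<in> S \<Longrightarrow> \<bar>det (matrix (g' x))\<bar> = J x"
  shows "emeasure lborel (g ` S) = (\<integral>\<^sup>+x. indicator S x * ennreal (J x) \<partial>lborel)"
proof -
  let ?I = "\<integral>\<^sup>+x. indicator S x * ennreal (J x) \<partial>lborel"
  have eq: "?I = (\<integral>\<^sup>+x. ennreal (indicator S x * J x) \<partial>lborel)"
    by (intro nn_integral_cong) (auto simp: indicator_def)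
  have iff: "(g ` S \<in> lmeasurable \<and> measure lebesgue (g ` S) = m)
     \<longleftrightarrow> ((\<lambda>x. indicator S x * J x) has_integral m) UNIV" for m
  proof -
    have "((\<lambda>x. \<bar>det (matrix (g' x))\<bar>) has_integral m) S \<longleftrightarrow> (J has_integral m) S"
      using J(3) by (intro has_integral_cong) auto
    also have "\<dots> \<longleftrightarrow> ((\<lambda>x. indicator S x * J x) has_integral m) UNIV"
    proof -
      have "(\<lambda>x. indicator S x * J x) = (\<lambda>x. if x \<in> S then J x else 0)"
        by (auto simp: indicator_def)
      thus ?thesis by (simp only: has_integral_restrict_UNIV)
    qed
    finally show ?thesis
      using has_measure_differentiable_image[of S g g' m] S der inj
      by auto
  qed
  have em: "emeasure lborel (g ` S) = emeasure lebesgue (g ` S)"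
    using gS by simp
  have meas: "(\<lambda>x. indicator S x * J x) \<in> borel_measurable borel"
    using S J(1) by measurable
  show ?thesis
  proof (cases "?I = \<infinity>")
    case False
    then obtain r where r: "0 \<le> r" "?I = ennreal r" by (cases ?I) auto
    have "((\<lambda>x. indicator S x * J x) has_integral r) UNIV"
      using r eq J(2) by (intro nn_integral_has_integral meas) (auto simp: indicator_def)
    hence "g ` S \<in> lmeasurable" "measure lebesgue (g ` S) = r" using iff by blast+
    thus ?thesis using r em by (simp add: emeasure_eq_measure2)
  next
    case True
    have "g ` S \<notin> lmeasurable"
    proof
      assume "g ` S \<in> lmeasurable"
      hence "((\<lambda>x. indicator S x * J x) has_integral (measure lebesgue (g ` S))) UNIV" using iff by blast
      hence "?I = ennreal (measure lebesgue (g ` S))"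
        unfolding eq using J(2) by (intro nn_integral_has_integral_lborel meas) (auto simp: indicator_def)
      thus False using True by simp
    qed
    hence "emeasure lebesgue (g ` S) = \<infinity>"
      using gS by (auto simp: fmeasurable_def less_top[symmetric])
    thus ?thesis using True em by simp
  qed
qed

lemma measurable_autom [measurable]: "autom A \<in> borel_measurable borel"
  unfolding autom_def[abs_def] by measurable

lemma measurable_moebius [measurable]: "moebius A \<in> borel_measurable borel"
  unfolding moebius_def[abs_def] by measurable

lemma moebius_inj:
  assumes "det A = 1" "z \<in> uhp" "w \<in> uhp" "moebius A z = moebius A w" shows "z = w"
  using moebius_diff[OF assms(1-3)] autom_nonzero[OF assms(1)] assms by auto

lemma moebius_vimage:
  assumes "det A = 1"
  shows "moebius A ` (uhp \<inter> moebius A -` X) = uhp \<inter> X"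
proof -
  define B where "B = mat2_adj A"
  have B: "det B = 1" "A ** B = mat 1" using assms by (simp_all add: B_def mat2_adj_inverse)
  have "w \<in> moebius A ` (uhp \<inter> moebius A -` X)" if "w \<in> uhp" "w \<in> X" for w
    using that moebius_inverse[OF assms B that(1)] moebius_uhp[OF B(1) that(1)]
    by (intro image_eqI[of _ _ "moebius B w"]) auto
  thus ?thesis using moebius_uhp[OF assms] by auto
qed

text \<open>
  As a map of the real plane, multiplication by the complex derivative \<open>(cz+d)\<^sup>-\<^sup>2\<close> has determinant \<open>|cz+d|\<^sup>-\<^sup>4\<close>.
\<close>

lemma emeasure_lborel_moebius_image:
  assumes A: "det A = 1" and X: "X \<in> sets borel"
  shows "emeasure lborel (uhp \<inter> X) =
    (\<integral>\<^sup>+z. indicator (uhp \<inter> moebius A -` X) z * ennreal (1 / (cmod (autom A z))^4) \<partial>lborel)"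
proof -
  define E where "E = uhp \<inter> moebius A -` X"
  have E: "E \<in> sets borel"
    unfolding E_def using X measurable_sets[OF measurable_moebius[of A] X] by (auto intro: sets.Int)
  define S where "S = plane_of_vec -` E"
  have S: "S \<in> sets borel"
    using measurable_sets[OF measurable_plane_of_vec E] by (simp add: S_def)
  define g where "g = (\<lambda>x. vec_of_plane (moebius A (plane_of_vec x)))"
  have gS: "g ` S = plane_of_vec -` (uhp \<inter> X)"
  proof -
    have "g ` S = vec_of_plane ` (moebius A ` E)"
      unfolding g_def S_def by (auto simp: image_iff) (metis plane_of_vec_inverse vimage_eq)+
    also have "moebius A ` E = uhp \<inter> X" unfolding E_def by (rule moebius_vimage[OF A])
    finally show ?thesis by (auto simp: image_iff) (metis vec_of_plane_inverse IntI)
  qed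
  have "plane_of_vec -` (uhp \<inter> X) \<in> sets borel"
    using measurable_sets[OF measurable_plane_of_vec, of "uhp \<inter> X"] X borel_uhp by simp
  hence gSb: "g ` S \<in> sets borel" unfolding gS .
  have "emeasure lborel (uhp \<inter> X) = emeasure lborel (g ` S)"
    unfolding gS using X borel_uhp
    by (subst lborel_complex_eq_distr) (simp add: emeasure_distr)
  also have "\<dots> = (\<integral>\<^sup>+x. indicator S x * ennreal (1 / (cmod (autom A (plane_of_vec x)))^4) \<partial>lborel)"
  proof (rule emeasure_lborel_differentiable_image[OF S gSb, where
      g' = "\<lambda>x. (\<lambda>h. vec_of_plane (1 / (autom A (plane_of_vec x))\<^sup>2 * plane_of_vec h))"])
    fix x assume x: "x \<in> S"
    hence z: "plane_of_vec x \<in> uhp" by (simp add: S_def E_def)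
    have d: "(moebius A has_derivative (*) (1 / (autom A (plane_of_vec x))\<^sup>2)) (at (plane_of_vec x))"
      using moebius_has_derivative[OF A z] by (simp add: has_field_derivative_def)
    have "((\<lambda>x. moebius A (plane_of_vec x)) has_derivative
        (\<lambda>h. 1 / (autom A (plane_of_vec x))\<^sup>2 * plane_of_vec h)) (at x within S)"
      by (rule has_derivative_compose[OF bounded_linear_imp_has_derivative[OF linear_plane_of_vec] d])
    thus "(g has_derivative (\<lambda>h. vec_of_plane (1 / (autom A (plane_of_vec x))\<^sup>2 * plane_of_vec h))) (at x within S)"
      unfolding g_def by (rule bounded_linear.has_derivative[OF linear_vec_of_plane])
    show "\<bar>det (matrix (\<lambda>h. vec_of_plane (1 / (autom A (plane_of_vec x))\<^sup>2 * plane_of_vec h)))\<bar>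
        = 1 / (cmod (autom A (plane_of_vec x)))^4"
      unfolding det_complex_mult by (simp add: norm_divide norm_power power_divide flip: power_mult)
  next
    show "inj_on g S"
    proof (rule inj_onI)
      fix x y assume "x \<in> S" "y \<in> S" "g x = g y"
      hence "plane_of_vec x = plane_of_vec y"
        using moebius_inj[OF A] unfolding g_def S_def E_def by (metis IntD1 plane_of_vec_inverse vimageE)
      thus "x = y" by (metis vec_of_plane_inverse)
    qed
  qed auto
  also have "\<dots> = (\<integral>\<^sup>+z. indicator E z * ennreal (1 / (cmod (autom A z))^4) \<partial>lborel)"
    using E by (subst lborel_complex_eq_distr, subst nn_integral_distr)
      (auto intro!: nn_integral_cong simp: S_def indicator_def)
  finally show ?thesis unfolding E_def .
qed

lemma sets_hyp_area [simp, measurable_cong]: "sets hyp_area = sets borel"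
  and space_hyp_area [simp]: "space hyp_area = UNIV"
  by (simp_all add: hyp_area_def)

lemma nn_integral_hyp_area:
  assumes "g \<in> borel_measurable borel"
  shows "(\<integral>\<^sup>+z. g z \<partial>hyp_area) = (\<integral>\<^sup>+z. indicator uhp z * (ennreal (1 / (Im z)\<^sup>2) * g z) \<partial>lborel)"
  using assms unfolding hyp_area_def by (subst nn_integral_density) (auto simp: mult.assoc)

text \<open>
  The Jacobian \<open>|cz+d|\<^sup>-\<^sup>4\<close> cancels against the change of \<open>1/y\<^sup>2\<close>, because \<open>y\<close> is divided by \<open>|cz+d|\<^sup>2\<close>.
\<close>

lemma hyp_area_moebius_invariant:
  assumes A: "det A = 1"
  shows "distr hyp_area borel (moebius A) = hyp_area"
proof -
  define j where "j = (\<lambda>z. indicator uhp z * ennreal (1 / (cmod (autom A z))^4))"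
  have [measurable]: "j \<in> borel_measurable borel" unfolding j_def by measurable
  have 1: "distr (density lborel j) borel (moebius A) = density lborel (indicator uhp)"
  proof (rule measure_eqI)
    fix X assume "X \<in> sets (distr (density lborel j) borel (moebius A))"
    hence X [measurable]: "X \<in> sets borel" by simp
    have "emeasure (distr (density lborel j) borel (moebius A)) X = (\<integral>\<^sup>+z. j z * indicator (moebius A -` X) z \<partial>lborel)"
      using measurable_sets[OF measurable_moebius X] by (simp add: emeasure_distr emeasure_density)
    also have "\<dots> = (\<integral>\<^sup>+z. indicator (uhp \<inter> moebius A -` X) z * ennreal (1 / (cmod (autom A z))^4) \<partial>lborel)"
      by (intro nn_integral_cong) (auto simp: j_def indicator_def)
    also have "\<dots> = emeasure lborel (uhp \<inter> X)" using emeasure_lborel_moebius_image[OF A X] by simp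
    also have "\<dots> = emeasure (density lborel (indicator uhp)) X"
      by (subst emeasure_density) (auto simp: indicator_inter_arith simp flip: nn_integral_indicator)
    finally show "emeasure (distr (density lborel j) borel (moebius A)) X = emeasure (density lborel (indicator uhp)) X" .
  qed auto
  show ?thesis
  proof (rule measure_eqI)
    fix X assume "X \<in> sets (distr hyp_area borel (moebius A))"
    hence X [measurable]: "X \<in> sets borel" by simp
    have XA [measurable]: "moebius A -` X \<in> sets borel" using measurable_sets[OF measurable_moebius X] by simp
    let ?h = "\<lambda>z. ennreal (1 / (Im z)\<^sup>2) * indicator X z"
    have "emeasure hyp_area X = (\<integral>\<^sup>+z. indicator X z \<partial>hyp_area)" by simp
    also have "\<dots> = (\<integral>\<^sup>+z. ?h z \<partial>density lborel (indicator uhp))"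
      by (subst nn_integral_hyp_area) (auto simp: nn_integral_density)
    also have "\<dots> = (\<integral>\<^sup>+z. j z * ?h (moebius A z) \<partial>lborel)"
      unfolding 1[symmetric] by (subst nn_integral_distr) (auto simp: nn_integral_density)
    also have "\<dots> = (\<integral>\<^sup>+z. indicator uhp z * (ennreal (1 / (Im z)\<^sup>2) * indicator (moebius A -` X) z) \<partial>lborel)"
    proof (rule nn_integral_cong)
      fix z
      have "ennreal (1 / (cmod (autom A z))^4) * ennreal (1 / (Im (moebius A z))\<^sup>2) = ennreal (1 / (Im z)\<^sup>2)"
        if "z \<in> uhp"
      proof -
        have "cmod (autom A z) > 0" "Im z > 0" using that autom_nonzero[OF A that] uhpD by auto
        thus ?thesis by (simp add: Im_moebius[OF A] power_divide flip: ennreal_mult power_mult)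
      qed
      thus "j z * ?h (moebius A z) = indicator uhp z * (ennreal (1 / (Im z)\<^sup>2) * indicator (moebius A -` X) z)"
        by (auto simp: j_def indicator_def mult.assoc)
    qed
    also have "\<dots> = emeasure hyp_area (moebius A -` X)"
      by (subst nn_integral_hyp_area[symmetric]) auto
    also have "\<dots> = emeasure (distr hyp_area borel (moebius A)) X"
      by (simp add: emeasure_distr)
    finally show "emeasure (distr hyp_area borel (moebius A)) X = emeasure hyp_area X" by simp
  qed simp
qed

lemma nn_integral_moebius:
  assumes "det A = 1" and [measurable]: "g \<in> borel_measurable borel"
  shows "(\<integral>\<^sup>+z. g (moebius A z) \<partial>hyp_area) = (\<integral>\<^sup>+z. g z \<partial>hyp_area)"
  using nn_integral_distr[of "moebius A" hyp_area borel g] hyp_area_moebius_invariant[OF assms(1)] by simp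

lemma AE_hyp_area_uhp: "AE z in hyp_area. z \<in> uhp"
  unfolding hyp_area_def by (subst AE_density) (auto simp: indicator_def)

lemma vimage_moebius_eq_image_adj:
  assumes "det A = 1"
  shows "uhp \<inter> moebius A -` X = moebius (mat2_adj A) ` (uhp \<inter> X)"
proof -
  have "z \<in> moebius (mat2_adj A) ` (uhp \<inter> X)" if "z \<in> uhp" "moebius A z \<in> X" for z
    using that moebius_uhp[OF assms] moebius_adj(2)[OF assms]
    by (intro image_eqI[of _ _ "moebius A z"]) auto
  moreover have "moebius (mat2_adj A) u \<in> uhp" if "u \<in> uhp" for u
    using that assms by (intro moebius_uhp) auto
  ultimately show ?thesis using moebius_adj(1)[OF assms] by auto
qed

lemma AE_moebius:
  assumes "det A = 1" "AE z in hyp_area. P z" "{z. P z} \<in> sets borel"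
  shows "AE z in hyp_area. P (moebius A z)"
proof -
  have "AE z in distr hyp_area borel (moebius A). P z"
    unfolding hyp_area_moebius_invariant[OF assms(1)] by (rule assms(2))
  thus ?thesis using assms(3) by (subst (asm) AE_distr_iff) auto
qed

section \<open>Hyperbolic discs\<close>

text \<open>
  The hyperbolic distance \<open>d\<close> satisfies \<open>4 sinh\<^sup>2(d/2) = |z-w|\<^sup>2 / (Im z Im w)\<close>. So this is the relation of
  lying at a distance below a fixed bound, written in a way that avoids \<open>d\<close>.
\<close>

definition close :: "complex \<Rightarrow> complex \<Rightarrow> bool" where
  "close z w \<longleftrightarrow> z \<in> uhp \<and> w \<in> uhp \<and> (cmod (z - w))\<^sup>2 < Im z * Im w"

lemma close_sym: "close z w \<longleftrightarrow> close w z"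
  by (auto simp: close_def norm_minus_commute mult.commute)

lemma close_refl: "z \<in> uhp \<Longrightarrow> close z z"
  by (simp add: close_def uhp_def)

lemma closeD: "close z w \<Longrightarrow> z \<in> uhp" "close z w \<Longrightarrow> w \<in> uhp"
  by (auto simp: close_def)

lemma close_moebius:
  assumes A: "det A = 1" and zw: "z \<in> uhp" "w \<in> uhp"
  shows "close (moebius A z) (moebius A w) \<longleftrightarrow> close z w"
proof -
  define P where "P = (cmod (autom A z))\<^sup>2 * (cmod (autom A w))\<^sup>2"
  have p: "0 < P"
    unfolding P_def using autom_nonzero[OF A] zw by simp
  have "(cmod (moebius A z - moebius A w))\<^sup>2
      = (cmod (z - w))\<^sup>2 / P"
    unfolding moebius_diff[OF A zw] P_def by (simp add: norm_divide norm_mult power_divide power_mult_distrib)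
  moreover have "Im (moebius A z) * Im (moebius A w)
      = Im z * Im w / P"
    by (simp add: Im_moebius[OF A] P_def)
  ultimately show ?thesis
    using p zw moebius_uhp[OF A] by (simp add: close_def divide_less_cancel)
qed

lemma open_close: "open {p. close (fst p) (snd p)}"
proof -
  have "{p. close (fst p) (snd p)} = {p. 0 < Im (fst p)} \<inter> {p. 0 < Im (snd p)} \<inter>
      {p. (cmod (fst p - snd p))\<^sup>2 < Im (fst p) * Im (snd p)}"
    by (auto simp: close_def uhp_def)
  also have "open \<dots>"
    by (intro open_Int open_Collect_less continuous_intros)
  finally show ?thesis .
qed

lemma open_close_section: "open {w. close z w}"
proof -
  have "{w. close z w} = Pair z -` {p. close (fst p) (snd p)}" by auto
  thus ?thesis using open_vimage[OF open_close, of "Pair z"] by (simp add: continuous_intros)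
qed

lemma measurable_close: "{p. close (fst p) (snd p)} \<in> sets (borel \<Otimes>\<^sub>M borel)"
  using borel_open[OF open_close] unfolding borel_prod .

lemma measurable_close_section [measurable]: "{w. close z w} \<in> sets borel"
  by (rule borel_open[OF open_close_section])

text \<open>
  The quotient \<open>t\<close> of the imaginary parts satisfies \<open>(t-1)\<^sup>2 < t\<close>, and therefore \<open>t < (3 + \<surd>5)/2\<close>.
\<close>

lemma close_Im_less:
  assumes "close z w" shows "Im w < 3 * Im z"
proof (rule ccontr)
  assume "\<not> Im w < 3 * Im z"
  hence h: "3 * Im z \<le> Im w" by simp
  have p: "0 < Im z" "0 < Im w" using assms by (auto simp: close_def uhp_def)
  have "(Im w - Im z)\<^sup>2 \<le> (cmod (z - w))\<^sup>2"
    by (metis abs_Im_le_cmod abs_le_square_iff abs_norm_cancel minus_complex.sel(2) norm_minus_commute)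
  also have "\<dots> < Im z * Im w" using assms by (simp add: close_def)
  finally have "(Im w)\<^sup>2 + (Im z)\<^sup>2 < 3 * (Im z * Im w)"
    by (simp add: power2_eq_square algebra_simps)
  moreover have "3 * (Im z * Im w) \<le> (Im w)\<^sup>2"
    using mult_right_mono[OF h, of "Im w"] p by (simp add: power2_eq_square algebra_simps)
  ultimately show False using zero_le_power2[of "Im z"] by linarith
qed

lemma close_norm_le:
  assumes "close z w" shows "(cmod w)\<^sup>2 \<le> 8 * (cmod z)\<^sup>2"
proof -
  have p: "0 < Im z" "0 < Im w" using assms by (auto simp: close_def uhp_def)
  have "(cmod w)\<^sup>2 \<le> (cmod z + cmod (z - w))\<^sup>2"
    by (intro power_mono) (metis norm_minus_commute norm_triangle_sub, simp)
  also have "\<dots> \<le> 2 * (cmod z)\<^sup>2 + 2 * (cmod (z - w))\<^sup>2"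
    using sum_squares_bound[of "cmod z" "cmod (z-w)"] by (simp add: power2_sum)
  also have "(cmod (z - w))\<^sup>2 \<le> Im z * (3 * Im z)"
    using assms close_Im_less[OF assms] p mult_left_mono[of "Im w" "3 * Im z" "Im z"]
    unfolding close_def by linarith
  also have "Im z * (3 * Im z) \<le> 3 * (cmod z)\<^sup>2"
  proof -
    have "(Im z)\<^sup>2 \<le> (cmod z)\<^sup>2" by (simp add: cmod_power2)
    thus ?thesis by (simp add: power2_eq_square)
  qed
  finally show ?thesis by simp
qed

text \<open>
  Already the upper triangular matrices act transitively. For them the action is affine, so a statement
  about the disc around \<open>z\<close> is carried to the disc around \<open>\<i>\<close> without an automorphy factor.
\<close>

lemma moebius_transitive:
  assumes "z \<in> uhp"
  obtains A where "det A = 1" "A$2$1 = 0" "moebius A \<i> = z"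
    "\<And>w. moebius A w = of_real (Im z) * w + of_real (Re z)"
proof
  define s where "s = sqrt (Im z)"
  have s: "s > 0" "s * s = Im z" using assms by (auto simp: s_def uhp_def)
  define A :: "real^2^2" where "A = vector [vector [s, Re z / s], vector [0, 1 / s]]"
  show "det A = 1" "A$2$1 = 0" using s by (simp_all add: A_def det_2)
  show m: "moebius A w = of_real (Im z) * w + of_real (Re z)" for w
  proof -
    have c: "complex_of_real s \<noteq> 0" using s by simp
    have "moebius A w = (of_real s * w + of_real (Re z) / of_real s) * of_real s"
      using c by (simp add: moebius_def autom_def A_def)
    also have "\<dots> = of_real (s * s) * w + of_real (Re z)"
      using c by (simp add: field_simps)
    finally show ?thesis using s by simp
  qed
  show "moebius A \<i> = z" unfolding m by (simp add: complex_eq_iff)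
qed

definition disc_area :: ennreal where
  "disc_area = emeasure hyp_area {w. close \<i> w}"

lemma nn_integral_close:
  assumes "det A = 1" "z \<in> uhp" and [measurable]: "g \<in> borel_measurable borel"
  shows "(\<integral>\<^sup>+w. indicator {w. close (moebius A z) w} w * g w \<partial>hyp_area)
       = (\<integral>\<^sup>+w. indicator {w. close z w} w * g (moebius A w) \<partial>hyp_area)"
proof -
  have "(\<integral>\<^sup>+w. indicator {w. close (moebius A z) w} w * g w \<partial>hyp_area)
     = (\<integral>\<^sup>+w. indicator {w. close (moebius A z) w} (moebius A w) * g (moebius A w) \<partial>hyp_area)"
    using assms(1) by (intro nn_integral_moebius[symmetric]) auto
  also have "\<dots> = (\<integral>\<^sup>+w. indicator {w. close z w} w * g (moebius A w) \<partial>hyp_area)"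
    using AE_hyp_area_uhp
    by (intro nn_integral_cong_AE, eventually_elim) (auto simp: indicator_def close_moebius assms)
  finally show ?thesis .
qed

lemma emeasure_close:
  assumes "z \<in> uhp" shows "emeasure hyp_area {w. close z w} = disc_area"
proof -
  obtain A where A: "det A = 1" "moebius A \<i> = z" using moebius_transitive[OF assms] by blast
  have "(\<integral>\<^sup>+w. indicator {w. close z w} w * 1 \<partial>hyp_area) = (\<integral>\<^sup>+w. indicator {w. close \<i> w} w * 1 \<partial>hyp_area)"
    using nn_integral_close[OF A(1), of \<i> "\<lambda>_. 1"] A(2) by (simp add: uhp_def)
  thus ?thesis by (simp add: disc_area_def)
qed

lemma emeasure_hyp_area_open_pos:
  assumes "open U" "U \<noteq> {}" "U \<subseteq> uhp"
  shows "emeasure hyp_area U > 0"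
proof (rule ccontr)
  assume "\<not> emeasure hyp_area U > 0"
  hence "U \<in> null_sets hyp_area" using assms by (auto simp: null_sets_def borel_open)
  hence "AE z in hyp_area. z \<notin> U" by (rule AE_not_in)
  hence "AE z in lborel. z \<in> uhp \<longrightarrow> z \<notin> U"
    unfolding hyp_area_def by (subst (asm) AE_density) (auto simp: indicator_def uhp_def)
  hence "AE z in lborel. z \<notin> U"
    by (rule AE_mp) (use assms(3) in \<open>auto intro!: AE_I2\<close>)
  hence "U \<in> null_sets lborel" using AE_iff_null_sets[of U lborel] assms(1) by (simp add: borel_open)
  hence "U \<in> null_sets lebesgue" by (rule null_sets_completionI)
  hence "negligible U" by (simp add: negligible_iff_null_sets)
  thus False using open_not_negligible assms by blast
qed

lemma disc_area_pos: "disc_area > 0"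
  unfolding disc_area_def
  by (rule emeasure_hyp_area_open_pos[OF open_close_section])
     (auto intro!: exI[of _ \<i>] simp: close_def uhp_def)

lemma disc_area_finite: "disc_area < \<infinity>"
proof -
  have sub: "indicator {w. close \<i> w} w * indicator uhp w * ennreal (1 / (Im w)\<^sup>2)
      \<le> 9 * indicator (cball 0 3) w" for w
  proof (cases "close \<i> w")
    case True
    have p: "Im w > 0" using closeD[OF True] by (simp add: uhp_def)
    have "1 < 3 * Im w" using close_Im_less[of w \<i>] close_sym True by auto
    hence "1 \<le> 9 * (Im w)\<^sup>2" using power_mono[of 1 "3 * Im w" 2] by (simp add: power_mult_distrib)
    hence "1 / (Im w)\<^sup>2 \<le> 9" using p by (simp add: divide_le_eq)
    hence "ennreal (1 / (Im w)\<^sup>2) \<le> 9" using ennreal_leI[of _ 9] by simp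
    moreover have "(cmod w)\<^sup>2 \<le> 3\<^sup>2" using close_norm_le[OF True] by simp
    hence "cmod w \<le> 3" by (rule power2_le_imp_le) simp
    ultimately show ?thesis using True by (auto simp: indicator_def)
  qed auto
  have "disc_area = (\<integral>\<^sup>+w. indicator {w. close \<i> w} w \<partial>hyp_area)" by (simp add: disc_area_def)
  also have "\<dots> = (\<integral>\<^sup>+w. indicator {w. close \<i> w} w * indicator uhp w * ennreal (1 / (Im w)\<^sup>2) \<partial>lborel)"
    by (subst nn_integral_hyp_area) (auto simp: mult_ac)
  also have "\<dots> \<le> (\<integral>\<^sup>+w. 9 * indicator (cball 0 3 :: complex set) w \<partial>lborel)"
    by (rule nn_integral_mono) (rule sub)
  also have "\<dots> = 9 * emeasure lborel (cball 0 3 :: complex set)"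
    by (subst nn_integral_cmult) (auto intro!: borel_measurable_indicator borel_closed)
  also have "\<dots> < \<infinity>"
    using emeasure_lborel_cball_finite[of "0::complex" 3] by (simp add: ennreal_mult_less_top)
  finally show ?thesis .
qed

lemma sigma_finite_hyp_area: "sigma_finite_measure hyp_area"
  unfolding hyp_area_def
  by (subst sigma_finite_measure.sigma_finite_iff_density_finite[OF sigma_finite_lborel])
     (auto simp: ennreal_mult_eq_top_iff indicator_def)

interpretation hyp_area: sigma_finite_measure hyp_area
  by (rule sigma_finite_hyp_area)

interpretation hyp_area_pair: pair_sigma_finite hyp_area hyp_area ..

section \<open>The matrices of a Fuchsian group\<close>

lemma group_SL2R: "group SL2R"
proof (rule groupI)
  fix x assume "x \<in> carrier SL2R"
  thus "\<exists>y\<in>carrier SL2R. y \<otimes>\<^bsub>SL2R\<^esub> x = \<one>\<^bsub>SL2R\<^esub>"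
    by (intro bexI[of _ "mat2_adj x"]) (simp_all add: SL2R_def mat2_adj_inverse)
qed (simp_all add: SL2R_def det_mul matrix_mul_assoc)

lemma SL2R_inv: "det A = 1 \<Longrightarrow> inv\<^bsub>SL2R\<^esub> A = mat2_adj A"
  by (rule group.inv_equality[OF group_SL2R]) (simp_all add: SL2R_def mat2_adj_inverse)

lemma mat2_uminus_mult: "(- A) ** B = - (A ** B)" "A ** (- B) = - (A ** B)" for A B :: "real^2^2"
  by (simp_all add: mat2_eq_iff mat2_mult_entry)

lemma det_mat2_uminus [simp]: "det (- A) = det (A :: real^2^2)"
  by (simp add: det_2)

lemma normal_center: "{mat 1, - mat 1} \<lhd> SL2R"
proof (rule group.normalI[OF group_SL2R])
  show "subgroup {mat 1, - mat 1} SL2R"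
  proof (rule group.subgroupI[OF group_SL2R])
    fix a :: "real^2^2" assume "a \<in> {mat 1, - mat 1}"
    hence "det a = 1" "mat2_adj a = a" by (auto simp: mat2_adj_def mat2_eq_iff mat_def det_2)
    thus "inv\<^bsub>SL2R\<^esub> a \<in> {mat 1, - mat 1}" using \<open>a \<in> _\<close> by (simp add: SL2R_inv)
  qed (auto simp: SL2R_def mat2_uminus_mult)
  show "\<forall>x\<in>carrier SL2R. {mat 1, - mat 1} #>\<^bsub>SL2R\<^esub> x = x <#\<^bsub>SL2R\<^esub> {mat 1, - mat 1}"
    by (auto simp: r_coset_def l_coset_def SL2R_def mat2_uminus_mult)
qed

locale fuchsian =
  fixes \<Gamma> :: "(real^2^2) set set"
  assumes lattice: "discrete_finite_covolume \<Gamma>"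
begin

text \<open>
  It is more convenient to work with the matrices than with the cosets. Since \<open>A\<close> and \<open>-A\<close> act in the same way,
  every element of the group is then counted twice.
\<close>

definition G :: "(real^2^2) set" where "G = \<Union>\<Gamma>"

lemma G_I: "a \<in> \<Gamma> \<Longrightarrow> A \<in> a \<Longrightarrow> A \<in> G"
  by (auto simp: G_def)

lemma subgroup: "subgroup \<Gamma> PSL2R"
  using lattice by (simp add: discrete_finite_covolume_def)

lemma coset_form:
  assumes "a \<in> \<Gamma>"
  obtains x where "det x = 1" "a = {x, - x}"
proof -
  have "a \<in> carrier PSL2R" using subgroup.subset[OF subgroup] assms by auto
  thus ?thesis using that
    unfolding PSL2R_def carrier_FactGroup
    by (auto simp: r_coset_def SL2R_def mat2_uminus_mult)
qed

lemma det_G: "A \<in> G \<Longrightarrow> det A = 1"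
  by (metis G_def UnionE coset_form det_mat2_uminus insert_iff singletonD)

lemma uminus_G: "A \<in> G \<Longrightarrow> - A \<in> G"
proof -
  assume "A \<in> G"
  then obtain a where a: "a \<in> \<Gamma>" "A \<in> a" by (auto simp: G_def)
  obtain x where "a = {x, - x}" using coset_form[OF a(1)] by blast
  hence "- A \<in> a" using a(2) by auto
  thus ?thesis by (rule G_I[OF a(1)])
qed

lemma one_G: "mat 1 \<in> G"
proof -
  have "{mat 1, - mat 1} \<in> \<Gamma>"
    using subgroup.one_closed[OF subgroup] by (simp add: PSL2R_def)
  thus ?thesis by (rule G_I) simp
qed

lemma mult_G:
  assumes "A \<in> G" "B \<in> G" shows "A ** B \<in> G"
proof -
  obtain a b where ab: "a \<in> \<Gamma>" "b \<in> \<Gamma>" "A \<in> a" "B \<in> b" using assms by (auto simp: G_def)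
  hence "a <#>\<^bsub>SL2R\<^esub> b \<in> \<Gamma>" using subgroup.m_closed[OF subgroup] by (simp add: PSL2R_def)
  moreover have "A ** B \<in> a <#>\<^bsub>SL2R\<^esub> b" using ab by (auto simp: set_mult_def SL2R_def)
  ultimately show ?thesis by (rule G_I)
qed

lemma adj_G:
  assumes "A \<in> G" shows "mat2_adj A \<in> G"
proof -
  obtain a where a: "a \<in> \<Gamma>" "A \<in> a" using assms by (auto simp: G_def)
  have "a \<in> carrier (SL2R Mod {mat 1, - mat 1})"
    using subgroup.subset[OF subgroup] a by (auto simp: PSL2R_def)
  hence "inv\<^bsub>PSL2R\<^esub> a = set_inv\<^bsub>SL2R\<^esub> a"
    unfolding PSL2R_def by (rule normal.inv_FactGroup[OF normal_center])
  moreover have "inv\<^bsub>PSL2R\<^esub> a \<in> \<Gamma>"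
    using subgroup.m_inv_closed[OF subgroup a(1)] .
  moreover have "mat2_adj A \<in> set_inv\<^bsub>SL2R\<^esub> a"
    using a det_G[OF assms] by (auto simp: SET_INV_def SL2R_inv intro!: bexI[of _ A])
  ultimately show ?thesis using G_I by metis
qed

text \<open>
  Each point of a discrete set is singled out by a member of a countable basis of the topology.
\<close>

lemma countable_G: "countable G"
proof -
  have d: "discrete G" using lattice by (simp add: discrete_finite_covolume_def G_def)
  obtain B :: "(real^2^2) set set" where B: "countable B" "topological_basis B"
    using ex_countable_basis by blast
  have "\<exists>b\<in>B. b \<inter> G = {x}" if x: "x \<in> G" for x
  proof -
    have "x isolated_in G" using d x by (simp only: discrete_def)
    then obtain T where T: "open T" "T \<inter> G = {x}" unfolding isolated_in_def by blast
    then obtain b where "b \<in> B" "x \<in> b" "b \<subseteq> T" using topological_basisE[OF B(2), of T x] by blast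
    thus ?thesis using T x by (intro bexI[of _ b]) auto
  qed
  then obtain b where b: "\<And>x. x \<in> G \<Longrightarrow> b x \<in> B \<and> b x \<inter> G = {x}" by metis
  have "inj_on b G" using b by (intro inj_onI) (metis singleton_inject)
  moreover have "b ` G \<subseteq> B" using b by blast
  ultimately show ?thesis using B(1) by (meson countable_image_inj_on countable_subset)
qed

section \<open>Mass transport between points of a fundamental domain\<close>

definition fdom :: "complex set" where
  "fdom = (SOME F. fundamental_domain \<Gamma> F \<and> emeasure hyp_area F < \<infinity>)"

lemma fdom: "fundamental_domain \<Gamma> fdom" "emeasure hyp_area fdom < \<infinity>"
proof -
  have "\<exists>F. fundamental_domain \<Gamma> F \<and> emeasure hyp_area F < \<infinity>"
    using lattice by (simp add: discrete_finite_covolume_def finite_covolume_def)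
  from someI_ex[OF this] show "fundamental_domain \<Gamma> fdom" "emeasure hyp_area fdom < \<infinity>"
    by (simp_all add: fdom_def)
qed

lemma measurable_fdom [measurable]: "fdom \<in> sets borel"
  and fdom_subset: "fdom \<subseteq> uhp"
  using fdom(1) by (auto simp: fundamental_domain_def)

lemma fdom_cover:
  assumes "w \<in> uhp" obtains A where "A \<in> G" "moebius A w \<in> fdom"
proof -
  have "w \<in> (\<Union>A\<in>G. moebius A ` fdom)" using fdom(1) assms by (simp only: fundamental_domain_def G_def)
  then obtain B u where B: "B \<in> G" "u \<in> fdom" "w = moebius B u" by blast
  hence "moebius (mat2_adj B) w = u" using fdom_subset det_G moebius_adj(2) by auto
  thus ?thesis using that[of "mat2_adj B"] B adj_G by auto
qed

lemma AE_fdom_disjoint: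
  assumes "A \<in> G" "A \<noteq> mat 1" "A \<noteq> - mat 1"
  shows "AE z in hyp_area. \<not> (z \<in> fdom \<and> moebius A z \<in> fdom)"
proof -
  have A: "det A = 1" "det (mat2_adj A) = 1" "mat2_adj A \<in> G" using det_G adj_G assms(1) by auto
  have "mat2_adj A \<noteq> mat 1" "mat2_adj A \<noteq> - mat 1"
    using assms(2,3) by (auto simp: mat2_adj_def mat2_eq_iff mat_def)
  hence "emeasure hyp_area (fdom \<inter> moebius (mat2_adj A) ` fdom) = 0"
    using fdom(1) A(3) unfolding fundamental_domain_def G_def by auto
  moreover have "fdom \<inter> moebius (mat2_adj A) ` fdom = fdom \<inter> moebius A -` fdom"
  proof -
    have "uhp \<inter> fdom = fdom" using fdom_subset by auto
    hence "uhp \<inter> moebius A -` fdom = moebius (mat2_adj A) ` fdom"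
      using vimage_moebius_eq_image_adj[OF A(1), of fdom] by simp
    thus ?thesis using fdom_subset by blast
  qed
  moreover have "fdom \<inter> moebius A -` fdom \<in> sets borel"
    using measurable_sets[OF measurable_moebius measurable_fdom, of A] by auto
  ultimately have "fdom \<inter> moebius A -` fdom \<in> null_sets hyp_area"
    by (auto simp: null_sets_def)
  from AE_not_in[OF this] show ?thesis by eventually_elim auto
qed

lemma AE_fdom_unique: "AE w in hyp_area. \<forall>A\<in>G. \<forall>B\<in>G. moebius A w \<in> fdom \<longrightarrow> moebius B w \<in> fdom \<longrightarrow> B = A \<or> B = - A"
proof (intro AE_ball_countable' countable_G)
  fix A B assume AB: "A \<in> G" "B \<in> G"
  define C where "C = B ** mat2_adj A"
  have C: "C \<in> G" "C ** A = B"
    using AB mult_G adj_G mat2_adj_inverse[OF det_G[OF AB(1)]]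
    by (auto simp: C_def matrix_mul_assoc[symmetric])
  show "AE w in hyp_area. moebius A w \<in> fdom \<longrightarrow> moebius B w \<in> fdom \<longrightarrow> B = A \<or> B = - A"
  proof (cases "C = mat 1 \<or> C = - mat 1")
    case True
    hence "B = A \<or> B = - A" using C(2) by (auto simp: mat2_uminus_mult)
    thus ?thesis by auto
  next
    case False
    have m: "moebius C -` fdom \<in> sets borel" using measurable_sets[OF measurable_moebius measurable_fdom, of C] by simp
    have "{z. \<not> (z \<in> fdom \<and> moebius C z \<in> fdom)} = - (fdom \<inter> moebius C -` fdom)" by auto
    also have "\<dots> \<in> sets borel" using m by auto
    finally have "AE z in hyp_area. \<not> (moebius A z \<in> fdom \<and> moebius C (moebius A z) \<in> fdom)"
      using AE_fdom_disjoint[OF C(1)] False by (intro AE_moebius det_G AB) auto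
    thus ?thesis using AE_hyp_area_uhp
    proof eventually_elim
      fix z assume "\<not> (moebius A z \<in> fdom \<and> moebius C (moebius A z) \<in> fdom)" "z \<in> uhp"
      thus "moebius A z \<in> fdom \<longrightarrow> moebius B z \<in> fdom \<longrightarrow> B = A \<or> B = - A"
        using moebius_mult[OF det_G[OF C(1)] det_G[OF AB(1)], of z] C(2) by auto
    qed
  qed
qed

text \<open>
  Almost every point is moved into the fundamental domain by exactly one element of the group, that is,
  by the two matrices \<open>A\<close> and \<open>-A\<close>.
\<close>

lemma AE_fdom_multiplicity:
  "AE w in hyp_area. (\<integral>\<^sup>+A. indicator fdom (moebius A w) \<partial>count_space G) = 2"
  using AE_fdom_unique AE_hyp_area_uhp
proof eventually_elim
  fix w assume u: "\<forall>A\<in>G. \<forall>B\<in>G. moebius A w \<in> fdom \<longrightarrow> moebius B w \<in> fdom \<longrightarrow> B = A \<or> B = - A" and w: "w \<in> uhp"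
  obtain A where A: "A \<in> G" "moebius A w \<in> fdom" using fdom_cover[OF w] by blast
  have eq: "{B\<in>G. moebius B w \<in> fdom} = {A, - A}"
    using u A uminus_G by (auto simp: moebius_uminus)
  have "A \<noteq> - A"
  proof
    assume "A = - A"
    hence "A $ i $ j = - A $ i $ j" for i j by (metis vector_uminus_component)
    hence "A $ i $ j = 0" for i j by simp
    thus False using det_G[OF A(1)] by (simp add: det_2)
  qed
  have "(\<integral>\<^sup>+B. indicator fdom (moebius B w) \<partial>count_space G) = (\<integral>\<^sup>+B. indicator {A, - A} B \<partial>count_space G)"
  proof (rule nn_integral_cong)
    fix B assume "B \<in> space (count_space G)"
    hence "moebius B w \<in> fdom \<longleftrightarrow> B \<in> {A, - A}" using eq by (simp only: space_count_space) blast
    thus "indicator fdom (moebius B w) = (indicator {A, - A} B :: ennreal)"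
      by (simp only: indicator_def)
  qed
  also have "\<dots> = emeasure (count_space G) {A, - A}"
    using A(1) uminus_G[OF A(1)] by (intro nn_integral_indicator) simp
  also have "\<dots> = of_nat (card {A, - A})"
    using A(1) uminus_G[OF A(1)] by (intro emeasure_count_space_finite) auto
  also have "\<dots> = 2" using \<open>A \<noteq> - A\<close> by simp
  finally show "(\<integral>\<^sup>+B. indicator fdom (moebius B w) \<partial>count_space G) = 2" .
qed

lemma bij_adj: "bij_betw mat2_adj G G"
  by (rule bij_betwI[of _ _ _ mat2_adj]) (auto intro: adj_G)

text \<open>
  The reason is that \<open>\<integral> K(z,w) dw\<close> splits into integrals over the translates \<open>A F\<close>, and the substitution of
  \<open>Az\<close>, \<open>Aw\<close> for \<open>z\<close>, \<open>w\<close> turns the contribution of \<open>z \<in> F\<close>, \<open>w \<in> A\<^sup>-\<^sup>1 F\<close> into that of \<open>z \<in> A F\<close>, \<open>w \<in> F\<close>.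
  This is where \<open>F\<close> being a fundamental domain enters the proof.
\<close>

theorem mass_transport:
  fixes K :: "complex \<Rightarrow> complex \<Rightarrow> ennreal"
  assumes [measurable]: "(\<lambda>(z, w). K z w) \<in> borel_measurable (borel \<Otimes>\<^sub>M borel)"
    and inv: "\<And>A z w. A \<in> G \<Longrightarrow> z \<in> uhp \<Longrightarrow> w \<in> uhp \<Longrightarrow> K (moebius A z) (moebius A w) = K z w"
  shows "(\<integral>\<^sup>+z. indicator fdom z * (\<integral>\<^sup>+w. K z w \<partial>hyp_area) \<partial>hyp_area)
       = (\<integral>\<^sup>+w. indicator fdom w * (\<integral>\<^sup>+z. K z w \<partial>hyp_area) \<partial>hyp_area)" (is "?L = ?R")
proof -
  let ?\<mu> = hyp_area
  let ?f = "indicator fdom :: complex \<Rightarrow> ennreal"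
  define T where "T A = (\<integral>\<^sup>+z. \<integral>\<^sup>+w. ?f z * K z w * ?f (moebius A w) \<partial>?\<mu> \<partial>?\<mu>)" for A
  define T' where "T' A = (\<integral>\<^sup>+w. \<integral>\<^sup>+z. ?f w * K z w * ?f (moebius A z) \<partial>?\<mu> \<partial>?\<mu>)" for A
  \<comment> \<open>an integral over the plane as a sum over translates of the domain, each of which occurs for \<open>A\<close> and \<open>-A\<close>\<close>
  have two: "(\<integral>\<^sup>+w. h w \<partial>?\<mu>) * 2 = (\<integral>\<^sup>+A. \<integral>\<^sup>+w. h w * ?f (moebius A w) \<partial>?\<mu> \<partial>count_space G)"
    if [measurable]: "h \<in> borel_measurable borel" for h
  proof -
    have "(\<integral>\<^sup>+w. h w \<partial>?\<mu>) * 2 = (\<integral>\<^sup>+w. h w * (\<integral>\<^sup>+A. ?f (moebius A w) \<partial>count_space G) \<partial>?\<mu>)"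
      by (subst nn_integral_multc[symmetric], simp)
         (intro nn_integral_cong_AE, use AE_fdom_multiplicity in \<open>eventually_elim, simp\<close>)
    also have "\<dots> = (\<integral>\<^sup>+w. \<integral>\<^sup>+A. h w * ?f (moebius A w) \<partial>count_space G \<partial>?\<mu>)"
      by (intro nn_integral_cong nn_integral_cmult[symmetric]) simp
    also have "\<dots> = (\<integral>\<^sup>+A. \<integral>\<^sup>+w. h w * ?f (moebius A w) \<partial>?\<mu> \<partial>count_space G)"
      by (intro nn_integral_count_space_nn_integral countable_G) measurable
    finally show ?thesis .
  qed
  have L: "?L * 2 = (\<integral>\<^sup>+A. T A \<partial>count_space G)"
  proof -
    have "?L * 2 = (\<integral>\<^sup>+z. (\<integral>\<^sup>+w. ?f z * K z w \<partial>?\<mu>) * 2 \<partial>?\<mu>)"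
      by (subst nn_integral_multc[symmetric]) (auto intro!: nn_integral_cong simp: nn_integral_cmult)
    also have "\<dots> = (\<integral>\<^sup>+z. \<integral>\<^sup>+A. \<integral>\<^sup>+w. ?f z * K z w * ?f (moebius A w) \<partial>?\<mu> \<partial>count_space G \<partial>?\<mu>)"
      by (intro nn_integral_cong two) measurable
    also have "\<dots> = (\<integral>\<^sup>+A. T A \<partial>count_space G)"
      unfolding T_def by (intro nn_integral_count_space_nn_integral countable_G) measurable
    finally show ?thesis .
  qed
  have R: "?R * 2 = (\<integral>\<^sup>+A. T' A \<partial>count_space G)"
  proof -
    have "?R * 2 = (\<integral>\<^sup>+w. (\<integral>\<^sup>+z. ?f w * K z w \<partial>?\<mu>) * 2 \<partial>?\<mu>)"
      by (subst nn_integral_multc[symmetric]) (auto intro!: nn_integral_cong simp: nn_integral_cmult)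
    also have "\<dots> = (\<integral>\<^sup>+w. \<integral>\<^sup>+A. \<integral>\<^sup>+z. ?f w * K z w * ?f (moebius A z) \<partial>?\<mu> \<partial>count_space G \<partial>?\<mu>)"
      by (intro nn_integral_cong two) measurable
    also have "\<dots> = (\<integral>\<^sup>+A. T' A \<partial>count_space G)"
      unfolding T'_def by (intro nn_integral_count_space_nn_integral countable_G) measurable
    finally show ?thesis .
  qed
  have TT: "T' (mat2_adj A) = T A" if A: "A \<in> G" for A
  proof -
    let ?B = "mat2_adj A"
    have d: "det A = 1" "det ?B = 1" using det_G[OF A] by auto
    have "T' ?B = (\<integral>\<^sup>+w. \<integral>\<^sup>+z. ?f (moebius A w) * K z (moebius A w) * ?f (moebius ?B z) \<partial>?\<mu> \<partial>?\<mu>)"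
      unfolding T'_def by (rule nn_integral_moebius[OF d(1), symmetric]) measurable
    also have "\<dots> = (\<integral>\<^sup>+w. \<integral>\<^sup>+z. ?f (moebius A w) * K (moebius A z) (moebius A w) * ?f (moebius ?B (moebius A z)) \<partial>?\<mu> \<partial>?\<mu>)"
      by (intro nn_integral_cong nn_integral_moebius[OF d(1), symmetric]) measurable
    also have "\<dots> = (\<integral>\<^sup>+w. \<integral>\<^sup>+z. ?f z * K z w * ?f (moebius A w) \<partial>?\<mu> \<partial>?\<mu>)"
    proof (rule nn_integral_cong_AE, use AE_hyp_area_uhp in eventually_elim, rule nn_integral_cong_AE,
           use AE_hyp_area_uhp in eventually_elim)
      fix w z assume "w \<in> uhp" "z \<in> uhp"
      thus "?f (moebius A w) * K (moebius A z) (moebius A w) * ?f (moebius ?B (moebius A z))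
          = ?f z * K z w * ?f (moebius A w)"
        by (simp add: inv[OF A] moebius_adj[OF d(1)] mult_ac)
    qed
    also have "\<dots> = T A"
      unfolding T_def by (rule hyp_area_pair.Fubini') measurable
    finally show ?thesis .
  qed
  have "(\<integral>\<^sup>+A. T' A \<partial>count_space G) = (\<integral>\<^sup>+A. T' (mat2_adj A) \<partial>count_space G)"
    by (rule nn_integral_bij_count_space[OF bij_adj, symmetric])
  also have "\<dots> = (\<integral>\<^sup>+A. T A \<partial>count_space G)"
    by (rule nn_integral_cong) (simp add: TT)
  finally have "2 * ?L = 2 * ?R" using L R by (simp add: mult.commute)
  thus ?thesis by (simp add: ennreal_mult_cancel_left)
qed

text \<open>
  Countably many translates of a null set cannot cover a disc.
\<close>

lemma emeasure_fdom_pos: "emeasure hyp_area fdom > 0"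
proof (rule ccontr)
  assume "\<not> emeasure hyp_area fdom > 0"
  hence "AE z in hyp_area. z \<notin> fdom"
    by (intro AE_not_in) (auto simp: null_sets_def)
  hence "AE z in hyp_area. moebius A z \<notin> fdom" if "A \<in> G" for A
  proof (rule AE_moebius[OF det_G[OF that]])
    have "{z. z \<notin> fdom} = - fdom" by auto
    thus "{z. z \<notin> fdom} \<in> sets borel" by simp
  qed
  hence "AE z in hyp_area. \<forall>A\<in>G. moebius A z \<notin> fdom"
    by (intro AE_ball_countable' countable_G)
  hence "AE z in hyp_area. z \<notin> {w. close \<i> w}"
    by eventually_elim (metis fdom_cover closeD(2) mem_Collect_eq)
  hence "disc_area = 0"
    unfolding disc_area_def using AE_iff_null_sets[of "{w. close \<i> w}" hyp_area] by auto
  thus False using disc_area_pos by simp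
qed

end

section \<open>The orbit of infinity\<close>

text \<open>
  The variable in the expansions of quasimodular forms. For fixed \<open>z\<close> it is determined by \<open>d/c\<close>, that is,
  by the point \<open>A\<^sup>-\<^sup>1 \<infinity> = -d/c\<close> of the orbit of infinity.
\<close>

definition slope :: "real^2^2 \<Rightarrow> complex \<Rightarrow> complex" where
  "slope A z = of_real (A$2$1) / autom A z"

lemma slope_eq_iff:
  assumes "det A = 1" "det B = 1" "z \<in> uhp"
  shows "slope A z = slope B z \<longleftrightarrow> A$2$1 * B$2$2 = B$2$1 * A$2$2"
proof -
  have "slope A z = slope B z \<longleftrightarrow> of_real (A$2$1) * autom B z = of_real (B$2$1) * autom A z"
    using autom_nonzero[OF assms(1,3)] autom_nonzero[OF assms(2,3)]
    by (simp add: slope_def frac_eq_eq)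
  also have "\<dots> \<longleftrightarrow> complex_of_real (A$2$1 * B$2$2) = of_real (B$2$1 * A$2$2)"
    by (auto simp: autom_def algebra_simps)
  finally show ?thesis by (simp only: of_real_eq_iff)
qed

lemma slope_eq_independent:
  assumes "det A = 1" "det B = 1" "z \<in> uhp" "w \<in> uhp" "slope A z = slope B z"
  shows "slope A w = slope B w"
  using assms slope_eq_iff by blast

lemma autom_eq_slope:
  assumes "det A = 1" "z \<in> uhp"
  shows "autom A w = autom A z * (1 + slope A z * (w - z))"
  using autom_nonzero[OF assms] by (simp add: slope_def field_simps) (simp add: autom_def algebra_simps)

text \<open>
  Which of two points is closer to the boundary point \<open>A\<^sup>-\<^sup>1 \<infinity>\<close> depends on this boundary point alone: the
  automorphy factors at \<open>z\<close> and \<open>w\<close> differ by \<open>1 + X (w - z)\<close>, where \<open>X\<close> is the slope at \<open>z\<close>.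
\<close>

lemma Im_moebius_less_cong:
  assumes A: "det A = 1" and B: "det B = 1" and zw: "z \<in> uhp" "w \<in> uhp" and s: "slope A z = slope B z"
  shows "Im (moebius A z) < Im (moebius A w) \<longleftrightarrow> Im (moebius B z) < Im (moebius B w)"
proof -
  have "Im (moebius C z) < Im (moebius C w) \<longleftrightarrow> Im z < Im w / (cmod (1 + slope C z * (w - z)))\<^sup>2"
    if C: "det C = 1" for C
  proof -
    have p: "0 < (cmod (autom C z))\<^sup>2" using autom_nonzero[OF C zw(1)] by simp
    have "Im (moebius C w) = Im w / (cmod (1 + slope C z * (w - z)))\<^sup>2 / (cmod (autom C z))\<^sup>2"
      unfolding Im_moebius[OF C] autom_eq_slope[OF C zw(1), of w]
      by (simp add: norm_mult power_mult_distrib mult.commute)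
    moreover have "a / P < b / P \<longleftrightarrow> a < b" if "0 < P" for a b P :: real
      using that by (simp add: divide_less_cancel)
    ultimately show ?thesis using p by (simp only: Im_moebius[OF C, of z])
  qed
  thus ?thesis using A B s by simp
qed

lemma emeasure_vimage_moebius:
  assumes "det A = 1" "X \<in> sets borel"
  shows "emeasure hyp_area (moebius A -` X) = emeasure hyp_area X"
  by (subst (2) hyp_area_moebius_invariant[OF assms(1), symmetric])
     (simp add: emeasure_distr assms(2))

lemma emeasure_hyp_area_cong:
  assumes "X \<inter> uhp = Y \<inter> uhp" "X \<in> sets borel" "Y \<in> sets borel"
  shows "emeasure hyp_area X = emeasure hyp_area Y"
proof (rule emeasure_eq_AE)
  show "AE x in hyp_area. x \<in> X \<longleftrightarrow> x \<in> Y"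
    using AE_hyp_area_uhp by eventually_elim (use assms(1) in blast)
qed (use assms in auto)

definition upper_area :: ennreal where
  "upper_area = emeasure hyp_area {w. close \<i> w \<and> 1 < Im w}"

definition lower_area :: ennreal where
  "lower_area = emeasure hyp_area {w. close \<i> w \<and> Im w < 1}"

lemma sets_close_upper [measurable]: "{w. close z w \<and> a < Im w} \<in> sets borel"
  and sets_close_lower [measurable]: "{w. close z w \<and> Im w < a} \<in> sets borel"
proof -
  have "{w. close z w \<and> a < Im w} = {w. close z w} \<inter> {w. a < Im w}"
    "{w. close z w \<and> Im w < a} = {w. close z w} \<inter> {w. Im w < a}" by auto
  thus "{w. close z w \<and> a < Im w} \<in> sets borel" "{w. close z w \<and> Im w < a} \<in> sets borel"
    by (auto intro!: borel_open open_Int open_close_section open_halfspace_Im_gt open_halfspace_Im_lt)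
qed

lemma emeasure_close_upper_lower:
  assumes "z \<in> uhp"
  shows "emeasure hyp_area {w. close z w \<and> Im z < Im w} = upper_area"
    and "emeasure hyp_area {w. close z w \<and> Im w < Im z} = lower_area"
proof -
  obtain A where A: "det A = 1" "moebius A \<i> = z" "\<And>w. moebius A w = of_real (Im z) * w + of_real (Re z)"
    using moebius_transitive[OF assms] by blast
  have i: "\<i> \<in> uhp" by (simp add: uhp_def)
  have pos: "0 < Im z" using assms by (simp add: uhp_def)
  have c: "close z (moebius A w) \<longleftrightarrow> close \<i> w" if "w \<in> uhp" for w
    using close_moebius[OF A(1) i that] A(2) by simp
  have "moebius A -` {w. close z w \<and> Im z < Im w} \<inter> uhp = {w. close \<i> w \<and> 1 < Im w} \<inter> uhp"
    using c pos by (auto simp: A(3))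
  thus "emeasure hyp_area {w. close z w \<and> Im z < Im w} = upper_area"
    unfolding upper_area_def emeasure_vimage_moebius[OF A(1) sets_close_upper, symmetric, of z]
    by (intro emeasure_hyp_area_cong measurable_sets_borel[OF measurable_moebius] sets_close_upper)
  have "moebius A -` {w. close z w \<and> Im w < Im z} \<inter> uhp = {w. close \<i> w \<and> Im w < 1} \<inter> uhp"
    using c pos by (auto simp: A(3))
  thus "emeasure hyp_area {w. close z w \<and> Im w < Im z} = lower_area"
    unfolding lower_area_def emeasure_vimage_moebius[OF A(1) sets_close_lower, symmetric, of z]
    by (intro emeasure_hyp_area_cong measurable_sets_borel[OF measurable_moebius] sets_close_lower)
qed

text \<open>
  The half turn \<open>z \<mapsto> -1/z\<close> about \<open>\<i>\<close> preserves the disc and maps its upper part into the lower part, because it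
  maps \<open>Im z > 1\<close> onto the Euclidean disc with diameter from \<open>0\<close> to \<open>\<i>\<close>. The image misses the open set of points that lie below the horocycle together with
  their images under the half turn.
\<close>

lemma upper_area_less_lower_area: "upper_area < lower_area"
proof -
  define J :: "real^2^2" where "J = vector [vector [0, -1], vector [1, 0]]"
  have J: "det J = 1" by (simp add: J_def det_2)
  have Ji: "moebius J \<i> = \<i>" by (simp add: J_def moebius_def autom_def)
  have ImJ: "Im (moebius J w) = Im w / (cmod w)\<^sup>2" for w
    by (simp add: Im_moebius[OF J]) (simp add: J_def autom_def)
  have i: "\<i> \<in> uhp" by (simp add: uhp_def)
  have cJ: "close \<i> (moebius J w) \<longleftrightarrow> close \<i> w" if "w \<in> uhp" for w
    using close_moebius[OF J i that] Ji by simp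
  define U where "U = {w. close \<i> w \<and> 1 < Im w / (cmod w)\<^sup>2}"
  define W where "W = {w. close \<i> w \<and> Im w < 1 \<and> Im w < (cmod w)\<^sup>2}"
  have U [measurable]: "U \<in> sets borel"
  proof -
    have "{w. 1 < Im w / (cmod w)\<^sup>2} \<in> sets borel" by measurable
    moreover have "U = {w. close \<i> w} \<inter> {w. 1 < Im w / (cmod w)\<^sup>2}" by (auto simp: U_def)
    ultimately show ?thesis by auto
  qed
  have Wo: "open W"
  proof -
    have "W = {w. close \<i> w} \<inter> {w. Im w < 1} \<inter> {w. Im w < (cmod w)\<^sup>2}" by (auto simp: W_def)
    thus ?thesis by (auto intro!: open_Int open_close_section open_Collect_less continuous_intros)
  qed
  have W [measurable]: "W \<in> sets borel" using Wo by (rule borel_open)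
  have "upper_area = emeasure hyp_area U"
    unfolding upper_area_def emeasure_vimage_moebius[OF J sets_close_upper, symmetric]
  proof (rule emeasure_hyp_area_cong)
    show "moebius J -` {w. close \<i> w \<and> 1 < Im w} \<inter> uhp = U \<inter> uhp"
      using cJ by (auto simp: U_def ImJ)
    show "moebius J -` {w. close \<i> w \<and> 1 < Im w} \<in> sets borel"
      by (intro measurable_sets_borel[OF measurable_moebius] sets_close_upper)
  qed (rule U)
  moreover have UL: "U \<union> W \<subseteq> {w. close \<i> w \<and> Im w < 1}"
  proof -
    have "Im w < 1" if "1 < Im w / (cmod w)\<^sup>2" "close \<i> w" for w
    proof -
      have pos: "0 < Im w" using that(2) by (simp add: close_def uhp_def)
      have "0 < (cmod w)\<^sup>2" using pos by auto
      hence "(cmod w)\<^sup>2 < Im w" using that(1) by (simp add: less_divide_eq)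
      moreover have "(Im w)\<^sup>2 \<le> (cmod w)\<^sup>2" by (simp add: cmod_power2)
      ultimately have "Im w * Im w < Im w * 1" by (simp add: power2_eq_square)
      thus ?thesis using pos by (simp only: mult_less_cancel_left_pos)
    qed
    thus ?thesis by (auto simp: U_def W_def)
  qed
  moreover have "U \<inter> W = {}"
    by (auto simp: U_def W_def less_divide_eq split: if_splits)
  moreover have "emeasure hyp_area U < \<infinity>"
  proof -
    have "emeasure hyp_area U \<le> disc_area"
      unfolding disc_area_def by (rule emeasure_mono) (auto simp: U_def)
    thus ?thesis using disc_area_finite by simp
  qed
  moreover have "0 < emeasure hyp_area W"
  proof (rule emeasure_hyp_area_open_pos[OF Wo])
    \<comment> \<open>a point to the side of \<open>\<i>\<close>, just below the horocycle\<close>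
    have "Complex (1/2) (9/10) \<in> W"
      by (simp add: W_def close_def uhp_def cmod_power2) (simp add: power2_eq_square)
    thus "W \<noteq> {}" by auto
    show "W \<subseteq> uhp" using closeD(2) by (auto simp: W_def)
  qed
  moreover have "emeasure hyp_area U + emeasure hyp_area W = emeasure hyp_area (U \<union> W)"
    using \<open>U \<inter> W = {}\<close> by (intro plus_emeasure) auto
  moreover have "emeasure hyp_area (U \<union> W) \<le> lower_area"
    unfolding lower_area_def using UL by (intro emeasure_mono) auto
  ultimately show ?thesis
    by (metis add.right_neutral ennreal_add_left_cancel_less infinity_ennreal_def less_le_trans less_top)
qed

text \<open>
  The mass transported from \<open>z\<close> to \<open>w\<close> on behalf of the boundary point \<open>A\<^sup>-\<^sup>1 \<infinity>\<close>.
\<close>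

definition updown :: "real^2^2 \<Rightarrow> complex \<Rightarrow> complex \<Rightarrow> ennreal" where
  "updown A z w = (if close z w \<and> Im (moebius A z) < Im (moebius A w) then 1 else 0)"

lemma measurable_updown [measurable]:
  "(\<lambda>(z, w). updown A z w) \<in> borel_measurable (borel \<Otimes>\<^sub>M borel)"
proof -
  have [measurable]: "Measurable.pred (borel \<Otimes>\<^sub>M borel) (\<lambda>p. close (fst p) (snd p))"
    unfolding pred_def using measurable_close by (simp add: space_pair_measure)
  show ?thesis unfolding updown_def case_prod_beta by measurable
qed

lemma nn_integral_updown:
  assumes A: "det A = 1" and z: "z \<in> uhp"
  shows "(\<integral>\<^sup>+w. updown A z w \<partial>hyp_area) = upper_area"
    and "(\<integral>\<^sup>+w. updown A w z \<partial>hyp_area) = lower_area"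
proof -
  let ?z = "moebius A z"
  have cA: "close ?z (moebius A w) \<longleftrightarrow> close z w" if "w \<in> uhp" for w
    using close_moebius[OF A z that] .
  have cA': "close ?z (moebius A w) \<longleftrightarrow> close w z" if "w \<in> uhp" for w
    using cA[OF that] close_sym by simp
  have "(\<integral>\<^sup>+w. updown A z w \<partial>hyp_area) = (\<integral>\<^sup>+w. indicator {w. close ?z w \<and> Im ?z < Im w} (moebius A w) \<partial>hyp_area)"
    using AE_hyp_area_uhp
    by (intro nn_integral_cong_AE, eventually_elim) (auto simp: updown_def indicator_def cA)
  also have "\<dots> = (\<integral>\<^sup>+w. indicator {w. close ?z w \<and> Im ?z < Im w} w \<partial>hyp_area)"
    by (intro nn_integral_moebius[OF A]) measurable
  also have "\<dots> = upper_area"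
    using emeasure_close_upper_lower(1)[OF moebius_uhp[OF A z]] by simp
  finally show "(\<integral>\<^sup>+w. updown A z w \<partial>hyp_area) = upper_area" .
  have "(\<integral>\<^sup>+w. updown A w z \<partial>hyp_area) = (\<integral>\<^sup>+w. indicator {w. close ?z w \<and> Im w < Im ?z} (moebius A w) \<partial>hyp_area)"
    using AE_hyp_area_uhp
    by (intro nn_integral_cong_AE, eventually_elim) (simp add: updown_def indicator_def cA')
  also have "\<dots> = (\<integral>\<^sup>+w. indicator {w. close ?z w \<and> Im w < Im ?z} w \<partial>hyp_area)"
    by (intro nn_integral_moebius[OF A]) measurable
  also have "\<dots> = lower_area"
    using emeasure_close_upper_lower(2)[OF moebius_uhp[OF A z]] by simp
  finally show "(\<integral>\<^sup>+w. updown A w z \<partial>hyp_area) = lower_area" .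
qed

context fuchsian
begin

lemma updown_moebius:
  assumes "A \<in> G" "B \<in> G" "z \<in> uhp" "w \<in> uhp"
  shows "updown A (moebius B z) (moebius B w) = updown (A ** B) z w"
  using assms det_G by (simp add: updown_def close_moebius moebius_mult)

text \<open>
  Finitely many slopes mean that the functions \<open>updown A\<close> form a finite set \<open>K\<close>, which the group permutes.
  Their sum is invariant, and transporting mass by it contradicts
  \<open>upper_area < lower_area\<close>, as the fundamental domain has positive and finite area.
\<close>

theorem infinite_slopes:
  assumes z0: "z0 \<in> uhp"
  shows "infinite ((\<lambda>A. slope A z0) ` G)"
proof
  assume fin: "finite ((\<lambda>A. slope A z0) ` G)"
  have cong: "updown A = updown B" if "A \<in> G" "B \<in> G" "slope A z0 = slope B z0" for A B
  proof (intro ext)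
    fix z w
    show "updown A z w = updown B z w"
    proof (cases "close z w")
      case True
      have "slope A z = slope B z"
        using slope_eq_independent[OF _ _ z0 closeD(1)[OF True] that(3)] det_G that by auto
      thus ?thesis
        using Im_moebius_less_cong[of A B z w] det_G that closeD[OF True] by (simp add: updown_def)
    qed (simp add: updown_def)
  qed
  \<comment> \<open>a set of functions and not a family indexed by \<open>G\<close>, so that the sum over it is finite\<close>
  define K where "K = updown ` G"
  have finK: "finite K"
  proof -
    have "K \<subseteq> (\<lambda>x. updown (SOME A. A \<in> G \<and> slope A z0 = x)) ` ((\<lambda>A. slope A z0) ` G)"
    proof
      fix k assume "k \<in> K"
      then obtain A where A: "A \<in> G" "k = updown A" by (auto simp: K_def)
      let ?B = "SOME B. B \<in> G \<and> slope B z0 = slope A z0"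
      have "?B \<in> G \<and> slope ?B z0 = slope A z0" by (rule someI[of _ A]) (use A in auto)
      hence "k = updown ?B" using cong[of A ?B] A by auto
      thus "k \<in> (\<lambda>x. updown (SOME A. A \<in> G \<and> slope A z0 = x)) ` ((\<lambda>A. slope A z0) ` G)"
        using A(1) by blast
    qed
    thus ?thesis using fin by (meson finite_imageI finite_subset)
  qed
  define T where "T z w = (\<Sum>k\<in>K. k z w)" for z w
  have Km: "(\<lambda>(z, w). k z w) \<in> borel_measurable (borel \<Otimes>\<^sub>M borel)" if "k \<in> K" for k
    using that by (auto simp: K_def)
  have Tm [measurable]: "(\<lambda>(z, w). T z w) \<in> borel_measurable (borel \<Otimes>\<^sub>M borel)"
    unfolding T_def case_prod_beta
    by (intro borel_measurable_sum) (use Km in \<open>simp add: case_prod_beta\<close>)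
  have Tinv: "T (moebius B z) (moebius B w) = T z w" if B: "B \<in> G" and zw: "z \<in> uhp" "w \<in> uhp" for B z w
  proof -
    define \<phi> :: "real^2^2 \<Rightarrow> (complex \<Rightarrow> complex \<Rightarrow> ennreal) \<Rightarrow> complex \<Rightarrow> complex \<Rightarrow> ennreal"
      where "\<phi> C k = (\<lambda>z w. if z \<in> uhp \<and> w \<in> uhp then k (moebius C z) (moebius C w) else 0)" for C k
    have \<phi>: "\<phi> C (updown A) = updown (A ** C)" if "A \<in> G" "C \<in> G" for A C
      using updown_moebius[OF that] by (auto simp: \<phi>_def fun_eq_iff updown_def dest: closeD)
    have e: "A ** B ** mat2_adj B = A" "A ** mat2_adj B ** B = A" for A
      using mat2_adj_inverse[OF det_G[OF B]] by (simp_all add: matrix_mul_assoc[symmetric])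
    have bij: "bij_betw (\<phi> B) K K"
      by (rule bij_betwI[of _ _ _ "\<phi> (mat2_adj B)"])
         (auto simp: K_def \<phi> B adj_G mult_G e)
    have "T z w = (\<Sum>k\<in>K. \<phi> B k z w)"
      unfolding T_def by (rule sum.reindex_bij_betw[OF bij, symmetric])
    also have "\<dots> = T (moebius B z) (moebius B w)"
      using zw by (simp add: T_def \<phi>_def)
    finally show ?thesis by simp
  qed
  have out: "(\<integral>\<^sup>+w. T z w \<partial>hyp_area) = of_nat (card K) * upper_area" if "z \<in> uhp" for z
  proof -
    have "(\<integral>\<^sup>+w. T z w \<partial>hyp_area) = (\<Sum>k\<in>K. \<integral>\<^sup>+w. k z w \<partial>hyp_area)"
      unfolding T_def by (rule nn_integral_sum) (auto simp: K_def)
    also have "\<dots> = (\<Sum>k\<in>K. upper_area)"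
      using nn_integral_updown(1)[OF det_G that] by (intro sum.cong) (auto simp: K_def)
    finally show ?thesis by simp
  qed
  have inn: "(\<integral>\<^sup>+z. T z w \<partial>hyp_area) = of_nat (card K) * lower_area" if "w \<in> uhp" for w
  proof -
    have "(\<integral>\<^sup>+z. T z w \<partial>hyp_area) = (\<Sum>k\<in>K. \<integral>\<^sup>+z. k z w \<partial>hyp_area)"
      unfolding T_def by (rule nn_integral_sum) (auto simp: K_def)
    also have "\<dots> = (\<Sum>k\<in>K. lower_area)"
      using nn_integral_updown(2)[OF det_G that] by (intro sum.cong) (auto simp: K_def)
    finally show ?thesis by simp
  qed
  have "(\<integral>\<^sup>+z. indicator fdom z * (\<integral>\<^sup>+w. T z w \<partial>hyp_area) \<partial>hyp_area)
      = (\<integral>\<^sup>+z. of_nat (card K) * upper_area * indicator fdom z \<partial>hyp_area)"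
    using out fdom_subset by (intro nn_integral_cong) (auto simp: indicator_def)
  moreover have "(\<integral>\<^sup>+w. indicator fdom w * (\<integral>\<^sup>+z. T z w \<partial>hyp_area) \<partial>hyp_area)
      = (\<integral>\<^sup>+z. of_nat (card K) * lower_area * indicator fdom z \<partial>hyp_area)"
    using inn fdom_subset by (intro nn_integral_cong) (auto simp: indicator_def)
  ultimately have "of_nat (card K) * upper_area * emeasure hyp_area fdom
      = of_nat (card K) * lower_area * emeasure hyp_area fdom"
    using mass_transport[OF Tm Tinv] by (simp add: nn_integral_cmult_indicator)
  hence "(of_nat (card K) * emeasure hyp_area fdom) * upper_area
      = (of_nat (card K) * emeasure hyp_area fdom) * lower_area"
    by (simp add: mult_ac)
  moreover have "card K \<noteq> 0" using finK one_G by (auto simp: K_def)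
  hence "of_nat (card K) * emeasure hyp_area fdom \<noteq> 0" "of_nat (card K) * emeasure hyp_area fdom \<noteq> \<infinity>"
    using emeasure_fdom_pos fdom(2) by (auto simp: ennreal_mult_eq_top_iff)
  ultimately have "upper_area = lower_area"
    by (simp add: ennreal_mult_cancel_left)
  thus False using upper_area_less_lower_area by simp
qed

end

section \<open>Jensen's inequality on roots of unity\<close>

text \<open>
  The square of the invariant norm of a form \<open>f\<close> of weight \<open>-n\<close>. The square avoids half-integral powers of \<open>y\<close>.
\<close>

definition size_sq :: "nat \<Rightarrow> (complex \<Rightarrow> complex) \<Rightarrow> complex \<Rightarrow> real" where
  "size_sq n f z = (cmod (f z))\<^sup>2 / Im z ^ n"

text \<open>
  Cutting off the logarithm at \<open>0\<close> keeps it finite at the zeros of \<open>f\<close> and makes it a nonnegative function.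
\<close>

definition log_size :: "nat \<Rightarrow> (complex \<Rightarrow> complex) \<Rightarrow> complex \<Rightarrow> real" where
  "log_size n f z = ln (max 1 (size_sq n f z))"

lemma log_size_nonneg: "0 \<le> log_size n f z"
  by (simp add: log_size_def)

lemma measurable_log_size [measurable]:
  assumes [measurable]: "f \<in> borel_measurable borel"
  shows "log_size n f \<in> borel_measurable borel"
  unfolding log_size_def size_sq_def by measurable

lemma root_of_unity_near:
  assumes "0 < d"
  obtains M :: nat where "M > 0" "\<And>u. cmod u = 1 \<Longrightarrow> \<exists>\<omega>. \<omega> ^ M = 1 \<and> cmod (u - \<omega>) < d"
proof -
  have "uniformly_continuous_on {0..2*pi} cis"
    by (intro compact_uniformly_continuous continuous_intros) auto
  then obtain \<delta> where \<delta>: "\<delta> > 0"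
    "\<And>a b. a \<in> {0..2*pi} \<Longrightarrow> b \<in> {0..2*pi} \<Longrightarrow> dist b a < \<delta> \<Longrightarrow> dist (cis b) (cis a) < d"
    using assms unfolding uniformly_continuous_on_def by metis
  obtain M :: nat where M: "2 * pi / \<delta> < real M" using reals_Archimedean2 by blast
  have M0: "real M > 0" using M \<delta>(1) by (smt (verit) divide_pos_pos pi_gt_zero)
  have small: "2 * pi / real M < \<delta>" using M M0 \<delta>(1) by (simp add: field_simps)
  show thesis
  proof (rule that[of M])
    show "M > 0" using M0 by simp
    fix u :: complex assume u: "cmod u = 1"
    define \<theta> where "\<theta> = Arg2pi u"
    have \<theta>: "0 \<le> \<theta>" "\<theta> < 2 * pi" "u = cis \<theta>"
      using Arg2pi[of u] u by (simp_all add: \<theta>_def cis_conv_exp is_Arg_def mult.commute)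
    define k where "k = nat \<lfloor>\<theta> * real M / (2 * pi)\<rfloor>"
    define b where "b = 2 * pi * real k / real M"
    have k: "real k \<le> \<theta> * real M / (2 * pi)" "\<theta> * real M / (2 * pi) < real k + 1"
      using \<theta> M0 by (simp_all add: k_def)
    have b: "b \<le> \<theta>" "\<theta> < b + 2 * pi / real M"
      using k M0 by (simp_all add: b_def field_simps)
    have "real M * b = 2 * pi * real k" using M0 by (simp add: b_def)
    hence "cis b ^ M = cis (2 * pi * real k)" by (simp only: Complex.DeMoivre)
    also have "\<dots> = cis (2 * pi) ^ k" by (simp add: Complex.DeMoivre mult.commute)
    finally have 1: "cis b ^ M = 1" by simp
    have "0 \<le> b" by (simp add: b_def)
    have "dist (cis \<theta>) (cis b) < d"
      using b \<theta> small \<open>0 \<le> b\<close> by (intro \<delta>(2)) (auto simp: dist_real_def)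
    hence "cmod (u - cis b) < d" using \<theta>(3) by (simp add: dist_norm)
    with 1 show "\<exists>\<omega>. \<omega> ^ M = 1 \<and> cmod (u - \<omega>) < d" by blast
  qed
qed

lemma norm_roots_of_unity: "\<omega> ^ M = 1 \<Longrightarrow> M > 0 \<Longrightarrow> cmod \<omega> = 1" for \<omega> :: complex
  by (metis norm_ge_zero norm_one norm_power power_eq_1_iff less_numeral_extra(3) abs_norm_cancel)

lemma prod_max_1_ge:
  fixes a :: "'a \<Rightarrow> real"
  assumes "finite I" "\<And>i. i \<in> I \<Longrightarrow> 0 \<le> a i"
  shows "max 1 (\<Prod>i\<in>I. a i) \<le> (\<Prod>i\<in>I. max 1 (a i))"
proof (rule max.boundedI)
  show "1 \<le> (\<Prod>i\<in>I. max 1 (a i))" by (rule prod_ge_1) auto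
  show "(\<Prod>i\<in>I. a i) \<le> (\<Prod>i\<in>I. max 1 (a i))" using assms by (intro prod_mono) auto
qed

text \<open>
  Jensen's inequality with the integral over a circle replaced by a sum over an orbit of the \<open>M\<close>-th roots of unity.
  The product of the functions \<open>g(\<omega>\<zeta>)\<close> is holomorphic with value \<open>g(0)\<^sup>M\<close> at the origin, and so
  the maximum principle gives a point on the circle where it is at least as large.
\<close>

lemma submean_circle:
  assumes hol: "g holomorphic_on ball 0 1" and M: "M > 0" and r: "0 < r" "r < 1"
  obtains \<xi> where "cmod \<xi> = r"
    "real M * ln (max 1 ((cmod (g 0))\<^sup>2)) \<le> (\<Sum>\<omega>\<in>{\<omega>. \<omega> ^ M = 1}. ln (max 1 ((cmod (g (\<omega> * \<xi>)))\<^sup>2)))"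
proof -
  let ?R = "{\<omega>::complex. \<omega> ^ M = 1}"
  have fin: "finite ?R" using M by (intro finite_roots_unity) auto
  have card: "card ?R = M" using M by (rule card_roots_unity_eq)
  define P where "P \<xi> = (\<Prod>\<omega>\<in>?R. g (\<omega> * \<xi>))" for \<xi>
  have "P holomorphic_on ball 0 1"
    unfolding P_def
  proof (intro holomorphic_on_prod)
    fix \<omega> assume "\<omega> \<in> ?R"
    hence "(*) \<omega> ` ball 0 1 \<subseteq> ball 0 1" using norm_roots_of_unity[of \<omega> M] M by (auto simp: norm_mult)
    thus "(\<lambda>\<xi>. g (\<omega> * \<xi>)) holomorphic_on ball 0 1"
      using holomorphic_on_compose_gen[of "(*) \<omega>" "ball 0 1" g "ball 0 1"] hol
      by (auto simp: o_def intro!: holomorphic_intros)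
  qed
  moreover have sub: "cball 0 r \<subseteq> (ball 0 1 :: complex set)" using r by auto
  ultimately have P: "P holomorphic_on cball 0 r" by (rule holomorphic_on_subset)
  have "continuous_on (sphere 0 r) (\<lambda>\<xi>. cmod (P \<xi>))"
    using holomorphic_on_imp_continuous_on[OF P]
    by (intro continuous_on_norm) (auto intro: continuous_on_subset)
  moreover have "sphere (0::complex) r \<noteq> {}" using r by simp
  ultimately obtain \<xi> where \<xi>: "\<xi> \<in> sphere 0 r" "\<And>x. x \<in> sphere 0 r \<Longrightarrow> cmod (P x) \<le> cmod (P \<xi>)"
    using continuous_attains_sup[of "sphere 0 r" "\<lambda>\<xi>. cmod (P \<xi>)"] by auto
  have "cmod (P 0) \<le> cmod (P \<xi>)"
  proof (rule maximum_modulus_frontier[where S = "cball 0 r" and f = P and \<xi> = 0])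
    show "P holomorphic_on interior (cball 0 r)" by (rule holomorphic_on_subset[OF P]) auto
    show "continuous_on (closure (cball 0 r)) P"
      using holomorphic_on_imp_continuous_on[OF P] by simp
  qed (use \<xi>(2) r in \<open>auto simp: sphere_def frontier_cball\<close>)
  hence le: "(cmod (P 0))\<^sup>2 \<le> (cmod (P \<xi>))\<^sup>2" by (simp add: power_mono)
  have max_pow: "max 1 a ^ M = max 1 (a ^ M)" if "0 \<le> a" for a :: real
  proof (cases "a \<le> 1")
    case True thus ?thesis using that power_le_one[of a M] by (simp add: max_def)
  next
    case False thus ?thesis using one_le_power[of a M] by (simp add: max_def)
  qed
  have "real M * ln (max 1 ((cmod (g 0))\<^sup>2)) = ln (max 1 ((cmod (g 0))\<^sup>2) ^ M)"
    by (simp add: ln_realpow)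
  also have "max 1 ((cmod (g 0))\<^sup>2) ^ M = max 1 ((cmod (P 0))\<^sup>2)"
    by (simp add: max_pow P_def card norm_power power_mult[symmetric] mult.commute)
  also have "ln (max 1 ((cmod (P 0))\<^sup>2)) \<le> ln (max 1 ((cmod (P \<xi>))\<^sup>2))"
    by (subst ln_le_cancel_iff) (simp_all only: less_max_iff_disj zero_less_one simp_thms max.mono[OF order_refl le])
  also have "max 1 ((cmod (P \<xi>))\<^sup>2) = max 1 (\<Prod>\<omega>\<in>?R. (cmod (g (\<omega> * \<xi>)))\<^sup>2)"
    by (simp add: P_def prod_norm[symmetric] prod_power_distrib)
  also have "ln \<dots> \<le> ln (\<Prod>\<omega>\<in>?R. max 1 ((cmod (g (\<omega> * \<xi>)))\<^sup>2))"
    using prod_max_1_ge[OF fin, of "\<lambda>\<omega>. (cmod (g (\<omega> * \<xi>)))\<^sup>2"]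
    by (subst ln_le_cancel_iff) (auto intro!: prod_pos)
  also have "\<dots> = (\<Sum>\<omega>\<in>?R. ln (max 1 ((cmod (g (\<omega> * \<xi>)))\<^sup>2)))"
    by (rule ln_prod) (use fin in auto)
  finally show thesis using \<xi>(1) by (intro that) auto
qed

text \<open>
  The point on the circle that \<open>submean_circle\<close> provides can be rotated by roots of unity close to any given point. By uniform
  continuity the inequality holds there as well, up to an error.
\<close>

lemma submean_roots_of_unity:
  assumes hol: "g holomorphic_on ball 0 1" and "0 < \<epsilon>"
  obtains M where "M > 0" "\<And>\<zeta>. cmod \<zeta> \<le> 1/2 \<Longrightarrow>
    real M * (ln (max 1 ((cmod (g 0))\<^sup>2)) - \<epsilon>) \<le> (\<Sum>\<omega>\<in>{\<omega>. \<omega> ^ M = 1}. ln (max 1 ((cmod (g (\<omega> * \<zeta>)))\<^sup>2)))"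
proof -
  define U where "U \<zeta> = ln (max 1 ((cmod (g \<zeta>))\<^sup>2))" for \<zeta>
  have "cball 0 (1/2) \<subseteq> (ball 0 1 :: complex set)" by auto
  hence "continuous_on (cball 0 (1/2)) g"
    using hol by (meson holomorphic_on_imp_continuous_on holomorphic_on_subset)
  hence "continuous_on (cball 0 (1/2)) U"
    unfolding U_def by (intro continuous_intros) auto
  hence "uniformly_continuous_on (cball 0 (1/2)) U" by (rule compact_uniformly_continuous) simp
  then obtain d where d: "d > 0"
    "\<And>a b. a \<in> cball 0 (1/2) \<Longrightarrow> b \<in> cball 0 (1/2) \<Longrightarrow> dist b a < d \<Longrightarrow> dist (U b) (U a) < \<epsilon>"
    using \<open>0 < \<epsilon>\<close> unfolding uniformly_continuous_on_def by metis
  obtain M where M: "M > 0" "\<And>u. cmod u = 1 \<Longrightarrow> \<exists>\<omega>. \<omega> ^ M = 1 \<and> cmod (u - \<omega>) < d"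
    using root_of_unity_near[OF d(1)] by blast
  let ?R = "{\<omega>::complex. \<omega> ^ M = 1}"
  have fin: "finite ?R" using M by (intro finite_roots_unity) auto
  have card: "card ?R = M" using M(1) by (rule card_roots_unity_eq)
  have "real M * (U 0 - \<epsilon>) \<le> (\<Sum>\<omega>\<in>?R. U (\<omega> * \<zeta>))" if \<zeta>: "cmod \<zeta> \<le> 1/2" for \<zeta>
  proof (cases "\<zeta> = 0")
    case True
    thus ?thesis using card \<open>0 < \<epsilon>\<close> M by (simp add: algebra_simps)
  next
    case False
    obtain \<xi> where \<xi>: "cmod \<xi> = cmod \<zeta>" "real M * U 0 \<le> (\<Sum>\<omega>\<in>?R. U (\<omega> * \<xi>))"
      using submean_circle[OF hol M(1), of "cmod \<zeta>"] False \<zeta> unfolding U_def by auto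
    have "\<xi> \<noteq> 0" using \<xi>(1) False by auto
    hence "cmod (\<zeta> / \<xi>) = 1" using \<xi>(1) False by (simp add: norm_divide)
    then obtain \<eta> where \<eta>: "\<eta> ^ M = 1" "cmod (\<zeta> / \<xi> - \<eta>) < d" using M(2) by blast
    have n1: "cmod \<eta> = 1" using norm_roots_of_unity[OF \<eta>(1) M(1)] .
    have "\<zeta> - \<eta> * \<xi> = (\<zeta> / \<xi> - \<eta>) * \<xi>" using \<open>\<xi> \<noteq> 0\<close> by (simp add: field_simps)
    hence "cmod (\<zeta> - \<eta> * \<xi>) = cmod (\<zeta> / \<xi> - \<eta>) * cmod \<xi>" by (simp add: norm_mult)
    also have "\<dots> \<le> cmod (\<zeta> / \<xi> - \<eta>) * 1" using \<xi>(1) \<zeta> by (intro mult_left_mono) auto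
    finally have near: "cmod (\<zeta> - \<eta> * \<xi>) < d" using \<eta>(2) by simp
    have "U (\<omega> * (\<eta> * \<xi>)) - \<epsilon> \<le> U (\<omega> * \<zeta>)" if "\<omega> \<in> ?R" for \<omega>
    proof -
      have w: "cmod \<omega> = 1" using that norm_roots_of_unity M(1) by auto
      have "cmod (\<omega> * (\<eta> * \<xi>) - \<omega> * \<zeta>) < d"
        using near w by (simp add: norm_mult norm_minus_commute flip: right_diff_distrib)
      hence "dist (U (\<omega> * (\<eta> * \<xi>))) (U (\<omega> * \<zeta>)) < \<epsilon>"
        using w n1 \<xi>(1) \<zeta> by (intro d(2)) (auto simp: norm_mult dist_norm)
      thus ?thesis by (simp add: dist_real_def)
    qed
    hence "(\<Sum>\<omega>\<in>?R. U (\<omega> * (\<eta> * \<xi>)) - \<epsilon>) \<le> (\<Sum>\<omega>\<in>?R. U (\<omega> * \<zeta>))"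
      by (rule sum_mono)
    moreover have "(\<Sum>\<omega>\<in>?R. U (\<omega> * (\<eta> * \<xi>))) = (\<Sum>\<omega>\<in>?R. U (\<omega> * \<xi>))"
    proof (rule sum.reindex_bij_witness[of _ "\<lambda>\<omega>. \<omega> / \<eta>" "\<lambda>\<omega>. \<omega> * \<eta>"])
      have "\<eta> \<noteq> 0" using n1 by auto
      thus "\<And>a. a \<in> ?R \<Longrightarrow> a * \<eta> / \<eta> = a" "\<And>a. a \<in> ?R \<Longrightarrow> a / \<eta> * \<eta> = a" by simp_all
    qed (use \<eta>(1) in \<open>auto simp: power_mult_distrib power_divide mult.assoc\<close>)
    ultimately show ?thesis using \<xi>(2) card by (simp add: sum_subtractf algebra_simps)
  qed
  thus thesis using M(1) by (intro that[of M]) (auto simp: U_def)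
qed

section \<open>The Cayley transform and the mean value inequality on hyperbolic discs\<close>

definition cayley :: "complex \<Rightarrow> complex" where
  "cayley z = (z - \<i>) / (z + \<i>)"

definition cayley_inv :: "complex \<Rightarrow> complex" where
  "cayley_inv \<zeta> = \<i> * (1 + \<zeta>) / (1 - \<zeta>)"

lemma uhp_plus_i_nonzero: "z \<in> uhp \<Longrightarrow> z + \<i> \<noteq> 0"
  by (auto simp: uhp_def complex_eq_iff)

lemma one_minus_cayley: "z \<in> uhp \<Longrightarrow> 1 - cayley z = 2 * \<i> / (z + \<i>)"
  using uhp_plus_i_nonzero[of z] by (simp add: cayley_def field_simps)

lemma cayley_inv_cayley:
  assumes "z \<in> uhp" shows "cayley_inv (cayley z) = z"
proof -
  have nz: "z + \<i> \<noteq> 0" using assms by (rule uhp_plus_i_nonzero)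
  have "1 + cayley z = 2 * z / (z + \<i>)" using nz by (simp add: cayley_def field_simps)
  thus ?thesis using nz by (simp add: cayley_inv_def one_minus_cayley[OF assms])
qed

lemma cayley_i [simp]: "cayley \<i> = 0"
  by (simp add: cayley_def)

lemma norm_plus_i: "(cmod (z + \<i>))\<^sup>2 = (cmod (z - \<i>))\<^sup>2 + 4 * Im z"
  by (simp add: cmod_power2) (simp add: power2_eq_square algebra_simps)

lemma cayley_inv_uhp:
  assumes "cmod \<zeta> < 1" shows "cayley_inv \<zeta> \<in> uhp"
proof -
  have n: "(1 - \<zeta>) \<noteq> 0" using assms by auto
  have "Im (cayley_inv \<zeta>) = (1 - (cmod \<zeta>)\<^sup>2) / (cmod (1 - \<zeta>))\<^sup>2"
    by (simp add: cayley_inv_def Im_divide cmod_power2) (simp add: power2_eq_square algebra_simps)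
  moreover have "(cmod \<zeta>)\<^sup>2 < 1" using assms by (simp add: power_less_one_iff abs_square_less_1)
  ultimately show ?thesis using n by (simp add: uhp_def)
qed

lemma norm_cayley_close:
  assumes "close \<i> w" shows "cmod (cayley w) \<le> 1/2"
proof -
  have w: "w \<in> uhp" "(cmod (w - \<i>))\<^sup>2 < Im w"
    using assms by (auto simp: close_def norm_minus_commute)
  have "4 * (cmod (w - \<i>))\<^sup>2 \<le> (cmod (w + \<i>))\<^sup>2"
    using norm_plus_i[of w] w(2) zero_le_power2[of "cmod (w - \<i>)"] by linarith
  hence "(2 * cmod (w - \<i>))\<^sup>2 \<le> (cmod (w + \<i>))\<^sup>2"
    by (simp add: power_mult_distrib)
  hence "2 * cmod (w - \<i>) \<le> cmod (w + \<i>)" by (rule power2_le_imp_le) simp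
  thus ?thesis using uhp_plus_i_nonzero[OF w(1)] by (simp add: cayley_def norm_divide field_simps)
qed

text \<open>
  The stabiliser of \<open>\<i>\<close> acts on the disc model by all rotations.
\<close>

lemma rotation_exists:
  assumes "cmod \<omega> = 1"
  obtains A where "det A = 1" "moebius A \<i> = \<i>" "\<And>z. z \<in> uhp \<Longrightarrow> cayley (moebius A z) = \<omega> * cayley z"
proof -
  define a where "a = Arg2pi \<omega> / 2"
  have \<omega>: "\<omega> = cis (2 * a)"
    using Arg2pi[of \<omega>] assms by (simp add: a_def cis_conv_exp is_Arg_def mult.commute)
  define c where "c = complex_of_real (cos a)"
  define s where "s = complex_of_real (sin a)"
  define A :: "real^2^2" where "A = vector [vector [cos a, sin a], vector [- sin a, cos a]]"
  have det: "det A = 1" by (simp add: A_def det_2)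
  have m: "moebius A z = (c * z + s) / (- s * z + c)" for z
    by (simp add: moebius_def autom_def A_def c_def s_def)
  have i2: "\<i> * (\<i> * x) = - x" for x by (simp flip: mult.assoc)
  have e: "c + \<i> * s = cis a" "c - \<i> * s = cis (- a)"
    by (simp_all add: c_def s_def complex_eq_iff)
  show thesis
  proof (rule that[of A])
    show "moebius A \<i> = \<i>"
    proof -
      have "c * \<i> + s = \<i> * (- s * \<i> + c)" by (simp add: algebra_simps i2)
      moreover have "- s * \<i> + c \<noteq> 0" using e(2) by (simp add: mult.commute)
      ultimately show ?thesis by (simp add: m)
    qed
    fix z assume z: "z \<in> uhp"
    have nz: "- s * z + c \<noteq> 0" using autom_nonzero[OF det z] by (simp add: autom_def A_def c_def s_def)
    have md: "moebius A z * (- s * z + c) = c * z + s" using nz by (simp add: m)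
    have "(moebius A z - \<i>) * (- s * z + c) = cis a * (z - \<i>)"
      unfolding e(1)[symmetric] left_diff_distrib[of "moebius A z"] md by (simp add: algebra_simps i2)
    moreover have "(moebius A z + \<i>) * (- s * z + c) = cis (- a) * (z + \<i>)"
      unfolding e(2)[symmetric] distrib_right[of "moebius A z"] md by (simp add: algebra_simps i2)
    ultimately have "cayley (moebius A z) = (cis a * (z - \<i>)) / (cis (- a) * (z + \<i>))"
      unfolding cayley_def using nz by (metis mult_divide_mult_cancel_right)
    also have "\<dots> = (cis a / cis (- a)) * cayley z" by (simp add: cayley_def)
    also have "cis a / cis (- a) = \<omega>" unfolding \<omega> by (simp add: cis_divide)
    finally show "cayley (moebius A z) = \<omega> * cayley z" .
  qed (rule det)
qed

text \<open>
  The factor \<open>(1-\<zeta>)\<^sup>n\<close> is chosen such that \<open>|f|\<^sup>2 / y\<^sup>n\<close> becomes \<open>|disc_form n f|\<^sup>2 / (1-|\<zeta>|\<^sup>2)\<^sup>n\<close>,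
  with a denominator that is invariant under rotations and at most \<open>1\<close>.
\<close>

definition disc_form :: "nat \<Rightarrow> (complex \<Rightarrow> complex) \<Rightarrow> complex \<Rightarrow> complex" where
  "disc_form n f \<zeta> = f (cayley_inv \<zeta>) * (1 - \<zeta>) ^ n"

lemma holomorphic_disc_form:
  assumes "f holomorphic_on uhp"
  shows "disc_form n f holomorphic_on ball 0 1"
proof -
  have "cayley_inv holomorphic_on ball 0 1"
    unfolding cayley_inv_def[abs_def] by (intro holomorphic_intros) auto
  moreover have "cayley_inv ` ball 0 1 \<subseteq> uhp" using cayley_inv_uhp by auto
  ultimately have "(f \<circ> cayley_inv) holomorphic_on ball 0 1"
    using assms holomorphic_on_compose_gen by blast
  thus ?thesis unfolding disc_form_def[abs_def] o_def by (intro holomorphic_intros)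
qed

lemma Im_cayley:
  assumes "z \<in> uhp"
  shows "Im z * (cmod (1 - cayley z))\<^sup>2 = 1 - (cmod (cayley z))\<^sup>2"
proof -
  have p: "(cmod (z + \<i>))\<^sup>2 \<noteq> 0" using uhp_plus_i_nonzero[OF assms] by simp
  have "Im z * (cmod (1 - cayley z))\<^sup>2 = 4 * Im z / (cmod (z + \<i>))\<^sup>2"
    unfolding one_minus_cayley[OF assms] by (simp add: norm_divide norm_mult power_divide)
  also have "4 * Im z = (cmod (z + \<i>))\<^sup>2 - (cmod (z - \<i>))\<^sup>2" using norm_plus_i[of z] by simp
  also have "\<dots> / (cmod (z + \<i>))\<^sup>2 = 1 - (cmod (cayley z))\<^sup>2"
  proof -
    have "(cmod (cayley z))\<^sup>2 = (cmod (z - \<i>))\<^sup>2 / (cmod (z + \<i>))\<^sup>2"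
      by (simp add: cayley_def norm_divide power_divide)
    thus ?thesis using p by (simp add: diff_divide_distrib)
  qed
  finally show ?thesis .
qed

lemma log_size_ge_disc_form:
  assumes z: "z \<in> uhp"
  shows "ln (max 1 ((cmod (disc_form n f (cayley z)))\<^sup>2)) \<le> log_size n f z"
proof -
  have y: "Im z > 0" using z by (simp add: uhp_def)
  have "(cmod (disc_form n f (cayley z)))\<^sup>2 = (cmod (f z))\<^sup>2 * ((cmod (1 - cayley z))\<^sup>2) ^ n"
    using z by (simp add: disc_form_def cayley_inv_cayley norm_mult norm_power power_mult_distrib
        power_mult[symmetric] mult.commute)
  also have "\<dots> = (cmod (f z))\<^sup>2 / Im z ^ n * (Im z * (cmod (1 - cayley z))\<^sup>2) ^ n"
    using y by (simp add: power_mult_distrib)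
  also have "\<dots> \<le> (cmod (f z))\<^sup>2 / Im z ^ n * 1"
  proof (rule mult_left_mono)
    have "0 \<le> Im z * (cmod (1 - cayley z))\<^sup>2" using y by simp
    thus "(Im z * (cmod (1 - cayley z))\<^sup>2) ^ n \<le> 1"
      using Im_cayley[OF z] by (intro power_le_one) auto
  qed (use y in auto)
  finally show ?thesis by (simp add: log_size_def size_sq_def max.coboundedI2)
qed

lemma log_size_i: "log_size n f \<i> = ln (max 1 ((cmod (disc_form n f 0))\<^sup>2))"
  by (simp add: log_size_def size_sq_def disc_form_def cayley_inv_def)

text \<open>
  The area and the disc around \<open>\<i>\<close> are invariant under rotations about \<open>\<i>\<close>. So the integral is the average of
  its rotations by roots of unity, and \<open>submean_roots_of_unity\<close> applies to the integrand at each point.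
\<close>

lemma log_size_submean_i:
  assumes hol: "f holomorphic_on uhp" and [measurable]: "f \<in> borel_measurable borel"
  shows "disc_area * ennreal (log_size n f \<i>)
    \<le> (\<integral>\<^sup>+w. indicator {w. close \<i> w} w * ennreal (log_size n f w) \<partial>hyp_area)" (is "_ \<le> ?I")
proof -
  let ?v = "log_size n f"
  have i: "\<i> \<in> uhp" by (simp add: uhp_def)
  have bound: "disc_area * ennreal (?v \<i> - \<epsilon>) \<le> ?I" if eps: "\<epsilon> > 0" for \<epsilon>
  proof -
    obtain M where M: "M > 0" "\<And>\<zeta>. cmod \<zeta> \<le> 1/2 \<Longrightarrow>
        real M * (?v \<i> - \<epsilon>) \<le> (\<Sum>\<omega>\<in>{\<omega>. \<omega> ^ M = 1}. ln (max 1 ((cmod (disc_form n f (\<omega> * \<zeta>)))\<^sup>2)))"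
      using submean_roots_of_unity[OF holomorphic_disc_form[OF hol] eps] log_size_i by metis
    let ?R = "{\<omega>::complex. \<omega> ^ M = 1}"
    have card: "card ?R = M" using M(1) by (rule card_roots_unity_eq)
    have "\<exists>A. det A = 1 \<and> moebius A \<i> = \<i> \<and> (\<forall>z\<in>uhp. cayley (moebius A z) = \<omega> * cayley z)" if "\<omega> \<in> ?R" for \<omega>
      using rotation_exists[of \<omega>] norm_roots_of_unity[of \<omega> M] that M(1) by (metis mem_Collect_eq)
    then obtain A where A: "\<And>\<omega>. \<omega> \<in> ?R \<Longrightarrow> det (A \<omega>) = 1" "\<And>\<omega>. \<omega> \<in> ?R \<Longrightarrow> moebius (A \<omega>) \<i> = \<i>"
      "\<And>\<omega> z. \<omega> \<in> ?R \<Longrightarrow> z \<in> uhp \<Longrightarrow> cayley (moebius (A \<omega>) z) = \<omega> * cayley z" by metis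
    have avg: "real M * (?v \<i> - \<epsilon>) \<le> (\<Sum>\<omega>\<in>?R. ?v (moebius (A \<omega>) w))" if w: "close \<i> w" for w
    proof -
      have "real M * (?v \<i> - \<epsilon>) \<le> (\<Sum>\<omega>\<in>?R. ln (max 1 ((cmod (disc_form n f (\<omega> * cayley w)))\<^sup>2)))"
        by (rule M(2)[OF norm_cayley_close[OF w]])
      also have "\<dots> \<le> (\<Sum>\<omega>\<in>?R. ?v (moebius (A \<omega>) w))"
      proof (rule sum_mono)
        fix \<omega> assume \<omega>: "\<omega> \<in> ?R"
        show "ln (max 1 ((cmod (disc_form n f (\<omega> * cayley w)))\<^sup>2)) \<le> ?v (moebius (A \<omega>) w)"
          using log_size_ge_disc_form[OF moebius_uhp[OF A(1)[OF \<omega>] closeD(2)[OF w]], of n f]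
          by (simp only: A(3)[OF \<omega> closeD(2)[OF w]])
      qed
      finally show ?thesis .
    qed
    have "of_nat M * (disc_area * ennreal (?v \<i> - \<epsilon>))
        = (\<integral>\<^sup>+w. indicator {w. close \<i> w} w * ennreal (real M * (?v \<i> - \<epsilon>)) \<partial>hyp_area)"
      using M(1) by (subst nn_integral_multc)
        (auto simp: disc_area_def ennreal_mult' ennreal_of_nat_eq_real_of_nat mult_ac)
    also have "\<dots> \<le> (\<integral>\<^sup>+w. (\<Sum>\<omega>\<in>?R. indicator {w. close \<i> w} w * ennreal (?v (moebius (A \<omega>) w))) \<partial>hyp_area)"
    proof (rule nn_integral_mono)
      fix w
      show "indicator {w. close \<i> w} w * ennreal (real M * (?v \<i> - \<epsilon>))
          \<le> (\<Sum>\<omega>\<in>?R. indicator {w. close \<i> w} w * ennreal (?v (moebius (A \<omega>) w)))"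
        using avg[of w] by (auto simp: indicator_def sum_ennreal log_size_nonneg intro!: ennreal_leI)
    qed
    also have "\<dots> = (\<Sum>\<omega>\<in>?R. \<integral>\<^sup>+w. indicator {w. close \<i> w} w * ennreal (?v (moebius (A \<omega>) w)) \<partial>hyp_area)"
      by (rule nn_integral_sum) measurable
    also have "\<dots> = (\<Sum>\<omega>\<in>?R. ?I)"
    proof (rule sum.cong)
      fix \<omega> assume \<omega>: "\<omega> \<in> ?R"
      show "(\<integral>\<^sup>+w. indicator {w. close \<i> w} w * ennreal (?v (moebius (A \<omega>) w)) \<partial>hyp_area) = ?I"
        using nn_integral_close[OF A(1)[OF \<omega>] i, of "\<lambda>w. ennreal (?v w)"] A(2)[OF \<omega>] by simp
    qed simp
    also have "\<dots> = of_nat M * ?I" by (simp add: card)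
    finally show ?thesis using M(1)
      by (subst (asm) ennreal_mult_le_mult_iff) auto
  qed
  obtain b where b: "disc_area = ennreal b" "b > 0"
  proof -
    obtain r where r: "0 \<le> r" "disc_area = ennreal r"
      using disc_area_finite by (cases disc_area) auto
    moreover have "r \<noteq> 0" using disc_area_pos r by auto
    ultimately show thesis using that by simp
  qed
  show ?thesis
  proof (cases "?I = top_class.top")
    case False
    then obtain I where I: "?I = ennreal I" "0 \<le> I" by (cases ?I) auto
    have *: "b * ?v \<i> \<le> I + b * \<epsilon>" if "\<epsilon> > 0" for \<epsilon>
    proof -
      have "ennreal (b * (?v \<i> - \<epsilon>)) \<le> ennreal I"
        using bound[OF that] b I by (simp add: ennreal_mult')
      hence "b * (?v \<i> - \<epsilon>) \<le> I" using I(2) ennreal_le_iff by blast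
      thus ?thesis by (simp add: algebra_simps)
    qed
    have "b * ?v \<i> \<le> I"
    proof (rule field_le_epsilon)
      fix e :: real assume "0 < e"
      moreover have "b * (e / b) = e" using b(2) by simp
      ultimately show "b * ?v \<i> \<le> I + e"
        using * [of "e / b"] b(2) by simp
    qed
    hence "ennreal (b * ?v \<i>) \<le> ennreal I" by (rule ennreal_leI)
    thus ?thesis using b I by (simp add: ennreal_mult')
  qed simp
qed

theorem log_size_submean:
  assumes hol: "f holomorphic_on uhp" and [measurable]: "f \<in> borel_measurable borel" and z: "z \<in> uhp"
  shows "disc_area * ennreal (log_size n f z)
    \<le> (\<integral>\<^sup>+w. indicator {w. close z w} w * ennreal (log_size n f w) \<partial>hyp_area)"
proof -
  obtain A where A: "det A = 1" "moebius A \<i> = z" "\<And>w. moebius A w = of_real (Im z) * w + of_real (Re z)"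
    using moebius_transitive[OF z] by blast
  have y: "Im z > 0" and i: "\<i> \<in> uhp" using z by (auto simp: uhp_def)
  define h where "h w = f (moebius A w) / of_real (sqrt (Im z ^ n))" for w
  have "(cmod (h w))\<^sup>2 = (cmod (f (moebius A w)))\<^sup>2 / Im z ^ n" for w
    using y by (simp add: h_def norm_divide power_divide real_sqrt_power[symmetric])
  hence lh: "log_size n f (moebius A w) = log_size n h w" for w
    using y by (simp add: log_size_def size_sq_def A(3) power_mult_distrib)
  have "(f \<circ> moebius A) holomorphic_on uhp"
    using holomorphic_moebius[OF A(1)] hol moebius_uhp[OF A(1)]
    by (intro holomorphic_on_compose_gen[of _ _ _ uhp]) auto
  hence "h holomorphic_on uhp"
    unfolding h_def[abs_def] o_def using y by (intro holomorphic_intros) auto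
  moreover have "h \<in> borel_measurable borel" unfolding h_def by measurable
  ultimately have "disc_area * ennreal (log_size n h \<i>)
      \<le> (\<integral>\<^sup>+w. indicator {w. close \<i> w} w * ennreal (log_size n h w) \<partial>hyp_area)"
    by (rule log_size_submean_i)
  also have "\<dots> = (\<integral>\<^sup>+w. indicator {w. close z w} w * ennreal (log_size n f w) \<partial>hyp_area)"
    using nn_integral_close[OF A(1) i, of "\<lambda>w. ennreal (log_size n f w)"] A(2) by (simp add: lh)
  finally show ?thesis using lh[of \<i>] A(2) by simp
qed

section \<open>Equality in the mean value inequality\<close>

text \<open>
  Twice the hyperbolic cosine of the distance between \<open>z\<close> and \<open>\<i>\<close>; it is also the function that governs moderate growth.
\<close>

definition tau :: "complex \<Rightarrow> real" where
  "tau z = (1 + (cmod z)\<^sup>2) / Im z"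

lemma tau_gt_1:
  assumes "z \<in> uhp" shows "1 < tau z"
proof -
  have y: "0 < Im z" using assms by (simp add: uhp_def)
  have "0 \<le> (Im z - 1)\<^sup>2" by simp
  hence "2 * Im z \<le> 1 + (Im z)\<^sup>2" by (simp add: power2_eq_square algebra_simps)
  also have "\<dots> \<le> 1 + (cmod z)\<^sup>2" by (simp add: cmod_power2)
  finally show ?thesis using y by (simp add: tau_def less_divide_eq)
qed

lemma inverse_Im_le_tau: "z \<in> uhp \<Longrightarrow> 1 / Im z \<le> tau z"
  by (simp add: tau_def uhp_def divide_right_mono)

lemma tau_close:
  assumes "close z w" shows "tau w \<le> 24 * tau z"
proof -
  have p: "0 < Im z" "0 < Im w" using assms by (auto simp: close_def uhp_def)
  have "Im z \<le> 3 * Im w" using close_Im_less[of w z] assms close_sym by simp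
  hence i: "1 / Im w \<le> 3 / Im z" using p by (simp add: field_simps)
  have "tau w = (1 + (cmod w)\<^sup>2) * (1 / Im w)" by (simp add: tau_def)
  also have "\<dots> \<le> (8 * (1 + (cmod z)\<^sup>2)) * (3 / Im z)"
    using close_norm_le[OF assms] i p by (intro mult_mono) auto
  also have "\<dots> = 24 * tau z" by (simp add: tau_def)
  finally show ?thesis .
qed

context fuchsian
begin

text \<open>
  Up to a bounded error, the distance from \<open>z\<close> to the orbit of \<open>\<i>\<close>. The maximum only matters outside the upper half
  plane, where it keeps the infimum bounded below.
\<close>

definition height :: "complex \<Rightarrow> real" where
  "height z = (INF A\<in>G. ln (max 1 (tau (moebius A z))))"

lemma bdd_height: "bdd_below ((\<lambda>A. ln (max 1 (tau (moebius A z)))) ` G)"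
  by (intro bdd_belowI[of _ 0]) auto

lemma measurable_height [measurable]: "height \<in> borel_measurable borel"
  unfolding height_def
proof (rule borel_measurable_cINF[OF countable_G])
  fix A
  show "(\<lambda>z. ln (max 1 (tau (moebius A z)))) \<in> borel_measurable borel"
    unfolding tau_def by measurable
qed (rule bdd_height)

lemma height_le: "A \<in> G \<Longrightarrow> height z \<le> ln (max 1 (tau (moebius A z)))"
  unfolding height_def by (rule cINF_lower[OF bdd_height])

lemma height_greatest: "(\<And>A. A \<in> G \<Longrightarrow> c \<le> ln (max 1 (tau (moebius A z)))) \<Longrightarrow> c \<le> height z"
  unfolding height_def using one_G by (intro cINF_greatest) auto

lemma height_le_moebius:
  assumes "B \<in> G" "z \<in> uhp" shows "height z \<le> height (moebius B z)"
proof (rule height_greatest)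
  fix A assume "A \<in> G"
  thus "height z \<le> ln (max 1 (tau (moebius A (moebius B z))))"
    using height_le[of "A ** B" z] moebius_mult[of A B z] assms det_G mult_G by simp
qed

lemma height_moebius:
  assumes "B \<in> G" "z \<in> uhp" shows "height (moebius B z) = height z"
  using height_le_moebius[OF assms] height_le_moebius[OF adj_G[OF assms(1)] moebius_uhp[OF det_G[OF assms(1)] assms(2)]]
    moebius_adj[OF det_G[OF assms(1)] assms(2)] by simp

lemma height_close:
  assumes "close z w" shows "height w \<le> height z + ln 24"
proof -
  have "height w - ln 24 \<le> height z"
  proof (rule height_greatest)
    fix A assume A: "A \<in> G"
    have c: "close (moebius A z) (moebius A w)"
      using close_moebius[OF det_G[OF A]] assms closeD by blast
    have t: "1 < tau (moebius A z)" "1 < tau (moebius A w)" using tau_gt_1 closeD[OF c] by auto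
    have "height w \<le> ln (tau (moebius A w))" using height_le[OF A, of w] t by (simp add: max_def)
    also have "\<dots> \<le> ln (24 * tau (moebius A z))" using tau_close[OF c] t by (subst ln_le_cancel_iff) auto
    also have "\<dots> = ln 24 + ln (tau (moebius A z))" using t by (subst ln_mult) auto
    finally show "height w - ln 24 \<le> ln (max 1 (tau (moebius A z)))" using t by (simp add: max_def)
  qed
  thus ?thesis by simp
qed

definition cutoff :: "nat \<Rightarrow> complex \<Rightarrow> real" where
  "cutoff R z = max 0 (min 1 (2 - height z / real R))"

lemma measurable_cutoff [measurable]: "cutoff R \<in> borel_measurable borel"
  unfolding cutoff_def by measurable

lemma cutoff_nonneg: "0 \<le> cutoff R z"
  by (simp add: cutoff_def)

lemma cutoff_le_1: "cutoff R z \<le> 1"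
  by (simp add: cutoff_def)

lemma cutoff_eq_1: "R > 0 \<Longrightarrow> height z \<le> real R \<Longrightarrow> cutoff R z = 1"
  by (simp add: cutoff_def max_def min_def divide_le_eq)

lemma cutoff_eq_0: "R > 0 \<Longrightarrow> 2 * real R \<le> height z \<Longrightarrow> cutoff R z = 0"
  by (simp add: cutoff_def max_def min_def divide_le_eq le_divide_eq)

text \<open>
  Between close points the height changes by at most \<open>log 24\<close>, and hence the cutoff by at most \<open>(log 24)/R\<close>; it
  does not change at all where it is locally constant.
\<close>

lemma cutoff_close:
  assumes R: "R > 0" and c: "close z w"
  shows "cutoff R z \<le> cutoff R w + ln 24 / real R *
    indicator {w. real R - ln 24 \<le> height w \<and> height w \<le> 2 * real R + ln 24} w"
proof -
  have h: "height w \<le> height z + ln 24" "height z \<le> height w + ln 24"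
    using height_close[of z w] height_close[of w z] c close_sym by auto
  have R': "real R > 0" using R by simp
  have "height w / real R \<le> height z / real R + ln 24 / real R"
    using h(1) R' by (simp add: field_simps)
  hence 1: "cutoff R z \<le> cutoff R w + ln 24 / real R"
  proof -
    have "max 0 (min 1 (2 - x)) \<le> max 0 (min 1 (2 - y)) + d" if "y \<le> x + d" "0 \<le> d" for x y d :: real
      using that by (simp add: max_def min_def)
    thus ?thesis using \<open>height w / real R \<le> _\<close> by (simp add: cutoff_def)
  qed
  consider "height w < real R - ln 24" | "2 * real R + ln 24 < height w" |
    "real R - ln 24 \<le> height w \<and> height w \<le> 2 * real R + ln 24" by linarith
  thus ?thesis
  proof cases
    case 1
    hence "height w \<le> real R" using ln_ge_zero[of 24] by linarith
    hence "cutoff R w = 1" by (rule cutoff_eq_1[OF R])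
    thus ?thesis using cutoff_le_1[of R z] 1 by (simp add: indicator_def)
  next
    case 2
    hence "2 * real R \<le> height z" using h by linarith
    hence "cutoff R z = 0" by (rule cutoff_eq_0[OF R])
    thus ?thesis using cutoff_nonneg[of R w] 2 by (simp add: indicator_def)
  next
    case 3
    thus ?thesis using 1 by (simp add: indicator_def)
  qed
qed

text \<open>
  The sets decrease to the empty set, and by finite covolume their areas are finite.
\<close>

lemma tendsto_fdom_high:
  "(\<lambda>R. emeasure hyp_area (fdom \<inter> {z. real R - c \<le> height z})) \<longlonglongrightarrow> 0"
proof -
  let ?A = "\<lambda>R::nat. fdom \<inter> {z. real R - c \<le> height z}"
  have m: "?A R \<in> sets hyp_area" for R
  proof -
    have "{z. real R - c \<le> height z} \<in> sets borel" by measurable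
    thus ?thesis by auto
  qed
  have "(\<lambda>R. emeasure hyp_area (?A R)) \<longlonglongrightarrow> emeasure hyp_area (\<Inter>R. ?A R)"
  proof (rule Lim_emeasure_decseq)
    show "range ?A \<subseteq> sets hyp_area" using m by blast
    show "decseq ?A" by (rule decseq_SucI) auto
    fix R
    have "emeasure hyp_area (?A R) \<le> emeasure hyp_area fdom" by (rule emeasure_mono) auto
    thus "emeasure hyp_area (?A R) \<noteq> \<infinity>" using fdom(2) by (auto simp: top_unique)
  qed
  moreover have "(\<Inter>R. ?A R) = {}"
  proof -
    have "\<exists>R::nat. \<not> real R - c \<le> height z" for z
      using reals_Archimedean2[of "height z + c"] by (auto simp: algebra_simps not_le)
    thus ?thesis by blast
  qed
  ultimately show ?thesis by simp
qed

text \<open>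
  Let \<open>V\<close> be the integral of \<open>v\<close> over discs, and let \<open>e \<ge> 0\<close> be the defect \<open>V - disc_area v\<close>. Transport of
  \<open>v(w) \<phi>(z)\<close> between close points replaces \<open>\<integral> \<phi> V\<close> by the integral of \<open>v\<close> times the disc integral of
  \<open>\<phi>\<close>, which for a cutoff function \<open>\<phi>\<close> is almost \<open>disc_area \<phi>\<close>. The error is at most \<open>v/R\<close>, up to a factor, on
  the part where the cutoff varies. There \<open>v\<close> is of order \<open>R\<close>, and so the error is bounded by the area of this part.
\<close>

lemma submean_imp_mean:
  fixes v :: "complex \<Rightarrow> real"
  assumes vm [measurable]: "v \<in> borel_measurable borel" and v0: "\<And>z. 0 \<le> v z"
    and inv: "\<And>A z. A \<in> G \<Longrightarrow> z \<in> uhp \<Longrightarrow> v (moebius A z) = v z"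
    and grow: "\<And>z. z \<in> uhp \<Longrightarrow> v z \<le> c + m * height z" and cm: "0 \<le> c" "0 \<le> m"
    and sub: "\<And>z. z \<in> uhp \<Longrightarrow> disc_area * ennreal (v z)
        \<le> (\<integral>\<^sup>+w. indicator {w. close z w} w * ennreal (v w) \<partial>hyp_area)"
  shows "AE z in hyp_area. (\<integral>\<^sup>+w. indicator {w. close z w} w * ennreal (v w) \<partial>hyp_area) = disc_area * ennreal (v z)"
proof -
  define k where "k z w = (if close z w then 1 else 0 :: ennreal)" for z w
  have km [measurable]: "(\<lambda>(z, w). k z w) \<in> borel_measurable (borel \<Otimes>\<^sub>M borel)"
  proof -
    have [measurable]: "Measurable.pred (borel \<Otimes>\<^sub>M borel) (\<lambda>p. close (fst p) (snd p))"
      unfolding pred_def using measurable_close by (simp add: space_pair_measure)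
    show ?thesis unfolding k_def case_prod_beta by measurable
  qed
  have k_ind: "indicator {w. close z w} w = k z w" for z w by (simp add: k_def indicator_def)
  have k_area: "(\<integral>\<^sup>+w. k z w \<partial>hyp_area) = disc_area" if "z \<in> uhp" for z
    using emeasure_close[OF that] by (simp flip: k_ind)
  have k_area': "(\<integral>\<^sup>+w. k w z \<partial>hyp_area) = disc_area" if "z \<in> uhp" for z
    using k_area[OF that] close_sym by (simp add: k_def)
  define V where "V z = (\<integral>\<^sup>+w. k z w * ennreal (v w) \<partial>hyp_area)" for z
  have Vm [measurable]: "V \<in> borel_measurable borel" unfolding V_def by measurable
  have subV: "disc_area * ennreal (v z) \<le> V z" if "z \<in> uhp" for z
    using sub[OF that] by (simp add: V_def k_ind)
  define e where "e z = V z - disc_area * ennreal (v z)" for z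
  have em [measurable]: "e \<in> borel_measurable borel" unfolding e_def by measurable
  have fin: "disc_area * ennreal (v z) < \<infinity>" for z
    using disc_area_finite by (simp add: ennreal_mult_less_top)
  have Ve: "V z = e z + disc_area * ennreal (v z)" if "z \<in> uhp" for z
    unfolding e_def using subV[OF that] by (simp add: diff_add_cancel_ennreal)
  define L where "L = ln (24::real)"
  have L: "L \<ge> 0" by (simp add: L_def)
  \<comment> \<open>bounds \<open>v L / R\<close> where the height is at most \<open>2R + L\<close>\<close>
  define b where "b = L * (c + m * (2 + L))"
  have b: "b \<ge> 0" using L cm by (simp add: b_def)
  let ?F = "indicator fdom :: complex \<Rightarrow> ennreal"
  let ?high = "\<lambda>R. fdom \<inter> {z. real R - L \<le> height z}"
  have high_m: "?high R \<in> sets borel" for R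
  proof -
    have "{z. real R - L \<le> height z} \<in> sets borel" by measurable
    thus ?thesis by auto
  qed
  have main: "(\<integral>\<^sup>+z. ?F z * (ennreal (cutoff R z) * e z) \<partial>hyp_area) \<le> disc_area * ennreal b * emeasure hyp_area (?high R)"
    if R: "R > 0" for R
  proof -
    let ?\<phi> = "\<lambda>z. ennreal (cutoff R z)"
    define K where "K z w = k z w * (ennreal (v w) * ?\<phi> z)" for z w
    have Km: "(\<lambda>(z, w). K z w) \<in> borel_measurable (borel \<Otimes>\<^sub>M borel)"
      unfolding K_def by measurable
    have Kinv: "K (moebius A z) (moebius A w) = K z w" if "A \<in> G" "z \<in> uhp" "w \<in> uhp" for A z w
      using that det_G by (simp add: K_def k_def close_moebius inv cutoff_def height_moebius)
    have "(\<integral>\<^sup>+z. ?F z * (?\<phi> z * V z) \<partial>hyp_area) = (\<integral>\<^sup>+z. ?F z * (\<integral>\<^sup>+w. K z w \<partial>hyp_area) \<partial>hyp_area)"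
    proof (rule nn_integral_cong)
      fix z
      have "?\<phi> z * V z = (\<integral>\<^sup>+w. ?\<phi> z * (k z w * ennreal (v w)) \<partial>hyp_area)"
        unfolding V_def by (rule nn_integral_cmult[symmetric]) measurable
      thus "?F z * (?\<phi> z * V z) = ?F z * (\<integral>\<^sup>+w. K z w \<partial>hyp_area)"
        by (simp add: K_def mult_ac)
    qed
    also have "\<dots> = (\<integral>\<^sup>+w. ?F w * (\<integral>\<^sup>+z. K z w \<partial>hyp_area) \<partial>hyp_area)"
      by (rule mass_transport[OF Km Kinv])
    also have "\<dots> \<le> (\<integral>\<^sup>+w. ?F w * (?\<phi> w * (disc_area * ennreal (v w))) + disc_area * ennreal b * indicator (?high R) w \<partial>hyp_area)"
    proof (rule nn_integral_mono)
      fix w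
      show "?F w * (\<integral>\<^sup>+z. K z w \<partial>hyp_area)
        \<le> ?F w * (?\<phi> w * (disc_area * ennreal (v w))) + disc_area * ennreal b * indicator (?high R) w"
      proof (cases "w \<in> fdom")
        case True
        hence w: "w \<in> uhp" using fdom_subset by auto
        define a where "a = cutoff R w + L / real R *
          indicator {w. real R - L \<le> height w \<and> height w \<le> 2 * real R + L} w"
        have a0: "0 \<le> a" using cutoff_nonneg L by (auto simp: a_def indicator_def)
        have "(\<integral>\<^sup>+z. K z w \<partial>hyp_area) \<le> (\<integral>\<^sup>+z. k z w * ennreal (v w * a) \<partial>hyp_area)"
        proof (rule nn_integral_mono)
          fix z
          show "K z w \<le> k z w * ennreal (v w * a)"
            using cutoff_close[OF R, of z w] v0[of w] cutoff_nonneg[of R z]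
            by (auto simp: K_def k_def a_def L_def ennreal_mult'[symmetric] intro!: ennreal_leI mult_left_mono)
        qed
        also have "\<dots> = disc_area * ennreal (v w * a)"
          by (subst nn_integral_multc) (auto simp: k_area'[OF w])
        also have "v w * a \<le> cutoff R w * v w + b * indicator (?high R) w"
        proof -
          have "v w * (L / real R * indicator {w. real R - L \<le> height w \<and> height w \<le> 2 * real R + L} w)
              \<le> b * indicator (?high R) w"
          proof (cases "real R - L \<le> height w \<and> height w \<le> 2 * real R + L")
            case T: True
            have "v w \<le> c + m * height w" by (rule grow[OF w])
            also have "\<dots> \<le> c + m * (2 * real R + L)" using T cm by (intro add_left_mono mult_left_mono) auto
            also have "\<dots> \<le> c * real R + m * (2 * real R + L * real R)"
              using R cm L by (intro add_mono mult_left_mono) (auto simp: mult_le_cancel_left1)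
            also have "\<dots> = (c + m * (2 + L)) * real R" by (simp add: algebra_simps)
            finally have "v w * (L / real R) \<le> ((c + m * (2 + L)) * real R) * (L / real R)"
              using L by (intro mult_right_mono) auto
            also have "\<dots> = b" using R by (simp add: b_def)
            finally show ?thesis using T True by (simp add: indicator_def)
          qed (use b in \<open>auto simp: indicator_def\<close>)
          thus ?thesis by (simp add: a_def algebra_simps)
        qed
        hence "disc_area * ennreal (v w * a) \<le> disc_area * ennreal (cutoff R w * v w + b * indicator (?high R) w)"
          by (intro mult_left_mono ennreal_leI) auto
        also have "\<dots> = ?\<phi> w * (disc_area * ennreal (v w)) + disc_area * ennreal b * indicator (?high R) w"
          using v0[of w] cutoff_nonneg[of R w] b
          by (auto simp: ennreal_plus ennreal_mult' indicator_def algebra_simps)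
        finally show ?thesis using True by simp
      qed simp
    qed
    also have "\<dots> = (\<integral>\<^sup>+w. ?F w * (?\<phi> w * (disc_area * ennreal (v w))) \<partial>hyp_area)
        + disc_area * ennreal b * emeasure hyp_area (?high R)"
      using high_m by (subst nn_integral_add) (auto simp: nn_integral_cmult_indicator)
    finally have 1: "(\<integral>\<^sup>+z. ?F z * (?\<phi> z * V z) \<partial>hyp_area)
      \<le> (\<integral>\<^sup>+w. ?F w * (?\<phi> w * (disc_area * ennreal (v w))) \<partial>hyp_area) + disc_area * ennreal b * emeasure hyp_area (?high R)" .
    have 2: "(\<integral>\<^sup>+z. ?F z * (?\<phi> z * V z) \<partial>hyp_area) =
      (\<integral>\<^sup>+z. ?F z * (?\<phi> z * e z) \<partial>hyp_area) + (\<integral>\<^sup>+w. ?F w * (?\<phi> w * (disc_area * ennreal (v w))) \<partial>hyp_area)"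
    proof (subst nn_integral_add[symmetric])
      show "(\<integral>\<^sup>+z. ?F z * (?\<phi> z * V z) \<partial>hyp_area) =
        (\<integral>\<^sup>+z. ?F z * (?\<phi> z * e z) + ?F z * (?\<phi> z * (disc_area * ennreal (v z))) \<partial>hyp_area)"
        using fdom_subset by (intro nn_integral_cong) (auto simp: indicator_def Ve distrib_left)
    qed auto
    have 3: "(\<integral>\<^sup>+w. ?F w * (?\<phi> w * (disc_area * ennreal (v w))) \<partial>hyp_area) < \<infinity>"
    proof -
      have "?F w * (?\<phi> w * (disc_area * ennreal (v w))) \<le> (disc_area * ennreal (c + m * (2 * real R))) * ?F w" for w
      proof (cases "w \<in> fdom \<and> height w \<le> 2 * real R")
        case True
        hence w: "w \<in> uhp" using fdom_subset by auto
        have "v w \<le> c + m * height w" by (rule grow[OF w])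
        also have "\<dots> \<le> c + m * (2 * real R)" using True cm by (intro add_left_mono mult_left_mono) auto
        finally have "ennreal (v w) \<le> ennreal (c + m * (2 * real R))" by (rule ennreal_leI)
        moreover have "?\<phi> w \<le> 1" using cutoff_le_1 by simp
        ultimately have "?\<phi> w * (disc_area * ennreal (v w)) \<le> 1 * (disc_area * ennreal (c + m * (2 * real R)))"
          by (intro mult_mono mult_left_mono) auto
        thus ?thesis using True by simp
      next
        case False
        thus ?thesis using cutoff_eq_0[OF R, of w] by (auto simp: indicator_def)
      qed
      hence "(\<integral>\<^sup>+w. ?F w * (?\<phi> w * (disc_area * ennreal (v w))) \<partial>hyp_area)
          \<le> (\<integral>\<^sup>+w. (disc_area * ennreal (c + m * (2 * real R))) * ?F w \<partial>hyp_area)"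
        by (intro nn_integral_mono)
      also have "\<dots> = disc_area * ennreal (c + m * (2 * real R)) * emeasure hyp_area fdom"
        by (subst nn_integral_cmult_indicator) auto
      also have "\<dots> < \<infinity>" using disc_area_finite fdom(2) by (simp add: ennreal_mult_less_top)
      finally show ?thesis .
    qed
    from 1 2 3 show ?thesis
      by (auto simp: add.commute)
  qed
  have low: "(\<integral>\<^sup>+z. indicator (fdom \<inter> {z. height z \<le> real R0}) z * e z \<partial>hyp_area) = 0" for R0 :: nat
  proof -
    have "(\<integral>\<^sup>+z. indicator (fdom \<inter> {z. height z \<le> real R0}) z * e z \<partial>hyp_area)
        \<le> disc_area * ennreal b * emeasure hyp_area (?high R)" if "R \<ge> Suc R0" for R
    proof -
      have "(\<integral>\<^sup>+z. indicator (fdom \<inter> {z. height z \<le> real R0}) z * e z \<partial>hyp_area)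
        \<le> (\<integral>\<^sup>+z. ?F z * (ennreal (cutoff R z) * e z) \<partial>hyp_area)"
        using that cutoff_eq_1[of R] by (intro nn_integral_mono) (auto simp: indicator_def)
      also have "\<dots> \<le> disc_area * ennreal b * emeasure hyp_area (?high R)"
        using that by (intro main) auto
      finally show ?thesis .
    qed
    moreover have "(\<lambda>R. disc_area * ennreal b * emeasure hyp_area (?high R)) \<longlonglongrightarrow> disc_area * ennreal b * 0"
      using disc_area_finite
      by (intro tendsto_mult_ennreal tendsto_const tendsto_fdom_high) (auto simp: ennreal_mult_eq_top_iff)
    ultimately have "(\<integral>\<^sup>+z. indicator (fdom \<inter> {z. height z \<le> real R0}) z * e z \<partial>hyp_area) \<le> disc_area * ennreal b * 0"
      by (intro Lim_bounded2[of _ _ "Suc R0"]) auto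
    thus ?thesis by simp
  qed
  have "AE z in hyp_area. \<forall>R0::nat. indicator (fdom \<inter> {z. height z \<le> real R0}) z * e z = 0"
    unfolding AE_all_countable
  proof
    fix R0 :: nat
    have [measurable]: "fdom \<inter> {z. height z \<le> real R0} \<in> sets borel"
    proof -
      have "{z. height z \<le> real R0} \<in> sets borel" by measurable
      thus ?thesis by auto
    qed
    show "AE z in hyp_area. indicator (fdom \<inter> {z. height z \<le> real R0}) z * e z = 0"
      using low[of R0] by (subst (asm) nn_integral_0_iff_AE) auto
  qed
  hence F: "AE z in hyp_area. z \<in> fdom \<longrightarrow> e z = 0"
  proof eventually_elim
    fix z assume *: "\<forall>R0::nat. indicator (fdom \<inter> {z. height z \<le> real R0}) z * e z = 0"
    obtain R0 :: nat where "height z \<le> real R0" using real_arch_simple by blast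
    thus "z \<in> fdom \<longrightarrow> e z = 0" using *[rule_format, of R0] by (auto simp: indicator_def)
  qed
  have e_inv: "e (moebius A z) = e z" if A: "A \<in> G" and z: "z \<in> uhp" for A z
  proof -
    have "V (moebius A z) = (\<integral>\<^sup>+w. k z w * ennreal (v (moebius A w)) \<partial>hyp_area)"
      using nn_integral_close[OF det_G[OF A] z, of "\<lambda>w. ennreal (v w)"] by (simp add: V_def k_ind)
    also have "\<dots> = V z"
      unfolding V_def using AE_hyp_area_uhp
      by (intro nn_integral_cong_AE, eventually_elim) (simp add: inv[OF A])
    finally show ?thesis by (simp add: e_def inv[OF A z])
  qed
  have "AE z in hyp_area. \<forall>A\<in>G. moebius A z \<in> fdom \<longrightarrow> e (moebius A z) = 0"
  proof (intro AE_ball_countable' countable_G)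
    fix A assume "A \<in> G"
    have "{z. z \<in> fdom \<longrightarrow> e z = 0} \<in> sets borel" by measurable
    thus "AE z in hyp_area. moebius A z \<in> fdom \<longrightarrow> e (moebius A z) = 0"
      by (rule AE_moebius[OF det_G[OF \<open>A \<in> G\<close>] F])
  qed
  thus ?thesis
    using AE_hyp_area_uhp
  proof eventually_elim
    fix z assume *: "\<forall>A\<in>G. moebius A z \<in> fdom \<longrightarrow> e (moebius A z) = 0" and z: "z \<in> uhp"
    obtain A where "A \<in> G" "moebius A z \<in> fdom" using fdom_cover[OF z] by blast
    hence "e z = 0" using * e_inv[OF _ z] by metis
    thus "(\<integral>\<^sup>+w. indicator {w. close z w} w * ennreal (v w) \<partial>hyp_area) = disc_area * ennreal (v z)"
      using Ve[OF z] by (simp add: V_def k_ind)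
  qed
qed

section \<open>Constancy of the invariant norm\<close>

context
  fixes n :: nat and f :: "complex \<Rightarrow> complex"
  assumes f: "f \<in> modular_forms \<Gamma> (- int n)"
begin

lemma f_props: "hfun f" "f holomorphic_on uhp" "moderate_growth f"
  "\<And>A z. A \<in> G \<Longrightarrow> z \<in> uhp \<Longrightarrow> autom A z ^ n * f (moebius A z) = f z"
  using f by (auto simp: modular_forms_def G_def)

lemma f_measurable [measurable]: "f \<in> borel_measurable borel"
proof -
  have "(\<lambda>z. if z \<in> uhp then f z else 0) \<in> borel_measurable borel"
    by (rule borel_measurable_continuous_on_if)
       (auto intro: holomorphic_on_imp_continuous_on f_props)
  moreover have "(\<lambda>z. if z \<in> uhp then f z else 0) = f" using f_props(1) by (auto simp: hfun_def)
  ultimately show ?thesis by simp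
qed

lemma size_sq_invariant:
  assumes "A \<in> G" "z \<in> uhp" shows "size_sq n f (moebius A z) = size_sq n f z"
proof -
  have d: "det A = 1" by (rule det_G[OF assms(1)])
  have nz: "cmod (autom A z) ^ n \<noteq> 0" using autom_nonzero[OF d assms(2)] by simp
  have "(cmod (f z))\<^sup>2 = ((cmod (autom A z))\<^sup>2) ^ n * (cmod (f (moebius A z)))\<^sup>2"
    by (subst f_props(4)[OF assms, symmetric])
       (simp add: norm_mult norm_power power_mult_distrib power_mult[symmetric] mult.commute)
  thus ?thesis using nz autom_nonzero[OF d assms(2)] uhpD[OF assms(2)]
    by (simp add: size_sq_def Im_moebius[OF d] power_divide)
qed

lemma log_size_growth:
  obtains c m where "0 \<le> c" "0 \<le> m" "\<And>z. z \<in> uhp \<Longrightarrow> log_size n f z \<le> c + m * height z"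
proof -
  obtain N C where NC: "\<And>z. z \<in> uhp \<Longrightarrow> cmod (f z) \<le> C * tau z ^ N"
    using f_props(3) by (auto simp: moderate_growth_def tau_def)
  define C' where "C' = max 1 C"
  \<comment> \<open>\<open>2N\<close> from \<open>|f|\<^sup>2\<close> and \<open>n\<close> from \<open>1/y\<^sup>n\<close>; the additional \<open>1\<close> makes \<open>m\<close> positive, so that one can divide by it\<close>
  define m where "m = 2 * N + n + 1"
  have bound: "log_size n f z \<le> 2 * ln C' + real m * ln (max 1 (tau z))" if z: "z \<in> uhp" for z
  proof -
    have t: "1 < tau z" by (rule tau_gt_1[OF z])
    have y: "0 < Im z" using z by (simp add: uhp_def)
    have C1: "1 \<le> C'" by (simp add: C'_def)
    have "cmod (f z) \<le> C' * tau z ^ N"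
    proof (rule order_trans[OF NC[OF z]])
      show "C * tau z ^ N \<le> C' * tau z ^ N" using t by (intro mult_right_mono) (auto simp: C'_def)
    qed
    hence "(cmod (f z))\<^sup>2 \<le> (C' * tau z ^ N)\<^sup>2" by (intro power_mono) auto
    moreover have "1 / Im z ^ n \<le> tau z ^ n"
      using power_mono[OF inverse_Im_le_tau[OF z], of n] y by (simp add: power_divide)
    ultimately have "(cmod (f z))\<^sup>2 * (1 / Im z ^ n) \<le> (C' * tau z ^ N)\<^sup>2 * tau z ^ n"
      using y t by (intro mult_mono) auto
    also have "\<dots> = C'\<^sup>2 * tau z ^ (2 * N + n)"
      by (simp add: power_mult_distrib power_add power_mult[symmetric] mult.commute)
    also have "\<dots> \<le> C'\<^sup>2 * tau z ^ m"
      using t C1 by (intro mult_left_mono power_increasing) (auto simp: m_def)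
    finally have "(cmod (f z))\<^sup>2 / Im z ^ n \<le> C'\<^sup>2 * tau z ^ m" by simp
    moreover have "1 \<le> C'\<^sup>2 * tau z ^ m"
      using mult_mono[of 1 "C'\<^sup>2" 1 "tau z ^ m"] one_le_power[of C' 2] one_le_power[of "tau z" m] t C1 by simp
    ultimately have "log_size n f z \<le> ln (C'\<^sup>2 * tau z ^ m)"
      unfolding log_size_def size_sq_def by (subst ln_le_cancel_iff) auto
    also have "\<dots> = 2 * ln C' + real m * ln (tau z)"
      using t C1 by (simp add: ln_mult ln_realpow)
    finally show ?thesis using t by (simp add: max_def)
  qed
  have "log_size n f z \<le> 2 * ln C' + real m * height z" if z: "z \<in> uhp" for z
  proof -
    have m0: "real m > 0" by (simp add: m_def)
    have "(log_size n f z - 2 * ln C') / real m \<le> height z"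
    proof (rule height_greatest)
      fix A assume A: "A \<in> G"
      have "log_size n f z = log_size n f (moebius A z)"
        using size_sq_invariant[OF A z] by (simp add: log_size_def)
      also have "\<dots> \<le> 2 * ln C' + real m * ln (max 1 (tau (moebius A z)))"
        by (rule bound[OF moebius_uhp[OF det_G[OF A] z]])
      finally show "(log_size n f z - 2 * ln C') / real m \<le> ln (max 1 (tau (moebius A z)))"
        using m0 by (simp add: divide_le_eq algebra_simps)
    qed
    thus ?thesis using m0 by (simp add: divide_le_eq algebra_simps)
  qed
  moreover have "0 \<le> ln C'" by (simp add: C'_def)
  ultimately show thesis by (intro that[of "2 * ln C'" "real m"]) auto
qed

lemma size_sq_continuous: "continuous_on uhp (size_sq n f)"
  unfolding size_sq_def[abs_def]
  by (intro continuous_intros holomorphic_on_imp_continuous_on f_props) (auto simp: uhp_def)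

lemma open_size_sq: "open {w. close z w \<and> a < size_sq n f w}" "open {w. close z w \<and> size_sq n f w < a}"
proof -
  have o: "open ({w. close z w} \<inter> size_sq n f -` U)" if "open U" for U
    using open_close_section that
    by (intro continuous_open_preimage continuous_on_subset[OF size_sq_continuous]) (auto dest: closeD)
  have "{w. close z w \<and> a < size_sq n f w} = {w. close z w} \<inter> size_sq n f -` {a<..}"
    "{w. close z w \<and> size_sq n f w < a} = {w. close z w} \<inter> size_sq n f -` {..<a}" by auto
  thus "open {w. close z w \<and> a < size_sq n f w}" "open {w. close z w \<and> size_sq n f w < a}"
    using o by auto
qed

text \<open>
  Where \<open>q < 1\<close> the function \<open>v = log max(1, q)\<close> vanishes. If it is also equal to its mean there, it vanishes almost
  everywhere on the disc, and by continuity everywhere.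
\<close>

lemma size_sq_le_1_close:
  assumes zw: "close z w" and small: "size_sq n f z < 1"
  shows "size_sq n f w \<le> 1"
proof (rule ccontr)
  assume big: "\<not> size_sq n f w \<le> 1"
  obtain c m where cm: "0 \<le> c" "0 \<le> m" "\<And>z. z \<in> uhp \<Longrightarrow> log_size n f z \<le> c + m * height z"
    by (rule log_size_growth) blast
  have linv: "log_size n f (moebius A z) = log_size n f z" if "A \<in> G" "z \<in> uhp" for A z
    using size_sq_invariant[OF that] by (simp add: log_size_def)
  have mean: "AE z in hyp_area. (\<integral>\<^sup>+w. indicator {w. close z w} w * ennreal (log_size n f w) \<partial>hyp_area)
      = disc_area * ennreal (log_size n f z)"
    by (rule submean_imp_mean[OF measurable_log_size[OF f_measurable] log_size_nonneg linv cm(3,1,2)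
          log_size_submean[OF f_props(2) f_measurable]])
  have good: "AE z in hyp_area. z \<in> uhp \<and> size_sq n f z < 1 \<longrightarrow> (\<forall>w. close z w \<longrightarrow> size_sq n f w \<le> 1)"
    using mean
  proof eventually_elim
    fix z assume m: "(\<integral>\<^sup>+w. indicator {w. close z w} w * ennreal (log_size n f w) \<partial>hyp_area)
      = disc_area * ennreal (log_size n f z)"
    show "z \<in> uhp \<and> size_sq n f z < 1 \<longrightarrow> (\<forall>w. close z w \<longrightarrow> size_sq n f w \<le> 1)"
    proof (intro impI allI; elim conjE; rule ccontr)
      fix w assume z: "z \<in> uhp" "size_sq n f z < 1" and w: "close z w" "\<not> size_sq n f w \<le> 1"
      have "log_size n f z = 0" using z by (simp add: log_size_def max_def)
      hence "(\<integral>\<^sup>+w. indicator {w. close z w} w * ennreal (log_size n f w) \<partial>hyp_area) = 0" using m by simp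
      hence "AE w in hyp_area. indicator {w. close z w} w * ennreal (log_size n f w) = 0"
        by (subst (asm) nn_integral_0_iff_AE) auto
      hence "AE w in hyp_area. w \<notin> {w. close z w \<and> 1 < size_sq n f w}"
      proof eventually_elim
        fix w assume "indicator {w. close z w} w * ennreal (log_size n f w) = 0"
        thus "w \<notin> {w. close z w \<and> 1 < size_sq n f w}"
          by (auto simp: indicator_def log_size_def max_def ennreal_eq_0_iff split: if_splits)
      qed
      hence "emeasure hyp_area {w. close z w \<and> 1 < size_sq n f w} = 0"
        using AE_iff_null_sets[of "{w. close z w \<and> 1 < size_sq n f w}" hyp_area] open_size_sq(1)
        by (auto simp: borel_open)
      moreover have "emeasure hyp_area {w. close z w \<and> 1 < size_sq n f w} > 0"
        using w by (intro emeasure_hyp_area_open_pos open_size_sq) (auto dest: closeD)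
      ultimately show False by simp
    qed
  qed
  \<comment> \<open>near \<open>z\<close> there are points from the set of full measure that are still close to \<open>w\<close>\<close>
  let ?S = "{u. close w u \<and> size_sq n f u < 1}"
  have "AE u in hyp_area. u \<notin> ?S"
    using good by eventually_elim (use big close_sym closeD in blast)
  hence "emeasure hyp_area ?S = 0"
    using AE_iff_null_sets[of ?S hyp_area] open_size_sq(2) by (auto simp: borel_open)
  moreover have "emeasure hyp_area ?S > 0"
    using zw small close_sym by (intro emeasure_hyp_area_open_pos open_size_sq) (auto dest: closeD)
  ultimately show False by simp
qed

end

lemma modular_forms_scale:
  assumes "f \<in> modular_forms \<Gamma> k" shows "fscale c f \<in> modular_forms \<Gamma> k"
proof -
  have "moderate_growth f" using assms by (simp add: modular_forms_def)
  then obtain N C where "\<And>z. z \<in> uhp \<Longrightarrow> cmod (f z) \<le> C * ((1 + (cmod z)\<^sup>2) / Im z) ^ N"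
    unfolding moderate_growth_def by blast
  hence "\<And>z. z \<in> uhp \<Longrightarrow> cmod (c * f z) \<le> (cmod c * C) * ((1 + (cmod z)\<^sup>2) / Im z) ^ N"
    by (simp add: norm_mult mult_left_mono mult.assoc)
  hence "moderate_growth (fscale c f)" unfolding moderate_growth_def fscale_def by blast
  thus ?thesis using assms
    by (auto simp: modular_forms_def hfun_def fscale_def[abs_def] mult.left_commute intro!: holomorphic_intros)
qed

text \<open>
  Applying \<open>size_sq_le_1_close\<close> to multiples of \<open>f\<close> shows that \<open>q \<le> s\<close> on the disc around \<open>z\<close>
  for every \<open>s > q(z)\<close>. Closeness is symmetric, so equality follows.
\<close>

lemma size_sq_close:
  assumes f: "f \<in> modular_forms \<Gamma> (- int n)" and zw: "close z w"
  shows "size_sq n f w = size_sq n f z"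
proof -
  have le: "size_sq n f w \<le> size_sq n f z" if zw: "close z w" for z w
  proof (rule dense_ge)
    fix s assume s: "size_sq n f z < s"
    have "0 \<le> size_sq n f z" using zw by (auto simp: size_sq_def close_def uhp_def)
    hence s0: "s > 0" using s by simp
    \<comment> \<open>this divides \<open>q\<close> by \<open>s\<close>\<close>
    define h where "h = fscale (1 / of_real (sqrt s)) f"
    have h: "h \<in> modular_forms \<Gamma> (- int n)" unfolding h_def by (rule modular_forms_scale[OF f])
    have e: "size_sq n h u = size_sq n f u / s" for u
      using s0 by (simp add: size_sq_def h_def fscale_def norm_divide power_divide)
    have "size_sq n h w \<le> 1"
      using s s0 by (intro size_sq_le_1_close[OF h zw]) (simp add: e)
    thus "size_sq n f w \<le> s" using s0 by (simp add: e)
  qed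
  have "close w z" using zw close_sym by blast
  thus ?thesis using le zw by (intro antisym) auto
qed

lemma size_sq_constant:
  assumes f: "f \<in> modular_forms \<Gamma> (- int n)" and zw: "z \<in> uhp" "w \<in> uhp"
  shows "size_sq n f z = size_sq n f w"
proof (rule connected_local_const[OF connected_uhp zw], intro ballI)
  fix a assume a: "a \<in> uhp"
  have "eventually (\<lambda>b. b \<in> {b. close a b}) (at a within uhp)"
    using close_refl[OF a] by (simp add: eventually_at_topological) (metis mem_Collect_eq open_close_section)
  thus "eventually (\<lambda>b. size_sq n f a = size_sq n f b) (at a within uhp)"
    by eventually_elim (use size_sq_close[OF f] in auto)
qed

text \<open>
  Since \<open>q\<close> is constant, \<open>|f(z)|\<^sup>2 / |z+\<i>|\<^sup>2\<^sup>n\<close> is a multiple of \<open>(y / |z+\<i>|\<^sup>2)\<^sup>n\<close>, which has its maximum at \<open>\<i>\<close>.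
\<close>

lemma modular_form_quotient_constant:
  assumes f: "f \<in> modular_forms \<Gamma> (- int n)"
  obtains c where "\<And>z. z \<in> uhp \<Longrightarrow> f z = c * (z + \<i>) ^ n"
proof -
  have hol: "f holomorphic_on uhp" using f by (simp add: modular_forms_def)
  define g where "g z = f z / (z + \<i>) ^ n" for z
  have i: "\<i> \<in> uhp" by (simp add: uhp_def)
  have g2: "(cmod (g z))\<^sup>2 = size_sq n f \<i> * (Im z / (cmod (z + \<i>))\<^sup>2) ^ n" if z: "z \<in> uhp" for z
  proof -
    have "Im z \<noteq> 0" using z by (simp add: uhp_def)
    hence "(cmod (f z))\<^sup>2 = size_sq n f z * Im z ^ n" by (simp add: size_sq_def)
    moreover have "size_sq n f z = size_sq n f \<i>" by (rule size_sq_constant[OF f z i])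
    ultimately show ?thesis
      by (simp add: g_def norm_divide norm_power power_divide power_mult[symmetric] mult.commute)
  qed
  have "g constant_on uhp"
  proof (rule maximum_modulus_principle[OF _ open_uhp connected_uhp open_uhp order_refl i])
    show "g holomorphic_on uhp"
      unfolding g_def[abs_def] using uhp_plus_i_nonzero by (intro holomorphic_intros hol) auto
    fix z assume z: "z \<in> uhp"
    have y: "0 < Im z" using z by (simp add: uhp_def)
    have "Im z / (cmod (z + \<i>))\<^sup>2 \<le> 1 / 4"
      using norm_plus_i[of z] y by (simp add: divide_le_eq add_nonneg_pos)
    hence "(Im z / (cmod (z + \<i>))\<^sup>2) ^ n \<le> (1 / 4) ^ n" using y by (intro power_mono) auto
    moreover have "0 \<le> size_sq n f \<i>" by (simp add: size_sq_def)
    ultimately have "(cmod (g z))\<^sup>2 \<le> (cmod (g \<i>))\<^sup>2"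
      unfolding g2[OF z] g2[OF i] by (simp add: mult_left_mono norm_mult power_mult_distrib)
    thus "cmod (g z) \<le> cmod (g \<i>)" by (rule power2_le_imp_le) simp
  qed
  then obtain c where "\<And>z. z \<in> uhp \<Longrightarrow> g z = c" by (auto simp: constant_on_def)
  thus thesis
    using uhp_plus_i_nonzero by (intro that[of c]) (auto simp: g_def field_simps)
qed

theorem modular_forms_0:
  assumes "f \<in> modular_forms \<Gamma> 0" shows "f \<in> range const_hfun"
proof -
  obtain c where "\<And>z. z \<in> uhp \<Longrightarrow> f z = c"
    using modular_form_quotient_constant[of f 0] assms by auto
  hence "f = const_hfun c" using assms by (auto simp: const_hfun_def modular_forms_def hfun_def)
  thus ?thesis by simp
qed

text \<open>
  For a multiple of \<open>(z+\<i>)\<^sup>n\<close> with \<open>n > 0\<close> the invariant norm is constant only if it vanishes; the points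
  \<open>\<i>\<close> and \<open>2\<i>\<close> suffice to see this.
\<close>

theorem modular_forms_neg:
  assumes "f \<in> modular_forms \<Gamma> k" "k < 0" shows "f = 0"
proof -
  define n where "n = nat (- k)"
  have f: "f \<in> modular_forms \<Gamma> (- int n)" and n: "n > 0" using assms by (auto simp: n_def)
  obtain c where c: "\<And>z. z \<in> uhp \<Longrightarrow> f z = c * (z + \<i>) ^ n"
    using modular_form_quotient_constant[OF f] by metis
  have u: "\<i> \<in> uhp" "2 * \<i> \<in> uhp" by (auto simp: uhp_def)
  have "size_sq n f \<i> = (cmod c)\<^sup>2 * 4 ^ n"
    by (simp add: size_sq_def c[OF u(1)] norm_mult norm_power power_mult_distrib power_mult[symmetric] mult.commute[of _ 2])
       (simp add: power_mult)
  moreover have "size_sq n f (2 * \<i>) = (cmod c)\<^sup>2 * (9 / 2) ^ n"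
    by (simp add: size_sq_def c[OF u(2)] norm_mult norm_power power_mult_distrib power_mult[symmetric] mult.commute[of _ 2] power_divide)
       (simp add: power_mult)
  moreover have "(4::real) ^ n < (9/2) ^ n" using n by (intro power_strict_mono) auto
  ultimately have "c = 0" using size_sq_constant[OF f u] by simp
  hence "f z = 0" for z using c[of z] f by (cases "z \<in> uhp") (auto simp: modular_forms_def hfun_def)
  thus ?thesis by (auto simp: fun_eq_iff)
qed

end

section \<open>Holomorphic functions of moderate growth\<close>

text \<open>
  These functions form a ring that is closed under the slash operators, and this ring will be shown to contain the expansion coefficients.
\<close>

definition mod_hol :: "(complex \<Rightarrow> complex) \<Rightarrow> bool" where
  "mod_hol f \<longleftrightarrow> f holomorphic_on uhp \<and> moderate_growth f"

lemma moderate_growthI: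
  assumes "\<And>z. z \<in> uhp \<Longrightarrow> cmod (f z) \<le> C * tau z ^ N" shows "moderate_growth f"
  using assms unfolding moderate_growth_def tau_def by blast

lemma mod_hol_growth:
  assumes "mod_hol f" shows "\<exists>N C. 0 \<le> C \<and> (\<forall>z\<in>uhp. cmod (f z) \<le> C * tau z ^ N)"
proof -
  obtain N C where NC: "\<And>z. z \<in> uhp \<Longrightarrow> cmod (f z) \<le> C * tau z ^ N"
    using assms unfolding mod_hol_def moderate_growth_def tau_def by blast
  have "cmod (f z) \<le> \<bar>C\<bar> * tau z ^ N" if "z \<in> uhp" for z
    by (rule order_trans[OF NC[OF that]]) (use tau_gt_1[OF that] in \<open>auto intro!: mult_right_mono\<close>)
  thus ?thesis by (intro exI[of _ N] exI[of _ "\<bar>C\<bar>"]) auto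
qed

lemma mod_hol_cong:
  assumes "mod_hol f" "\<And>z. z \<in> uhp \<Longrightarrow> f z = g z" shows "mod_hol g"
proof -
  have "g holomorphic_on uhp" using assms holomorphic_cong[of uhp uhp f g] by (auto simp: mod_hol_def)
  moreover have "moderate_growth g" using assms unfolding mod_hol_def moderate_growth_def by metis
  ultimately show ?thesis by (simp add: mod_hol_def)
qed

lemma mod_hol_const: "mod_hol (\<lambda>_. c)"
proof -
  have "moderate_growth (\<lambda>_. c)" by (rule moderate_growthI[where C = "cmod c" and N = 0]) simp
  thus ?thesis by (simp add: mod_hol_def)
qed

lemma mod_hol_ident: "mod_hol (\<lambda>z. z)"
proof -
  have "cmod z \<le> 1 * (tau z) ^ 2" if z: "z \<in> uhp" for z
  proof -
    have y: "0 < Im z" using z by (simp add: uhp_def)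
    have "cmod z * Im z \<le> (cmod z)\<^sup>2"
      using abs_Im_le_cmod[of z] y by (simp add: power2_eq_square mult_left_mono)
    hence "cmod z * Im z \<le> 1 + (cmod z)\<^sup>2" by simp
    hence "cmod z \<le> tau z" using y by (simp add: tau_def le_divide_eq)
    also have "\<dots> \<le> tau z ^ 2" using tau_gt_1[OF z] by (simp add: power2_eq_square)
    finally show ?thesis by simp
  qed
  hence "moderate_growth (\<lambda>z. z)" by (rule moderate_growthI)
  thus ?thesis by (simp add: mod_hol_def)
qed

lemma mod_hol_add:
  assumes "mod_hol f" "mod_hol g" shows "mod_hol (\<lambda>z. f z + g z)"
proof -
  obtain N C where f: "0 \<le> C" "\<And>z. z \<in> uhp \<Longrightarrow> cmod (f z) \<le> C * tau z ^ N"
    using mod_hol_growth[OF assms(1)] by blast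
  obtain N' C' where g: "0 \<le> C'" "\<And>z. z \<in> uhp \<Longrightarrow> cmod (g z) \<le> C' * tau z ^ N'"
    using mod_hol_growth[OF assms(2)] by blast
  have "cmod (f z + g z) \<le> (C + C') * tau z ^ (max N N')" if z: "z \<in> uhp" for z
  proof -
    have t: "1 \<le> tau z" using tau_gt_1[OF z] by simp
    have "cmod (f z + g z) \<le> C * tau z ^ N + C' * tau z ^ N'"
      using f(2)[OF z] g(2)[OF z] norm_triangle_ineq[of "f z" "g z"] by linarith
    also have "\<dots> \<le> C * tau z ^ (max N N') + C' * tau z ^ (max N N')"
      using f(1) g(1) t by (intro add_mono mult_left_mono power_increasing) auto
    finally show ?thesis by (simp add: algebra_simps)
  qed
  hence "moderate_growth (\<lambda>z. f z + g z)" by (rule moderate_growthI)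
  thus ?thesis using assms by (simp add: mod_hol_def holomorphic_on_add)
qed

lemma mod_hol_mult:
  assumes "mod_hol f" "mod_hol g" shows "mod_hol (\<lambda>z. f z * g z)"
proof -
  obtain N C where f: "0 \<le> C" "\<And>z. z \<in> uhp \<Longrightarrow> cmod (f z) \<le> C * tau z ^ N"
    using mod_hol_growth[OF assms(1)] by blast
  obtain N' C' where g: "0 \<le> C'" "\<And>z. z \<in> uhp \<Longrightarrow> cmod (g z) \<le> C' * tau z ^ N'"
    using mod_hol_growth[OF assms(2)] by blast
  have "cmod (f z * g z) \<le> (C * C') * tau z ^ (N + N')" if z: "z \<in> uhp" for z
  proof -
    have t: "1 \<le> tau z" using tau_gt_1[OF z] by simp
    have "cmod (f z * g z) \<le> (C * tau z ^ N) * (C' * tau z ^ N')"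
      unfolding norm_mult using f(2)[OF z] g(2)[OF z] f(1) t by (intro mult_mono) auto
    thus ?thesis by (simp add: power_add mult_ac)
  qed
  hence "moderate_growth (\<lambda>z. f z * g z)" by (rule moderate_growthI)
  thus ?thesis using assms by (simp add: mod_hol_def holomorphic_on_mult)
qed

lemma mod_hol_diff:
  assumes "mod_hol f" "mod_hol g" shows "mod_hol (\<lambda>z. f z - g z)"
  using mod_hol_add[OF assms(1) mod_hol_mult[OF mod_hol_const[of "-1"] assms(2)]] by simp

lemma mod_hol_power: "mod_hol f \<Longrightarrow> mod_hol (\<lambda>z. f z ^ n)"
  by (induction n) (auto intro: mod_hol_const mod_hol_mult)

lemma tau_moebius_le:
  assumes A: "det A = 1" and z: "z \<in> uhp"
  shows "tau (moebius A z) \<le> 2 * ((A$1$1)\<^sup>2 + (A$1$2)\<^sup>2 + (A$2$1)\<^sup>2 + (A$2$2)\<^sup>2) * tau z"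
proof -
  have bound: "(cmod (of_real a * z + of_real b))\<^sup>2 \<le> 2 * (a\<^sup>2 + b\<^sup>2) * (1 + (cmod z)\<^sup>2)" for a b :: real
  proof -
    have "cmod (of_real a * z + of_real b) \<le> \<bar>a\<bar> * cmod z + \<bar>b\<bar>"
      using norm_triangle_ineq[of "of_real a * z" "of_real b"] by (simp add: norm_mult)
    hence "(cmod (of_real a * z + of_real b))\<^sup>2 \<le> (\<bar>a\<bar> * cmod z + \<bar>b\<bar>)\<^sup>2" by (intro power_mono) auto
    also have "\<dots> \<le> 2 * (\<bar>a\<bar> * cmod z)\<^sup>2 + 2 * \<bar>b\<bar>\<^sup>2"
      using sum_squares_bound[of "\<bar>a\<bar> * cmod z" "\<bar>b\<bar>"] by (simp add: power2_sum)
    also have "\<dots> \<le> 2 * (a\<^sup>2 + b\<^sup>2) * (1 + (cmod z)\<^sup>2)"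
      by (simp add: power_mult_distrib algebra_simps)
    finally show ?thesis .
  qed
  have y: "0 < Im z" using z by (simp add: uhp_def)
  have nz: "(cmod (autom A z))\<^sup>2 \<noteq> 0" using autom_nonzero[OF A z] by simp
  have "tau (moebius A z) = ((cmod (autom A z))\<^sup>2 + (cmod (of_real (A$1$1) * z + of_real (A$1$2)))\<^sup>2) / Im z"
    using nz y by (simp add: tau_def Im_moebius[OF A]) (simp add: moebius_def norm_divide power_divide field_simps)
  also have "\<dots> \<le> (2 * ((A$2$1)\<^sup>2 + (A$2$2)\<^sup>2) * (1 + (cmod z)\<^sup>2) + 2 * ((A$1$1)\<^sup>2 + (A$1$2)\<^sup>2) * (1 + (cmod z)\<^sup>2)) / Im z"
    using y bound by (intro divide_right_mono add_mono) (auto simp: autom_def)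
  also have "\<dots> = 2 * ((A$1$1)\<^sup>2 + (A$1$2)\<^sup>2 + (A$2$1)\<^sup>2 + (A$2$2)\<^sup>2) * tau z"
    by (simp add: tau_def algebra_simps add_divide_distrib)
  finally show ?thesis .
qed

lemma mod_hol_moebius:
  assumes "mod_hol f" and A: "det A = 1" shows "mod_hol (\<lambda>z. f (moebius A z))"
proof -
  obtain N C where f: "0 \<le> C" "\<And>z. z \<in> uhp \<Longrightarrow> cmod (f z) \<le> C * tau z ^ N"
    using mod_hol_growth[OF assms(1)] by blast
  define M where "M = 2 * ((A$1$1)\<^sup>2 + (A$1$2)\<^sup>2 + (A$2$1)\<^sup>2 + (A$2$2)\<^sup>2)"
  have "cmod (f (moebius A z)) \<le> (C * M ^ N) * tau z ^ N" if z: "z \<in> uhp" for z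
  proof -
    have u: "moebius A z \<in> uhp" by (rule moebius_uhp[OF A z])
    have "cmod (f (moebius A z)) \<le> C * tau (moebius A z) ^ N" by (rule f(2)[OF u])
    also have "\<dots> \<le> C * (M * tau z) ^ N"
      using tau_moebius_le[OF A z] tau_gt_1[OF u] f(1) by (intro mult_left_mono power_mono) (auto simp: M_def)
    finally show ?thesis by (simp add: power_mult_distrib)
  qed
  hence "moderate_growth (\<lambda>z. f (moebius A z))" by (rule moderate_growthI)
  moreover have "(f \<circ> moebius A) holomorphic_on uhp"
    using holomorphic_moebius[OF A] assms(1) moebius_uhp[OF A]
    by (intro holomorphic_on_compose_gen[of _ _ _ uhp]) (auto simp: mod_hol_def)
  ultimately show ?thesis by (simp add: mod_hol_def o_def)
qed

lemma mod_hol_autom: "mod_hol (autom A)"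
  unfolding autom_def[abs_def] by (intro mod_hol_add mod_hol_mult mod_hol_const mod_hol_ident)

lemma autom_adj:
  assumes "det A = 1" "z \<in> uhp"
  shows "autom (mat2_adj A) (moebius A z) = 1 / autom A z"
proof -
  have "autom (mat2_adj A) (moebius A z) * autom A z = 1"
    using autom_mult[OF assms, of "mat2_adj A"] mat2_adj_inverse[OF assms(1)] by simp
  thus ?thesis using autom_nonzero[OF assms] by (simp add: field_simps)
qed

text \<open>
  By the cocycle relation \<open>1/(cz+d)\<close> is the automorphy factor of the inverse matrix at the transformed point.
\<close>

lemma mod_hol_inverse_autom:
  assumes "det A = 1" shows "mod_hol (\<lambda>z. 1 / autom A z)"
  by (rule mod_hol_cong[OF mod_hol_moebius[OF mod_hol_autom assms]]) (rule autom_adj[OF assms])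

lemma mod_hol_autom_powi:
  assumes "det A = 1" shows "mod_hol (\<lambda>z. autom A z powi m)"
proof (cases "m \<ge> 0")
  case True
  thus ?thesis using mod_hol_power[OF mod_hol_autom, of A "nat m"] by (simp add: power_int_def)
next
  case False
  thus ?thesis using mod_hol_power[OF mod_hol_inverse_autom[OF assms], of "nat (- m)"]
    by (simp add: power_int_def inverse_eq_divide)
qed

lemma mod_hol_slope: "det A = 1 \<Longrightarrow> mod_hol (slope A)"
  unfolding slope_def[abs_def]
  using mod_hol_mult[OF mod_hol_const mod_hol_inverse_autom, of A] by simp

lemma slope_diff:
  assumes "det A = 1" "det B = 1" "z \<in> uhp"
  shows "slope A z - slope B z = of_real (A$2$1 * B$2$2 - B$2$1 * A$2$2) / (autom A z * autom B z)"
proof -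
  have "slope A z - slope B z = (of_real (A$2$1) * autom B z - of_real (B$2$1) * autom A z) / (autom A z * autom B z)"
    using autom_nonzero[OF assms(1,3)] autom_nonzero[OF assms(2,3)] by (simp add: slope_def diff_frac_eq)
  thus ?thesis by (simp add: autom_def algebra_simps)
qed

lemma mod_hol_inverse_slope_diff:
  assumes "det A = 1" "det B = 1"
  shows "mod_hol (\<lambda>z. 1 / (slope A z - slope B z))"
proof (rule mod_hol_cong[OF mod_hol_mult[OF mod_hol_const[of "1 / of_real (A$2$1 * B$2$2 - B$2$1 * A$2$2)"]
      mod_hol_mult[OF mod_hol_autom[of A] mod_hol_autom[of B]]]])
  fix z assume "z \<in> uhp"
  thus "1 / of_real (A$2$1 * B$2$2 - B$2$1 * A$2$2) * (autom A z * autom B z) = 1 / (slope A z - slope B z)"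
    unfolding slope_diff[OF assms \<open>z \<in> uhp\<close>] by simp
qed

text \<open>
  Solving for the coefficients of a polynomial from its values at the nodes \<open>x i\<close> only requires divisions by
  differences of nodes: the difference quotient with respect to \<open>x 0\<close> is a polynomial of lower degree, whose coefficients
  \<open>h j\<close> determine the \<open>g j\<close> by synthetic division.
\<close>

lemma mod_hol_interpolation:
  assumes "\<And>i. mod_hol (x i)"
    and "\<And>i j. i \<noteq> j \<Longrightarrow> mod_hol (\<lambda>z. 1 / (x i z - x j z))"
    and "\<And>i j z. i \<noteq> j \<Longrightarrow> z \<in> uhp \<Longrightarrow> x i z \<noteq> x (j::nat) z"
    and "\<And>i. mod_hol (\<lambda>z. \<Sum>j\<le>p. g j z * x i z ^ j)"
    and "j \<le> p"
  shows "mod_hol (g j)"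
  using assms
proof (induction p arbitrary: g x j)
  case 0
  thus ?case by simp
next
  case (Suc p)
  define h where "h j z = (\<Sum>i=Suc j..Suc p. g i z * x 0 z ^ (i - Suc j))" for j z
  have h: "mod_hol (h j)" if "j \<le> p" for j
  proof (rule Suc.IH[of "\<lambda>i. x (Suc i)"])
    fix i
    let ?L = "\<lambda>i z. \<Sum>j\<le>Suc p. g j z * x i z ^ j"
    have "mod_hol (\<lambda>z. (?L (Suc i) z - ?L 0 z) * (1 / (x (Suc i) z - x 0 z)))"
      by (intro mod_hol_mult mod_hol_diff Suc.prems) auto
    moreover have "(?L (Suc i) z - ?L 0 z) * (1 / (x (Suc i) z - x 0 z)) = (\<Sum>j\<le>p. h j z * x (Suc i) z ^ j)"
      if z: "z \<in> uhp" for z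
    proof -
      have "?L (Suc i) z - ?L 0 z = (x (Suc i) z - x 0 z) * (\<Sum>j\<le>p. h j z * x (Suc i) z ^ j)"
        using sub_polyfun[of "\<lambda>i. g i z" "x (Suc i) z" "Suc p" "x 0 z"]
        unfolding h_def lessThan_Suc_atMost sum_distrib_right .
      thus ?thesis using Suc.prems(3)[of "Suc i" 0 z] z by simp
    qed
    ultimately show "mod_hol (\<lambda>z. \<Sum>j\<le>p. h j z * x (Suc i) z ^ j)" by (rule mod_hol_cong)
  qed (use Suc.prems that in auto)
  have h': "mod_hol (h j)" for j
  proof (cases "j \<le> p")
    case False
    hence "h j = (\<lambda>_. 0)" by (auto simp: h_def fun_eq_iff)
    thus ?thesis using mod_hol_const by simp
  qed (rule h)
  have rec: "h j z = g (Suc j) z + x 0 z * h (Suc j) z" if "j \<le> p" for j z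
  proof -
    have "h j z = g (Suc j) z + (\<Sum>i=Suc (Suc j)..Suc p. g i z * x 0 z ^ (i - Suc j))"
      unfolding h_def using that by (subst sum.atLeast_Suc_atMost) auto
    also have "(\<Sum>i=Suc (Suc j)..Suc p. g i z * x 0 z ^ (i - Suc j)) = x 0 z * h (Suc j) z"
      unfolding h_def sum_distrib_left
    proof (rule sum.cong)
      fix i assume "i \<in> {Suc (Suc j)..Suc p}"
      hence "i - Suc j = Suc (i - Suc (Suc j))" by auto
      thus "g i z * x 0 z ^ (i - Suc j) = x 0 z * (g i z * x 0 z ^ (i - Suc (Suc j)))" by simp
    qed simp
    finally show ?thesis .
  qed
  show ?case
  proof (cases j)
    case 0
    have "mod_hol (\<lambda>z. (\<Sum>j\<le>Suc p. g j z * x 0 z ^ j) - x 0 z * h 0 z)"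
      by (intro mod_hol_diff mod_hol_mult Suc.prems h')
    moreover have "(\<Sum>j\<le>Suc p. g j z * x 0 z ^ j) - x 0 z * h 0 z = g 0 z" for z
    proof -
      have "(\<Sum>j\<le>Suc p. g j z * x 0 z ^ j) = g 0 z + (\<Sum>j=Suc 0..Suc p. g j z * x 0 z ^ j)"
        unfolding atMost_atLeast0 by (subst sum.atLeast_Suc_atMost) auto
      also have "(\<Sum>j=Suc 0..Suc p. g j z * x 0 z ^ j) = x 0 z * h 0 z"
        unfolding h_def sum_distrib_left
      proof (rule sum.cong)
        fix j assume "j \<in> {Suc 0..Suc p}"
        hence "j = Suc (j - Suc 0)" by auto
        hence "x 0 z ^ j = x 0 z * x 0 z ^ (j - Suc 0)" by (metis power_Suc)
        thus "g j z * x 0 z ^ j = x 0 z * (g j z * x 0 z ^ (j - Suc 0))" by simp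
      qed simp
      finally show ?thesis by simp
    qed
    ultimately have "mod_hol (g 0)" by (rule mod_hol_cong)
    thus ?thesis using 0 by simp
  next
    case (Suc i)
    have "mod_hol (\<lambda>z. h i z - x 0 z * h (Suc i) z)"
      by (intro mod_hol_diff mod_hol_mult Suc.prems h')
    thus ?thesis using Suc \<open>j \<le> Suc p\<close> rec[of i] by (auto elim!: mod_hol_cong)
  qed
qed

text \<open>
  Cauchy's estimate on the disc of radius \<open>y/2\<close>, on which \<open>tau\<close> grows by a factor of at most \<open>5\<close>.
\<close>

lemma mod_hol_Dz:
  assumes "mod_hol f" shows "mod_hol (Dz f)"
proof -
  have hol: "f holomorphic_on uhp" using assms by (simp add: mod_hol_def)
  obtain N C where f: "0 \<le> C" "\<And>z. z \<in> uhp \<Longrightarrow> cmod (f z) \<le> C * tau z ^ N"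
    using mod_hol_growth[OF assms(1)] by blast
  have "cmod (Dz f z) \<le> (2 * C * 5 ^ N) * tau z ^ Suc N" if z: "z \<in> uhp" for z
  proof -
    have y: "0 < Im z" using z by (simp add: uhp_def)
    have sub: "cball z (Im z / 2) \<subseteq> uhp"
    proof
      fix w assume "w \<in> cball z (Im z / 2)"
      hence "\<bar>Im (z - w)\<bar> \<le> Im z / 2" using abs_Im_le_cmod[of "z - w"] by (simp add: dist_norm)
      hence "Im z - Im w \<le> Im z / 2" unfolding minus_complex.sel by linarith
      thus "w \<in> uhp" using y by (simp add: uhp_def)
    qed
    have bound: "cmod (f w) \<le> C * (5 * tau z) ^ N" if w: "cmod (z - w) = Im z / 2" for w
    proof -
      have wu: "w \<in> uhp" using sub w by (auto simp: dist_norm)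
      have Iw: "Im z / 2 \<le> Im w" using abs_Im_le_cmod[of "z - w"] w unfolding minus_complex.sel by linarith
      have "cmod w \<le> cmod z + Im z / 2" using norm_triangle_ineq2[of w z] w by (simp add: norm_minus_commute)
      hence "cmod w \<le> 3 / 2 * cmod z" using abs_Im_le_cmod[of z] y by linarith
      hence "(cmod w)\<^sup>2 \<le> (3 / 2 * cmod z)\<^sup>2" by (intro power_mono) auto
      hence "(cmod w)\<^sup>2 * 4 \<le> 9 * (cmod z)\<^sup>2" by (simp add: power_mult_distrib power_divide)
      hence "1 + (cmod w)\<^sup>2 \<le> 5 / 2 * (1 + (cmod z)\<^sup>2)"
      proof -
        have *: "1 + b \<le> 5 / 2 * (1 + a)" if "b * 4 \<le> 9 * a" "0 \<le> a" for a b :: real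
          using that by (simp add: field_simps)
        show ?thesis by (rule *[OF \<open>(cmod w)\<^sup>2 * 4 \<le> 9 * (cmod z)\<^sup>2\<close>]) simp
      qed
      moreover have "1 / Im w \<le> 2 / Im z" using Iw y by (simp add: field_simps)
      ultimately have "(1 + (cmod w)\<^sup>2) * (1 / Im w) \<le> (5 / 2 * (1 + (cmod z)\<^sup>2)) * (2 / Im z)"
        using y Iw by (intro mult_mono) auto
      moreover have "(1 + (cmod w)\<^sup>2) * (1 / Im w) = tau w" by (simp add: tau_def)
      moreover have "(5 / 2 * (1 + (cmod z)\<^sup>2)) * (2 / Im z) = 5 * tau z"
        using y by (simp add: tau_def field_simps)
      ultimately have "tau w \<le> 5 * tau z" by simp
      moreover have "0 \<le> tau w" using tau_gt_1[OF wu] by simp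
      ultimately have "C * tau w ^ N \<le> C * (5 * tau z) ^ N"
        using f(1) by (intro mult_left_mono power_mono) auto
      thus ?thesis using f(2)[OF wu] by simp
    qed
    have "cmod ((deriv ^^ 1) f z) \<le> fact 1 * (C * (5 * tau z) ^ N) / (Im z / 2) ^ 1"
    proof (rule Cauchy_inequality)
      show "f holomorphic_on ball z (Im z / 2)"
        using sub ball_subset_cball by (blast intro: holomorphic_on_subset[OF hol])
      show "continuous_on (cball z (Im z / 2)) f"
        by (rule continuous_on_subset[OF holomorphic_on_imp_continuous_on[OF hol] sub])
    qed (use y bound in \<open>auto simp: dist_norm\<close>)
    hence "cmod (deriv f z) \<le> 2 * (C * (5 * tau z) ^ N) * (1 / Im z)" by (simp add: mult_ac)
    also have "\<dots> \<le> 2 * (C * (5 * tau z) ^ N) * tau z"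
      using inverse_Im_le_tau[OF z] tau_gt_1[OF z] f(1) by (intro mult_left_mono) auto
    finally show ?thesis using z by (simp add: Dz_def power_mult_distrib mult_ac)
  qed
  hence "moderate_growth (Dz f)" by (rule moderate_growthI)
  moreover have "Dz f holomorphic_on uhp"
    using holomorphic_deriv[OF hol open_uhp] holomorphic_cong[of uhp uhp "Dz f" "deriv f"] by (simp add: Dz_def)
  ultimately show ?thesis by (simp add: mod_hol_def)
qed

section \<open>Expansion coefficients of quasimodular forms\<close>

text \<open>
  Writing \<open>X\<close> as the logarithmic derivative of \<open>cz+d\<close>, this is the derivative of the cocycle relation for \<open>cz+d\<close>.
\<close>

lemma slope_mult:
  assumes "det A = 1" "det B = 1" "z \<in> uhp"
  shows "slope (A ** B) z = slope B z + slope A (moebius B z) / (autom B z)\<^sup>2"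
proof -
  have nz: "autom B z \<noteq> 0" "autom A (moebius B z) \<noteq> 0"
    using assms by (simp_all add: autom_nonzero moebius_uhp)
  have m: "moebius B z * autom B z = of_real (B$1$1) * z + of_real (B$1$2)"
    using nz by (simp add: moebius_def)
  have AB: "autom A (moebius B z) * autom B z
      = of_real (A$2$1) * (of_real (B$1$1) * z + of_real (B$1$2)) + of_real (A$2$2) * autom B z"
    unfolding m[symmetric] by (simp add: autom_def[of A] algebra_simps)
  have "of_real (B$1$1) * autom B z - of_real (B$2$1) * (of_real (B$1$1) * z + of_real (B$1$2))
      = of_real (B$1$1 * B$2$2 - B$1$2 * B$2$1)"
    by (simp add: autom_def algebra_simps)
  hence d: "of_real (B$1$1) * autom B z - of_real (B$2$1) * (of_real (B$1$1) * z + of_real (B$1$2)) = 1"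
    using det_2_eq_1D[OF assms(2)] by simp
  have "of_real ((A ** B)$2$1) * autom B z - of_real (B$2$1) * (autom A (moebius B z) * autom B z)
      = of_real (A$2$1) * (of_real (B$1$1) * autom B z - of_real (B$2$1) * (of_real (B$1$1) * z + of_real (B$1$2)))"
    unfolding AB by (simp add: mat2_mult_entry algebra_simps)
  hence e: "of_real ((A ** B)$2$1) * autom B z = of_real (B$2$1) * (autom A (moebius B z) * autom B z) + of_real (A$2$1)"
    unfolding d by (simp add: algebra_simps)
  have "slope (A ** B) z = of_real ((A ** B)$2$1) * autom B z / (autom A (moebius B z) * (autom B z)\<^sup>2)"
    using nz by (simp add: slope_def autom_mult[OF assms(2,3)] power2_eq_square)
  also have "\<dots> = slope B z + slope A (moebius B z) / (autom B z)\<^sup>2"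
    unfolding e using nz by (simp add: slope_def power2_eq_square add_divide_distrib)
  finally show ?thesis .
qed

lemma slope_one [simp]: "slope (mat 1) z = 0"
  by (simp add: slope_def mat_def)

lemma slope_has_derivative:
  assumes "det A = 1" "z \<in> uhp"
  shows "(slope A has_field_derivative - (slope A z)\<^sup>2) (at z)"
  unfolding slope_def[abs_def]
  using autom_nonzero[OF assms]
  by (auto intro!: derivative_eq_intros autom_has_derivative simp: power2_eq_square)

lemma binomial_sum_swap:
  fixes g :: "nat \<Rightarrow> complex"
  shows "(\<Sum>r\<le>p. g r * (s + y) ^ r) = (\<Sum>j\<le>p. (\<Sum>i\<le>p-j. of_nat ((i + j) choose j) * g (i + j) * s ^ i) * y ^ j)"
proof -
  have "(\<Sum>r\<le>p. g r * (s + y) ^ r) = (\<Sum>r\<le>p. \<Sum>j\<le>r. of_nat (r choose j) * g r * s ^ (r - j) * y ^ j)"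
  proof (rule sum.cong)
    fix r
    have "(s + y) ^ r = (\<Sum>j\<le>r. of_nat (r choose j) * y ^ j * s ^ (r - j))"
      using binomial_ring[of y s r] by (simp add: add.commute)
    thus "g r * (s + y) ^ r = (\<Sum>j\<le>r. of_nat (r choose j) * g r * s ^ (r - j) * y ^ j)"
      by (simp add: sum_distrib_left mult_ac)
  qed simp
  also have "\<dots> = (\<Sum>j\<le>p. \<Sum>r=j..p. of_nat (r choose j) * g r * s ^ (r - j) * y ^ j)"
    by (simp add: sum.Sigma)
       (rule sum.reindex_bij_witness[of _ "\<lambda>(j, r). (r, j)" "\<lambda>(r, j). (j, r)"], auto)
  also have "\<dots> = (\<Sum>j\<le>p. (\<Sum>i\<le>p-j. of_nat ((i + j) choose j) * g (i + j) * s ^ i) * y ^ j)"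
  proof (rule sum.cong)
    fix j assume "j \<in> {..p}"
    have "(\<Sum>r=j..p. of_nat (r choose j) * g r * s ^ (r - j) * y ^ j)
        = (\<Sum>i\<le>p-j. of_nat ((i + j) choose j) * g (i + j) * s ^ i * y ^ j)"
      by (rule sum.reindex_bij_witness[of _ "\<lambda>i. i + j" "\<lambda>r. r - j"]) (use \<open>j \<in> _\<close> in auto)
    thus "(\<Sum>r=j..p. of_nat (r choose j) * g r * s ^ (r - j) * y ^ j)
        = (\<Sum>i\<le>p-j. of_nat ((i + j) choose j) * g (i + j) * s ^ i) * y ^ j"
      by (simp add: sum_distrib_right)
  qed simp
  finally show ?thesis .
qed

lemma subspace_zero: "cfun.subspace {0}"
  by (auto simp: cfun.subspace_def)

lemma hfun_fscale: "hfun f \<Longrightarrow> hfun (fscale c f)"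
  by (simp add: hfun_def fscale_def)

lemma hfun_add: "hfun f \<Longrightarrow> hfun g \<Longrightarrow> hfun (f + g)"
  by (simp add: hfun_def)

lemma hfun_Dz: "hfun (Dz f)"
  by (simp add: hfun_def Dz_def)

lemma fscale_0 [simp]: "fscale c 0 = 0"
  by (simp add: fscale_def fun_eq_iff)

lemma Dz_0 [simp]: "Dz 0 = 0"
  by (auto simp: Dz_def fun_eq_iff zero_fun_def)

context fuchsian
begin

lemma quasi_expansion_iff:
  "quasi_expansion \<Gamma> k p f g \<longleftrightarrow> (\<forall>j. hfun (g j)) \<and> (\<forall>j>p. g j = 0) \<and>
     (\<forall>A\<in>G. \<forall>z\<in>uhp. autom A z powi (- k) * f (moebius A z) = (\<Sum>j\<le>p. g j z * slope A z ^ j))"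
  by (simp add: quasi_expansion_def slope_def G_def)

lemma quasi_expansionD:
  assumes "quasi_expansion \<Gamma> k p f g"
  shows "hfun (g j)" "j > p \<Longrightarrow> g j = 0"
    "A \<in> G \<Longrightarrow> z \<in> uhp \<Longrightarrow> autom A z powi (- k) * f (moebius A z) = (\<Sum>j\<le>p. g j z * slope A z ^ j)"
  using assms by (auto simp: quasi_expansion_iff)

lemma coeffs_eq_of_slopes:
  assumes z: "z \<in> uhp" and eq: "\<And>A. A \<in> G \<Longrightarrow> (\<Sum>j\<le>p. a j * slope A z ^ j) = (\<Sum>j\<le>p. b j * slope A z ^ j)"
    and j: "j \<le> p"
  shows "a j = b j"
proof (rule ccontr)
  assume "a j \<noteq> b j"
  hence "finite {x. (\<Sum>i\<le>p. (a i - b i) * x ^ i) = 0}"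
    using polyfun_roots_finite[of "\<lambda>i. a i - b i" j p] j by simp
  moreover have "(\<lambda>A. slope A z) ` G \<subseteq> {x. (\<Sum>i\<le>p. (a i - b i) * x ^ i) = 0}"
    using eq by (auto simp: left_diff_distrib sum_subtractf)
  ultimately show False using infinite_slopes[OF z] finite_subset by blast
qed

lemma sum_coeffs_extend:
  assumes "\<forall>j>p. g j = (0 :: complex \<Rightarrow> complex)" "p \<le> (q :: nat)"
  shows "(\<Sum>j\<le>q. g j z * s j) = (\<Sum>j\<le>p. g j z * s j)"
  using assms by (intro sum.mono_neutral_right) auto

lemma quasi_expansion_mono:
  assumes "quasi_expansion \<Gamma> k p f g" "p \<le> q" shows "quasi_expansion \<Gamma> k q f g"
  using assms sum_coeffs_extend[of p g q] by (auto simp: quasi_expansion_iff)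

lemma quasi_expansion_lower:
  assumes "quasi_expansion \<Gamma> k q f g" "\<forall>j>p. g j = 0" shows "quasi_expansion \<Gamma> k p f g"
proof (cases "p \<le> q")
  case True
  thus ?thesis using assms sum_coeffs_extend[of p g q] by (auto simp: quasi_expansion_iff)
qed (use assms quasi_expansion_mono in auto)

lemma quasi_expansion_unique:
  assumes "quasi_expansion \<Gamma> k p f g" "quasi_expansion \<Gamma> k q f h" shows "g = h"
proof (intro ext)
  fix j z
  define r where "r = max p q"
  have g: "quasi_expansion \<Gamma> k r f g" and h: "quasi_expansion \<Gamma> k r f h"
    using quasi_expansion_mono[OF assms(1), of r] quasi_expansion_mono[OF assms(2), of r] by (auto simp: r_def)
  show "g j z = h j z"
  proof (cases "z \<in> uhp \<and> j \<le> r")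
    case True
    hence z: "z \<in> uhp" and j: "j \<le> r" by auto
    show ?thesis
    proof (rule coeffs_eq_of_slopes[OF z _ j, of "\<lambda>j. g j z" "\<lambda>j. h j z"])
      fix A assume "A \<in> G"
      show "(\<Sum>j\<le>r. g j z * slope A z ^ j) = (\<Sum>j\<le>r. h j z * slope A z ^ j)"
        using quasi_expansionD(3)[OF g \<open>A \<in> G\<close> z] quasi_expansionD(3)[OF h \<open>A \<in> G\<close> z] by (rule trans[OF sym])
    qed
  next
    case False
    show ?thesis
    proof (cases "z \<in> uhp")
      case True
      hence "j > r" using False by auto
      thus ?thesis using quasi_expansionD(2)[OF g] quasi_expansionD(2)[OF h] by simp
    next
      case False
      thus ?thesis using quasi_expansionD(1)[OF g, of j] quasi_expansionD(1)[OF h, of j] by (simp add: hfun_def)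
    qed
  qed
qed

lemma quasi_coeffs_eq:
  assumes "quasi_expansion \<Gamma> k p f g" shows "quasi_coeffs \<Gamma> k f = g"
  unfolding quasi_coeffs_def using assms quasi_expansion_unique by (intro the_equality) blast+

text \<open>
  Matrices whose slopes differ at one point have different slopes at every point. So the same matrices provide nodes
  for interpolation on the whole upper half plane.
\<close>

lemma distinct_slopes:
  obtains a :: "nat \<Rightarrow> real^2^2" where "\<And>i. a i \<in> G"
    "\<And>i j z. i \<noteq> j \<Longrightarrow> z \<in> uhp \<Longrightarrow> slope (a i) z \<noteq> slope (a j) z"
proof -
  have i: "\<i> \<in> uhp" by (simp add: uhp_def)
  obtain s :: "nat \<Rightarrow> complex" where s: "inj s" "range s \<subseteq> (\<lambda>A. slope A \<i>) ` G"
    using infinite_countable_subset[OF infinite_slopes[OF i]] by blast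
  have "\<forall>i. \<exists>A. A \<in> G \<and> s i = slope A \<i>" using s(2) by blast
  then obtain a where a: "\<And>i. a i \<in> G" "\<And>i. s i = slope (a i) \<i>" by metis
  show thesis
  proof (rule that[of a, OF a(1)])
    fix i j :: nat and z assume ij: "i \<noteq> j" and z: "z \<in> uhp"
    show "slope (a i) z \<noteq> slope (a j) z"
    proof
      assume "slope (a i) z = slope (a j) z"
      hence "s i = s j" unfolding a(2) by (intro slope_eq_independent[OF _ _ z i]) (auto intro: det_G a(1))
      thus False using s(1) ij by (auto dest: injD)
    qed
  qed
qed

lemma quasi_coeff_mod_hol:
  assumes f: "mod_hol f" and e: "quasi_expansion \<Gamma> k p f g"
  shows "mod_hol (g j)"
proof (cases "j \<le> p")
  case True
  obtain a :: "nat \<Rightarrow> real^2^2" where a: "\<And>i. a i \<in> G"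
    "\<And>i j z. i \<noteq> j \<Longrightarrow> z \<in> uhp \<Longrightarrow> slope (a i) z \<noteq> slope (a j) z"
    by (rule distinct_slopes) blast
  have d: "det (a i) = 1" for i by (rule det_G[OF a(1)])
  show ?thesis
  proof (rule mod_hol_interpolation[of "\<lambda>i. slope (a i)"])
    fix i
    have "mod_hol (\<lambda>z. autom (a i) z powi (- k) * f (moebius (a i) z))"
      by (intro mod_hol_mult mod_hol_autom_powi mod_hol_moebius f d)
    thus "mod_hol (\<lambda>z. \<Sum>j\<le>p. g j z * slope (a i) z ^ j)"
      by (rule mod_hol_cong) (rule quasi_expansionD(3)[OF e a(1)])
  qed (use True a d in \<open>auto intro: mod_hol_slope mod_hol_inverse_slope_diff\<close>)
next
  case False
  hence "g j = (\<lambda>_. 0)" using quasi_expansionD(2)[OF e] by (auto simp: fun_eq_iff)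
  thus ?thesis using mod_hol_const by simp
qed

text \<open>
  This is the cocycle relation \<open>f|(AB) = (f|A)|B\<close>. By \<open>slope_mult\<close> the left hand side is a polynomial in the slope of \<open>A\<close> at
  \<open>Bz\<close>, and its coefficients can be compared with those of the right hand side, since \<open>A\<close> is arbitrary.
\<close>

lemma quasi_coeff_expansion:
  assumes e: "quasi_expansion \<Gamma> k p f g" and j: "j \<le> p"
  shows "quasi_expansion \<Gamma> (k - 2 * int j) (p - j) (g j) (\<lambda>i. fscale (of_nat ((i + j) choose j)) (g (i + j)))"
  unfolding quasi_expansion_iff
proof (intro conjI allI impI ballI)
  show "hfun (fscale (of_nat ((i + j) choose j)) (g (i + j)))" for i
    by (rule hfun_fscale[OF quasi_expansionD(1)[OF e]])
  show "fscale (of_nat ((i + j) choose j)) (g (i + j)) = 0" if "i > p - j" for i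
    using quasi_expansionD(2)[OF e, of "i + j"] that j by (auto simp: fscale_def fun_eq_iff)
next
  fix B z assume B: "B \<in> G" and z: "z \<in> uhp"
  define J where "J = autom B z"
  define s where "s = slope B z"
  let ?w = "moebius B z"
  have dB: "det B = 1" by (rule det_G[OF B])
  have w: "?w \<in> uhp" by (rule moebius_uhp[OF dB z])
  have J: "J \<noteq> 0" using autom_nonzero[OF dB z] by (simp add: J_def)
  define b where "b j = (\<Sum>i\<le>p-j. of_nat ((i + j) choose j) * g (i + j) z * s ^ i)" for j
  have "J powi (- k) * g j ?w = b j / J ^ (2 * j)"
  proof (rule coeffs_eq_of_slopes[OF w _ j, of "\<lambda>j. J powi (- k) * g j ?w" "\<lambda>j. b j / J ^ (2 * j)"])
    fix A assume A: "A \<in> G"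
    have dA: "det A = 1" by (rule det_G[OF A])
    define X where "X = slope A ?w"
    have "(\<Sum>j\<le>p. J powi (- k) * g j ?w * X ^ j) = J powi (- k) * (\<Sum>j\<le>p. g j ?w * X ^ j)"
      by (simp add: sum_distrib_left mult.assoc)
    also have "\<dots> = J powi (- k) * (autom A ?w powi (- k) * f (moebius A ?w))"
      using quasi_expansionD(3)[OF e A w] by (simp add: X_def)
    also have "\<dots> = autom (A ** B) z powi (- k) * f (moebius (A ** B) z)"
      unfolding autom_mult[OF dB z] moebius_mult[OF dA dB z]
      by (simp add: J_def power_int_mult_distrib mult_ac)
    also have "\<dots> = (\<Sum>r\<le>p. g r z * (s + X / J\<^sup>2) ^ r)"
      using quasi_expansionD(3)[OF e mult_G[OF A B] z] by (simp add: slope_mult[OF dA dB z] s_def X_def J_def)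
    also have "\<dots> = (\<Sum>j\<le>p. b j * (X / J\<^sup>2) ^ j)"
      unfolding b_def by (rule binomial_sum_swap)
    also have "\<dots> = (\<Sum>j\<le>p. b j / J ^ (2 * j) * X ^ j)"
      by (simp add: power_divide power_mult)
    finally show "(\<Sum>j\<le>p. J powi (- k) * g j ?w * slope A ?w ^ j) = (\<Sum>j\<le>p. b j / J ^ (2 * j) * slope A ?w ^ j)"
      by (simp add: X_def)
  qed
  hence "J ^ (2 * j) * (J powi (- k) * g j ?w) = b j" using J by simp
  moreover have "J powi (- (k - 2 * int j)) = J ^ (2 * j) * J powi (- k)"
  proof -
    have "J powi (- (k - 2 * int j)) = J powi (int (2 * j) + - k)" by (simp add: algebra_simps)
    also have "\<dots> = J ^ (2 * j) * J powi (- k)" using J by (simp only: power_int_add power_int_of_nat simp_thms)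
    finally show ?thesis .
  qed
  ultimately show "autom B z powi - (k - 2 * int j) * g j ?w
      = (\<Sum>i\<le>p - j. fscale (of_nat ((i + j) choose j)) (g (i + j)) z * slope B z ^ i)"
    by (simp add: b_def J_def s_def fscale_def mult.assoc)
qed

text \<open>
  The coefficients \<open>(Df)\<^sub>j = D f\<^sub>j + (k-j+1) f\<^sub>j\<^sub>-\<^sub>1\<close> of the derivative of a form of weight \<open>k\<close>.
\<close>

definition Dcoeffs :: "int \<Rightarrow> (nat \<Rightarrow> complex \<Rightarrow> complex) \<Rightarrow> nat \<Rightarrow> complex \<Rightarrow> complex" where
  "Dcoeffs k g j = Dz (g j) + (if j = 0 then 0 else fscale (of_int (k - int j + 1)) (g (j - 1)))"

text \<open>
  The derivative of \<open>f|A\<close> is \<open>(Df)|A - k X (f|A)\<close> with \<open>Df\<close> taken in weight \<open>k + 2\<close>, and \<open>X\<close> satisfies \<open>X' = -X\<^sup>2\<close>.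
\<close>

lemma quasi_expansion_Dz:
  assumes f: "mod_hol f" and e: "quasi_expansion \<Gamma> k p f g"
  shows "quasi_expansion \<Gamma> (k + 2) (Suc p) (Dz f) (Dcoeffs k g)"
  unfolding quasi_expansion_iff
proof (intro conjI allI impI ballI)
  show "hfun (Dcoeffs k g j)" for j
    using quasi_expansionD(1)[OF e] by (auto simp: Dcoeffs_def hfun_def Dz_def fscale_def)
  show "Dcoeffs k g j = 0" if "j > Suc p" for j
  proof -
    have "g j = 0" "g (j - 1) = 0"
      using quasi_expansionD(2)[OF e, of j] quasi_expansionD(2)[OF e, of "j - 1"] that by auto
    thus ?thesis by (simp add: Dcoeffs_def)
  qed
next
  fix A z assume A: "A \<in> G" and z: "z \<in> uhp"
  have d: "det A = 1" by (rule det_G[OF A])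
  have w: "moebius A z \<in> uhp" by (rule moebius_uhp[OF d z])
  define J where "J = autom A z"
  define X where "X = slope A z"
  have J: "J \<noteq> 0" using autom_nonzero[OF d z] by (simp add: J_def)
  have cJ: "of_real (A$2$1) = X * J" using J by (simp add: X_def J_def slope_def)
  have deriv: "(h has_field_derivative Dz h u) (at u)" if "mod_hol h" "u \<in> uhp" for h u
    using holomorphic_derivI[of h uhp u UNIV] that open_uhp by (simp add: mod_hol_def Dz_def)
  define L where "L = (\<lambda>u. autom A u powi (- k) * f (moebius A u))"
  define R where "R = (\<lambda>u. \<Sum>j\<le>p. g j u * slope A u ^ j)"
  have 1: "(L has_field_derivative
      (of_int (- k) * J powi (- k - 1) * (X * J)) * f (moebius A z)
        + J powi (- k) * (Dz f (moebius A z) * (1 / J\<^sup>2))) (at z)"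
  proof -
    have "((\<lambda>u. autom A u powi (- k)) has_field_derivative of_int (- k) * J powi (- k - 1) * (X * J)) (at z)"
      using DERIV_power_int[OF autom_has_derivative[of A z], of "- k"] J unfolding J_def[symmetric] cJ[symmetric]
      by (simp add: J_def mult_ac)
    moreover have "((\<lambda>u. f (moebius A u)) has_field_derivative Dz f (moebius A z) * (1 / J\<^sup>2)) (at z)"
      using DERIV_chain2[OF deriv[OF f w] moebius_has_derivative[OF d z]] by (simp add: J_def)
    ultimately show ?thesis
      unfolding L_def by (rule DERIV_mult[THEN DERIV_cong]) (simp add: J_def)
  qed
  have 2: "(R has_field_derivative (\<Sum>j\<le>p. Dz (g j) z * X ^ j - of_nat j * g j z * X ^ Suc j)) (at z)"
    unfolding R_def
  proof (rule DERIV_sum)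
    fix j assume "j \<in> {..p}"
    have "((\<lambda>u. slope A u ^ j) has_field_derivative - (of_nat j * X ^ Suc j)) (at z)"
    proof (cases j)
      case (Suc i)
      have "((\<lambda>u. slope A u ^ j) has_field_derivative of_nat j * (- (slope A z)\<^sup>2 * slope A z ^ (j - Suc 0))) (at z)"
        by (rule DERIV_power[OF slope_has_derivative[OF d z]])
      thus ?thesis using Suc by (simp add: X_def power2_eq_square mult_ac)
    qed simp
    from DERIV_mult[OF deriv[OF quasi_coeff_mod_hol[OF f e] z, of j] this]
    show "((\<lambda>u. g j u * slope A u ^ j) has_field_derivative Dz (g j) z * X ^ j - of_nat j * g j z * X ^ Suc j) (at z)"
      by (rule DERIV_cong) (simp add: X_def algebra_simps)
  qed
  have "(L has_field_derivative (\<Sum>j\<le>p. Dz (g j) z * X ^ j - of_nat j * g j z * X ^ Suc j)) (at z)"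
    by (rule has_field_derivative_transform_within_open[OF 2 open_uhp z])
       (simp add: L_def R_def quasi_expansionD(3)[OF e A])
  from DERIV_unique[OF 1 this]
  have eq: "of_int (- k) * J powi (- k - 1) * (X * J) * f (moebius A z) + J powi (- k) * (Dz f (moebius A z) * (1 / J\<^sup>2))
      = (\<Sum>j\<le>p. Dz (g j) z * X ^ j - of_nat j * g j z * X ^ Suc j)" .
  have p1: "J powi (- k - 1) * J = J powi (- k)"
    using J power_int_add[of J "- k - 1" 1] by simp
  have p2: "J powi (- (k + 2)) = J powi (- k) / J\<^sup>2"
    using J power_int_diff[of J "- k" 2] by (simp add: algebra_simps)
  have q: "J powi (- k) * f (moebius A z) = (\<Sum>j\<le>p. g j z * X ^ j)"
    using quasi_expansionD(3)[OF e A z] by (simp add: J_def X_def)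
  have "of_int (- k) * J powi (- k - 1) * (X * J) * f (moebius A z)
      = - of_int k * X * ((J powi (- k - 1) * J) * f (moebius A z))" by (simp add: mult_ac)
  also have "\<dots> = - (\<Sum>j\<le>p. of_int k * g j z * X ^ Suc j)"
    unfolding p1 q by (simp add: sum_distrib_left sum_negf mult_ac)
  finally have t: "of_int (- k) * J powi (- k - 1) * (X * J) * f (moebius A z) = - (\<Sum>j\<le>p. of_int k * g j z * X ^ Suc j)" .
  have "J powi (- (k + 2)) * Dz f (moebius A z)
      = (\<Sum>j\<le>p. Dz (g j) z * X ^ j - of_nat j * g j z * X ^ Suc j) + (\<Sum>j\<le>p. of_int k * g j z * X ^ Suc j)"
    using eq unfolding t p2 by (simp add: algebra_simps)
  also have "\<dots> = (\<Sum>j\<le>p. Dz (g j) z * X ^ j) + (\<Sum>j\<le>p. of_int (k - int j) * g j z * X ^ Suc j)"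
    by (simp add: sum.distrib[symmetric] algebra_simps)
  also have "\<dots> = (\<Sum>j\<le>Suc p. Dcoeffs k g j z * X ^ j)"
  proof -
    have "g (Suc p) = 0" using quasi_expansionD(2)[OF e] by simp
    hence "(\<Sum>j\<le>p. Dz (g j) z * X ^ j) = (\<Sum>j\<le>Suc p. Dz (g j) z * X ^ j)" by simp
    moreover have "(\<Sum>j\<le>p. of_int (k - int j) * g j z * X ^ Suc j)
        = (\<Sum>j\<le>Suc p. (if j = 0 then 0 else of_int (k - int j + 1) * g (j - 1) z) * X ^ j)"
      by (subst sum.atMost_Suc_shift) simp
    moreover have "Dcoeffs k g j z = Dz (g j) z + (if j = 0 then 0 else of_int (k - int j + 1) * g (j - 1) z)" for j
      by (simp add: Dcoeffs_def fscale_def)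
    ultimately show ?thesis by (simp only: sum.distrib[symmetric] distrib_right[symmetric])
  qed
  finally show "autom A z powi - (k + 2) * Dz f (moebius A z) = (\<Sum>j\<le>Suc p. Dcoeffs k g j z * slope A z ^ j)"
    by (simp only: J_def X_def)
qed

end

section \<open>Quasimodular forms of bounded depth\<close>

lemma fscale_fscale: "fscale c (fscale d f) = fscale (c * d) f"
  by (simp add: fscale_def fun_eq_iff)

lemma fscale_one [simp]: "fscale 1 f = f"
  by (simp add: fscale_def)

lemma fscale_eq_0_iff: "fscale c f = 0 \<longleftrightarrow> c = 0 \<or> f = 0"
  by (auto simp: fscale_def fun_eq_iff)

lemma mod_hol_0: "mod_hol 0"
  using mod_hol_const[of 0] by (simp add: zero_fun_def)

lemma mod_hol_plus: "mod_hol f \<Longrightarrow> mod_hol g \<Longrightarrow> mod_hol (f + g)"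
  using mod_hol_add by (simp add: plus_fun_def)

lemma mod_hol_fscale: "mod_hol f \<Longrightarrow> mod_hol (fscale c f)"
  using mod_hol_mult[OF mod_hol_const] by (simp add: fscale_def)

lemma mod_hol_differentiable: "mod_hol f \<Longrightarrow> z \<in> uhp \<Longrightarrow> f field_differentiable at z"
  using open_uhp holomorphic_on_imp_differentiable_at by (auto simp: mod_hol_def)

lemma Dz_add: "mod_hol f \<Longrightarrow> mod_hol g \<Longrightarrow> Dz (f + g) = Dz f + Dz g"
  by (auto simp: Dz_def fun_eq_iff plus_fun_def mod_hol_differentiable)

lemma Dz_fscale: "mod_hol f \<Longrightarrow> Dz (fscale c f) = fscale c (Dz f)"
  by (auto simp: Dz_def fun_eq_iff fscale_def mod_hol_differentiable)

lemma mod_hol_Dz_pow: "mod_hol f \<Longrightarrow> mod_hol ((Dz ^^ i) f)"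
  by (induction i) (auto intro: mod_hol_Dz)

lemma Dz_pow_add: "mod_hol f \<Longrightarrow> mod_hol g \<Longrightarrow> (Dz ^^ i) (f + g) = (Dz ^^ i) f + (Dz ^^ i) g"
  by (induction i) (auto simp: Dz_add mod_hol_Dz_pow)

lemma Dz_pow_fscale: "mod_hol f \<Longrightarrow> (Dz ^^ i) (fscale c f) = fscale c ((Dz ^^ i) f)"
  by (induction i) (auto simp: Dz_fscale mod_hol_Dz_pow)

lemma Dz_pow_0 [simp]: "(Dz ^^ i) 0 = 0"
proof (induction i)
  case (Suc i)
  thus ?case by (simp only: funpow.simps o_apply Dz_0)
qed simp

lemma hfun_const_hfun: "hfun (const_hfun c)"
  by (simp add: hfun_def const_hfun_def)

lemma mod_hol_const_hfun: "mod_hol (const_hfun c)"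
  by (rule mod_hol_cong[OF mod_hol_const]) (simp add: const_hfun_def)

lemma fscale_const_hfun: "fscale a (const_hfun c) = const_hfun (a * c)"
  by (auto simp: fscale_def const_hfun_def)

lemma const_hfun_eq_0_iff: "const_hfun c = 0 \<longleftrightarrow> c = 0"
proof
  assume "const_hfun c = 0"
  hence "const_hfun c \<i> = 0" by simp
  thus "c = 0" by (simp add: const_hfun_def uhp_def)
qed (auto simp: const_hfun_def)

context fuchsian
begin

abbreviation "QM \<equiv> quasimodular_forms \<Gamma>"
abbreviation "QMd \<equiv> quasimodular_forms_depth \<Gamma>"
abbreviation "qcoeff \<equiv> quasi_coeffs \<Gamma>"

lemma QMd_iff: "f \<in> QMd k p \<longleftrightarrow> hfun f \<and> mod_hol f \<and> (\<exists>g. quasi_expansion \<Gamma> k p f g)"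
  by (auto simp: quasimodular_forms_depth_def mod_hol_def)

lemma QMdI: "hfun f \<Longrightarrow> mod_hol f \<Longrightarrow> quasi_expansion \<Gamma> k p f g \<Longrightarrow> f \<in> QMd k p"
  by (auto simp: QMd_iff)

lemma QMd_hfun: "f \<in> QMd k p \<Longrightarrow> hfun f"
  and QMd_mod_hol: "f \<in> QMd k p \<Longrightarrow> mod_hol f"
  by (simp_all add: QMd_iff)

lemma QMd_expansion: "f \<in> QMd k p \<Longrightarrow> quasi_expansion \<Gamma> k p f (qcoeff k f)"
  using quasi_coeffs_eq by (auto simp: QMd_iff)

lemma QMd_subset_QM: "f \<in> QMd k p \<Longrightarrow> f \<in> QM k"
  by (auto simp: quasimodular_forms_def)

lemma QM_E: "f \<in> QM k \<Longrightarrow> (\<And>p. f \<in> QMd k p \<Longrightarrow> P) \<Longrightarrow> P"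
  by (auto simp: quasimodular_forms_def)

lemma QMd_mono: "f \<in> QMd k p \<Longrightarrow> p \<le> q \<Longrightarrow> f \<in> QMd k q"
  by (metis QMd_iff quasi_expansion_mono)

lemma coeffs_above_depth: "f \<in> QMd k p \<Longrightarrow> p < j \<Longrightarrow> qcoeff k f j = 0"
  using quasi_expansionD(2)[OF QMd_expansion] by blast

lemma QM_depthI:
  assumes "f \<in> QM k" "\<And>j. j > p \<Longrightarrow> qcoeff k f j = 0" shows "f \<in> QMd k p"
proof (rule QM_E[OF assms(1)])
  fix q assume f: "f \<in> QMd k q"
  show ?thesis
    using quasi_expansion_lower[OF QMd_expansion[OF f]] assms(2) by (intro QMdI QMd_hfun[OF f] QMd_mod_hol[OF f]) auto
qed

lemma coeffs_0:
  assumes "f \<in> QM k" shows "qcoeff k f 0 = f"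
proof (rule QM_E[OF assms])
  fix p assume f: "f \<in> QMd k p"
  note e = QMd_expansion[OF f]
  show ?thesis
  proof
    fix z
    show "qcoeff k f 0 z = f z"
    proof (cases "z \<in> uhp")
      case True
      have "f z = (\<Sum>j\<le>p. qcoeff k f j z * 0 ^ j)"
        using quasi_expansionD(3)[OF e one_G True] by simp
      also have "\<dots> = qcoeff k f 0 z" by (simp add: power_0_left if_distrib sum.delta cong: if_cong)
      finally show ?thesis by simp
    next
      case False
      thus ?thesis using quasi_expansionD(1)[OF e, of 0] QMd_hfun[OF f] by (simp add: hfun_def)
    qed
  qed
qed

lemma quasi_expansion_add:
  assumes "quasi_expansion \<Gamma> k p f g" "quasi_expansion \<Gamma> k p f' g'"
  shows "quasi_expansion \<Gamma> k p (f + f') (\<lambda>j. g j + g' j)"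
  using assms by (auto simp: quasi_expansion_iff hfun_add distrib_left distrib_right sum.distrib)

lemma quasi_expansion_fscale:
  assumes "quasi_expansion \<Gamma> k p f g"
  shows "quasi_expansion \<Gamma> k p (fscale c f) (\<lambda>j. fscale c (g j))"
  unfolding quasi_expansion_iff
proof (intro conjI allI impI ballI)
  fix A z assume Az: "A \<in> G" "z \<in> uhp"
  have "autom A z powi (- k) * fscale c f (moebius A z) = c * (autom A z powi (- k) * f (moebius A z))"
    by (simp add: fscale_def mult_ac)
  also have "\<dots> = (\<Sum>j\<le>p. fscale c (g j) z * slope A z ^ j)"
    unfolding quasi_expansionD(3)[OF assms Az] by (simp add: fscale_def sum_distrib_left mult_ac)
  finally show "autom A z powi (- k) * fscale c f (moebius A z) = (\<Sum>j\<le>p. fscale c (g j) z * slope A z ^ j)" .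
qed (use quasi_expansionD(1,2)[OF assms] in \<open>simp_all add: hfun_fscale\<close>)

lemma QMd_add:
  assumes "f \<in> QMd k p" "g \<in> QMd k p"
  shows "f + g \<in> QMd k p" and "qcoeff k (f + g) j = qcoeff k f j + qcoeff k g j"
proof -
  have e: "quasi_expansion \<Gamma> k p (f + g) (\<lambda>j. qcoeff k f j + qcoeff k g j)"
    by (intro quasi_expansion_add QMd_expansion assms)
  show "f + g \<in> QMd k p"
    using assms by (intro QMdI[OF _ _ e] hfun_add mod_hol_plus) (auto simp: QMd_iff)
  show "qcoeff k (f + g) j = qcoeff k f j + qcoeff k g j"
    by (simp add: quasi_coeffs_eq[OF e])
qed

lemma QMd_fscale:
  assumes "f \<in> QMd k p"
  shows "fscale c f \<in> QMd k p" and "qcoeff k (fscale c f) j = fscale c (qcoeff k f j)"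
proof -
  have e: "quasi_expansion \<Gamma> k p (fscale c f) (\<lambda>j. fscale c (qcoeff k f j))"
    by (intro quasi_expansion_fscale QMd_expansion assms)
  show "fscale c f \<in> QMd k p"
    using assms by (intro QMdI[OF _ _ e] hfun_fscale mod_hol_fscale) (auto simp: QMd_iff)
  show "qcoeff k (fscale c f) j = fscale c (qcoeff k f j)"
    by (simp add: quasi_coeffs_eq[OF e])
qed

lemma QMd_0: "0 \<in> QMd k p" and coeffs_of_0: "qcoeff k 0 j = 0"
proof -
  have e: "quasi_expansion \<Gamma> k p 0 (\<lambda>_. 0)" by (simp add: quasi_expansion_iff hfun_def)
  show "0 \<in> QMd k p" by (rule QMdI[OF _ mod_hol_0 e]) (simp add: hfun_def)
  show "qcoeff k 0 j = 0" by (simp add: quasi_coeffs_eq[OF e])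
qed

lemma QMd_diff:
  assumes "f \<in> QMd k p" "g \<in> QMd k p"
  shows "f - g \<in> QMd k p" and "qcoeff k (f - g) j = qcoeff k f j - qcoeff k g j"
proof -
  have d: "f - g = f + fscale (-1) g" for f g by (simp add: fscale_def fun_eq_iff)
  note g = QMd_fscale[OF assms(2), of "-1"]
  show "f - g \<in> QMd k p" unfolding d by (rule QMd_add(1)[OF assms(1) g(1)])
  show "qcoeff k (f - g) j = qcoeff k f j - qcoeff k g j"
    unfolding d by (simp only: QMd_add(2)[OF assms(1) g(1)] g(2))
qed

lemma QM_add:
  assumes "f \<in> QM k" "g \<in> QM k"
  shows "f + g \<in> QM k" and "qcoeff k (f + g) j = qcoeff k f j + qcoeff k g j"
proof -
  obtain p q where "f \<in> QMd k p" "g \<in> QMd k q" using assms by (auto elim!: QM_E)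
  hence "f \<in> QMd k (max p q)" "g \<in> QMd k (max p q)" by (auto elim: QMd_mono)
  thus "f + g \<in> QM k" "qcoeff k (f + g) j = qcoeff k f j + qcoeff k g j"
    using QMd_add QMd_subset_QM by blast+
qed

lemma QM_fscale:
  assumes "f \<in> QM k"
  shows "fscale c f \<in> QM k" and "qcoeff k (fscale c f) j = fscale c (qcoeff k f j)"
  using assms QMd_fscale QMd_subset_QM by (blast elim: QM_E)+

lemma subspace_QM: "cfun.subspace (QM k)"
  using QM_add(1) QM_fscale(1) QMd_0 QMd_subset_QM by (auto simp: cfun.subspace_def)

lemma modular_forms_eq_depth_0: "modular_forms \<Gamma> k = QMd k 0"
proof (intro equalityI subsetI)
  fix f assume f: "f \<in> modular_forms \<Gamma> k"
  hence "quasi_expansion \<Gamma> k 0 f (\<lambda>j. if j = 0 then f else 0)"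
    by (auto simp: quasi_expansion_iff modular_forms_def hfun_def G_def)
  thus "f \<in> QMd k 0" using f by (intro QMdI) (auto simp: modular_forms_def mod_hol_def)
next
  fix f assume f: "f \<in> QMd k 0"
  have "autom A z powi (- k) * f (moebius A z) = f z" if "A \<in> G" "z \<in> uhp" for A z
    using quasi_expansionD(3)[OF QMd_expansion[OF f] that] coeffs_0[OF QMd_subset_QM[OF f]] by simp
  thus "f \<in> modular_forms \<Gamma> k" using f by (auto simp: modular_forms_def QMd_iff mod_hol_def G_def)
qed

lemma modular_forms_mod_hol: "f \<in> modular_forms \<Gamma> k \<Longrightarrow> mod_hol f"
  unfolding modular_forms_eq_depth_0 by (rule QMd_mod_hol)

lemma subspace_modular_forms: "cfun.subspace (modular_forms \<Gamma> k)"
  unfolding modular_forms_eq_depth_0 using QMd_add(1) QMd_fscale(1) QMd_0 by (auto simp: cfun.subspace_def)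

lemma coeffs_QMd:
  assumes f: "f \<in> QMd k p" and j: "j \<le> p"
  shows "qcoeff k f j \<in> QMd (k - 2 * int j) (p - j)"
    and "qcoeff (k - 2 * int j) (qcoeff k f j) i = fscale (of_nat ((i + j) choose j)) (qcoeff k f (i + j))"
proof -
  note e = QMd_expansion[OF f]
  note e' = quasi_coeff_expansion[OF e j]
  show "qcoeff k f j \<in> QMd (k - 2 * int j) (p - j)"
    by (rule QMdI[OF quasi_expansionD(1)[OF e] quasi_coeff_mod_hol[OF QMd_mod_hol[OF f] e] e'])
  show "qcoeff (k - 2 * int j) (qcoeff k f j) i = fscale (of_nat ((i + j) choose j)) (qcoeff k f (i + j))"
    by (simp add: quasi_coeffs_eq[OF e'])
qed

lemma top_coeff_modular:
  assumes "f \<in> QMd k p" shows "qcoeff k f p \<in> modular_forms \<Gamma> (k - 2 * int p)"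
  using coeffs_QMd(1)[OF assms, of p] by (simp add: modular_forms_eq_depth_0)

text \<open>
  The last nonzero coefficient is a modular form, and its weight cannot be negative.
\<close>

lemma coeffs_above_half_weight:
  assumes f: "f \<in> QM k" and j: "k < 2 * int j" shows "qcoeff k f j = 0"
proof (rule ccontr)
  assume nz: "qcoeff k f j \<noteq> 0"
  obtain p where p: "f \<in> QMd k p" using f by (rule QM_E)
  define J where "J = Max {j. qcoeff k f j \<noteq> 0}"
  have sub: "{j. qcoeff k f j \<noteq> 0} \<subseteq> {..p}" using coeffs_above_depth[OF p] by (auto simp: not_less[symmetric])
  hence fin: "finite {j. qcoeff k f j \<noteq> 0}" using finite_subset by blast
  have J: "qcoeff k f J \<noteq> 0" "j \<le> J"
    using Max_in[OF fin] Max_ge[OF fin] nz unfolding J_def by auto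
  have "f \<in> QMd k J"
  proof (rule QM_depthI[OF f], rule ccontr)
    fix i assume "J < i" "qcoeff k f i \<noteq> 0"
    thus False using Max_ge[OF fin, of i] by (simp add: J_def)
  qed
  hence "qcoeff k f J \<in> modular_forms \<Gamma> (k - 2 * int J)" by (rule top_coeff_modular)
  hence "qcoeff k f J = 0" using j J(2) by (intro modular_forms_neg) auto
  thus False using J(1) by simp
qed

lemma QM_half_weight:
  assumes "f \<in> QM k" "k \<le> 2 * int p + 1" shows "f \<in> QMd k p"
  using assms by (intro QM_depthI coeffs_above_half_weight) auto

lemma const_hfun_QMd: "const_hfun c \<in> QMd 0 0"
proof -
  have "const_hfun c (moebius A z) = const_hfun c z" if "A \<in> G" "z \<in> uhp" for A z
    using moebius_uhp[OF det_G[OF that(1)] that(2)] that(2) by (simp add: const_hfun_def)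
  hence "const_hfun c \<in> modular_forms \<Gamma> 0"
    using hfun_const_hfun[of c] mod_hol_const_hfun[of c]
    by (auto simp: modular_forms_def mod_hol_def G_def)
  thus ?thesis by (simp add: modular_forms_eq_depth_0)
qed

lemma QM_0: "QM 0 = range const_hfun"
proof (intro equalityI subsetI)
  fix f assume "f \<in> QM 0"
  hence "f \<in> modular_forms \<Gamma> 0" using QM_half_weight[of f 0 0] by (simp add: modular_forms_eq_depth_0)
  thus "f \<in> range const_hfun" by (rule modular_forms_0)
qed (auto intro: QMd_subset_QM const_hfun_QMd)

lemma top_coeff_half_weight:
  assumes "f \<in> QMd (2 * int d) d" obtains c where "qcoeff (2 * int d) f d = const_hfun c"
  using modular_forms_0[of "qcoeff (2 * int d) f d"] top_coeff_modular[OF assms] by auto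

lemma Dz_QMd:
  assumes f: "f \<in> QMd k p"
  shows "Dz f \<in> QMd (k + 2) (Suc p)" and "qcoeff (k + 2) (Dz f) = Dcoeffs k (qcoeff k f)"
proof -
  note e = quasi_expansion_Dz[OF QMd_mod_hol[OF f] QMd_expansion[OF f]]
  show "Dz f \<in> QMd (k + 2) (Suc p)"
    by (rule QMdI[OF hfun_Dz mod_hol_Dz[OF QMd_mod_hol[OF f]] e])
  show "qcoeff (k + 2) (Dz f) = Dcoeffs k (qcoeff k f)" by (rule quasi_coeffs_eq[OF e])
qed

text \<open>
  Only the second term of \<open>Dcoeffs\<close> contributes to the top coefficient. After \<open>r\<close> steps the weight is \<open>m + 2r\<close> and the
  depth \<open>p + r\<close>, so the next factor is \<open>m - p + r\<close>.
\<close>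

lemma Dz_pow_QMd:
  assumes f: "f \<in> QMd m p"
  shows "(Dz ^^ i) f \<in> QMd (m + 2 * int i) (p + i) \<and>
    qcoeff (m + 2 * int i) ((Dz ^^ i) f) (p + i) = fscale (\<Prod>r<i. of_int (m - int p + int r)) (qcoeff m f p)"
proof (induction i)
  case 0
  thus ?case using f by simp
next
  case (Suc i)
  let ?k = "m + 2 * int i" and ?h = "(Dz ^^ i) f"
  have h: "?h \<in> QMd ?k (p + i)" using Suc.IH by simp
  have k: "m + 2 * int (Suc i) = ?k + 2" by simp
  have "qcoeff (?k + 2) (Dz ?h) (Suc (p + i)) = fscale (of_int (m - int p + int i)) (qcoeff ?k ?h (p + i))"
    unfolding Dz_QMd(2)[OF h] Dcoeffs_def using coeffs_above_depth[OF h, of "Suc (p + i)"]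
    by (simp add: algebra_simps)
  also have "\<dots> = fscale (\<Prod>r<Suc i. of_int (m - int p + int r)) (qcoeff m f p)"
    using Suc.IH by (simp add: fscale_fscale mult.commute)
  finally show ?case using Dz_QMd(1)[OF h] unfolding k by simp
qed

section \<open>The decomposition in a fixed weight\<close>

text \<open>
  The elements of weight \<open>k\<close> with which a top coefficient in depth \<open>d\<close> can be removed. Derivatives of modular forms of positive
  weight do this for \<open>d < k/2\<close>. In depth \<open>d = k/2\<close> the top coefficient is a constant, and the family \<open>P\<close> takes over,
  which depends on whether \<open>\<phi>\<close> exists.
\<close>

definition level :: "(nat \<Rightarrow> (complex \<Rightarrow> complex) set) \<Rightarrow> nat \<Rightarrow> nat \<Rightarrow> (complex \<Rightarrow> complex) set" where
  "level P k d = (if 2 * d < k then (Dz ^^ d) ` modular_forms \<Gamma> (int (k - 2 * d))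
     else if 2 * d = k then P d else {0})"

text \<open>
  Taking the top coefficient is to be a bijection from \<open>P d\<close> onto the top coefficients that occur in weight \<open>2d\<close> and depth \<open>d\<close>.
\<close>

definition half_weight_family :: "(nat \<Rightarrow> (complex \<Rightarrow> complex) set) \<Rightarrow> bool" where
  "half_weight_family P \<longleftrightarrow> (\<forall>d. cfun.subspace (P d) \<and> P d \<subseteq> QMd (2 * int d) d \<and>
     (\<forall>u\<in>P d. qcoeff (2 * int d) u d = 0 \<longrightarrow> u = 0) \<and>
     (\<forall>f\<in>QMd (2 * int d) d. \<exists>u\<in>P d. qcoeff (2 * int d) u d = qcoeff (2 * int d) f d))"

lemma subspace_Dz_pow_modular: "cfun.subspace ((Dz ^^ d) ` modular_forms \<Gamma> m)"
  unfolding cfun.subspace_def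
proof (intro conjI ballI allI)
  note s = subspace_modular_forms[of m]
  show "0 \<in> (Dz ^^ d) ` modular_forms \<Gamma> m"
    using cfun.subspace_0[OF s] by (metis Dz_pow_0 imageI)
  fix x assume "x \<in> (Dz ^^ d) ` modular_forms \<Gamma> m"
  then obtain f where f: "f \<in> modular_forms \<Gamma> m" "x = (Dz ^^ d) f" by auto
  { fix y assume "y \<in> (Dz ^^ d) ` modular_forms \<Gamma> m"
    then obtain g where g: "g \<in> modular_forms \<Gamma> m" "y = (Dz ^^ d) g" by auto
    have "x + y = (Dz ^^ d) (f + g)" using f g by (simp add: Dz_pow_add modular_forms_mod_hol)
    thus "x + y \<in> (Dz ^^ d) ` modular_forms \<Gamma> m" using cfun.subspace_add[OF s f(1) g(1)] by blast }
  fix c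
  have "fscale c x = (Dz ^^ d) (fscale c f)" using f by (simp add: Dz_pow_fscale modular_forms_mod_hol)
  thus "fscale c x \<in> (Dz ^^ d) ` modular_forms \<Gamma> m" using cfun.subspace_scale[OF s f(1)] by blast
qed

context
  fixes P assumes P: "half_weight_family P"
begin

lemma P_props:
  "cfun.subspace (P d)" "u \<in> P d \<Longrightarrow> u \<in> QMd (2 * int d) d"
  "u \<in> P d \<Longrightarrow> qcoeff (2 * int d) u d = 0 \<Longrightarrow> u = 0"
  "f \<in> QMd (2 * int d) d \<Longrightarrow> \<exists>u\<in>P d. qcoeff (2 * int d) u d = qcoeff (2 * int d) f d"
  using P by (auto simp: half_weight_family_def)

lemma subspace_level: "cfun.subspace (level P k d)"
  by (simp add: level_def P_props(1) subspace_Dz_pow_modular subspace_zero)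

lemma Dz_pow_modular:
  assumes g: "g \<in> modular_forms \<Gamma> (int (k - 2 * d))" and kd: "2 * d < k"
  shows "(Dz ^^ d) g \<in> QMd (int k) d"
    and "qcoeff (int k) ((Dz ^^ d) g) d = fscale (\<Prod>r<d. of_int (int (k - 2 * d) + int r)) g"
proof -
  let ?m = "int (k - 2 * d)"
  have g0: "g \<in> QMd ?m 0" using g by (simp only: modular_forms_eq_depth_0)
  have k: "?m + 2 * int d = int k" using kd by simp
  show "(Dz ^^ d) g \<in> QMd (int k) d"
    and "qcoeff (int k) ((Dz ^^ d) g) d = fscale (\<Prod>r<d. of_int (?m + int r)) g"
    using Dz_pow_QMd[OF g0, of d] coeffs_0[OF QMd_subset_QM[OF g0]] unfolding k by simp_all
qed

lemma factor_nonzero: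
  assumes "2 * d < k" shows "(\<Prod>r<d. of_int (int (k - 2 * d) + int r) :: complex) \<noteq> 0"
proof -
  have "int (k - 2 * d) + int r \<noteq> 0" for r using assms by linarith
  hence "(of_int (int (k - 2 * d) + int r) :: complex) \<noteq> 0" for r by (simp only: of_int_eq_0_iff not_False_eq_True)
  thus ?thesis by (simp only: prod_zero_iff finite_lessThan) blast
qed

lemma level_QMd:
  assumes "u \<in> level P k d" shows "u \<in> QMd (int k) d"
  using assms Dz_pow_modular(1) P_props(2) QMd_0 by (auto simp: level_def split: if_splits)

lemma level_coeff_eq_0:
  assumes u: "u \<in> level P k d" "qcoeff (int k) u d = 0" shows "u = 0"
proof -
  consider "2 * d < k" | "2 * d = k" | "k < 2 * d" by linarith
  thus ?thesis
  proof cases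
    case 1
    then obtain g where g: "g \<in> modular_forms \<Gamma> (int (k - 2 * d))" "u = (Dz ^^ d) g"
      using u(1) by (auto simp: level_def)
    have "g = 0"
      using u(2) Dz_pow_modular(2)[OF g(1) 1] factor_nonzero[OF 1] unfolding g(2) by (simp only: fscale_eq_0_iff) blast
    thus ?thesis using g(2) by simp
  next
    case 2
    thus ?thesis using u P_props(3)[of u d] by (auto simp: level_def)
  next
    case 3
    thus ?thesis using u by (simp add: level_def)
  qed
qed

lemma level_coeff_surj:
  assumes f: "f \<in> QMd (int k) d" shows "\<exists>u\<in>level P k d. qcoeff (int k) u d = qcoeff (int k) f d"
proof -
  consider "2 * d < k" | "2 * d = k" | "k < 2 * d" by linarith
  thus ?thesis
  proof cases
    case 1
    define c :: complex where "c = (\<Prod>r<d. of_int (int (k - 2 * d) + int r))"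
    have c: "c \<noteq> 0" unfolding c_def by (rule factor_nonzero[OF 1])
    have e: "int (k - 2 * d) = int k - 2 * int d" using 1 by simp
    have "qcoeff (int k) f d \<in> modular_forms \<Gamma> (int (k - 2 * d))"
      unfolding e by (rule top_coeff_modular[OF f])
    hence g: "fscale (1 / c) (qcoeff (int k) f d) \<in> modular_forms \<Gamma> (int (k - 2 * d))"
      by (rule modular_forms_scale)
    have "qcoeff (int k) ((Dz ^^ d) (fscale (1 / c) (qcoeff (int k) f d))) d = qcoeff (int k) f d"
      unfolding Dz_pow_modular(2)[OF g 1] c_def[symmetric] using c by (simp add: fscale_fscale)
    moreover have "(Dz ^^ d) (fscale (1 / c) (qcoeff (int k) f d)) \<in> level P k d"
      using g 1 unfolding level_def by (simp only: if_True) (rule imageI)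
    ultimately show ?thesis by blast
  next
    case 2
    thus ?thesis using P_props(4)[of f d] f by (auto simp: level_def)
  next
    case 3
    hence "qcoeff (int k) f d = 0" by (intro coeffs_above_half_weight QMd_subset_QM[OF f]) auto
    thus ?thesis using 3 by (auto simp: level_def coeffs_of_0)
  qed
qed

lemma decompose:
  assumes "f \<in> QMd (int k) p"
  shows "\<exists>u. (\<forall>d. u d \<in> level P k d) \<and> (\<forall>d>p. u d = 0) \<and> f = (\<Sum>d\<le>p. u d)"
  using assms
proof (induction p arbitrary: f)
  case 0
  obtain v where v: "v \<in> level P k 0" "qcoeff (int k) v 0 = qcoeff (int k) f 0"
    using level_coeff_surj[OF 0] by blast
  have "v = f" using v(2) coeffs_0 QMd_subset_QM[OF 0] QMd_subset_QM[OF level_QMd[OF v(1)]] by metis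
  define u where "u d = (if d = 0 then v else 0)" for d :: nat
  have "u d \<in> level P k d" for d
    using v(1) cfun.subspace_0[OF subspace_level] by (simp add: u_def)
  moreover have "f = (\<Sum>d\<le>0. u d)" using \<open>v = f\<close> by (simp add: u_def)
  ultimately show ?case by (intro exI[of _ u]) (auto simp: u_def)
next
  case (Suc p)
  obtain v where v: "v \<in> level P k (Suc p)" "qcoeff (int k) v (Suc p) = qcoeff (int k) f (Suc p)"
    using level_coeff_surj[OF Suc.prems] by blast
  note d = QMd_diff[OF Suc.prems level_QMd[OF v(1)]]
  have "f - v \<in> QMd (int k) p"
  proof (rule QM_depthI[OF QMd_subset_QM[OF d(1)]])
    fix j assume "p < j"
    thus "qcoeff (int k) (f - v) j = 0"
      using d(2)[of j] v(2) coeffs_above_depth[OF d(1), of j] by (cases "j = Suc p") auto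
  qed
  then obtain u where u: "\<forall>d. u d \<in> level P k d" "\<forall>d>p. u d = 0" "f - v = (\<Sum>d\<le>p. u d)"
    using Suc.IH by blast
  define u' where "u' = u(Suc p := v)"
  have "f = (\<Sum>d\<le>Suc p. u' d)"
  proof -
    have "(\<Sum>d\<le>p. u' d) = (\<Sum>d\<le>p. u d)" by (rule sum.cong) (auto simp: u'_def)
    thus ?thesis using u(3) by (simp add: u'_def algebra_simps)
  qed
  thus ?case using u v by (intro exI[of _ u']) (auto simp: u'_def)
qed

lemma sum_QMd:
  assumes "\<And>d. d \<in> S \<Longrightarrow> u d \<in> QMd k p" "finite S"
  shows "(\<Sum>d\<in>S. u d) \<in> QMd k p \<and> qcoeff k (\<Sum>d\<in>S. u d) j = (\<Sum>d\<in>S. qcoeff k (u d) j)"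
  using assms(2,1) by (induction S rule: finite_induct) (auto simp: QMd_0 coeffs_of_0 QMd_add(1) QMd_add(2)[of _ k p])

text \<open>
  The summand of the largest depth alone determines the coefficient in that depth of the sum.
\<close>

lemma decompose_unique:
  assumes "\<And>d. d \<le> n \<Longrightarrow> u d \<in> level P k d" "(\<Sum>d\<le>n. u d) = 0" "d \<le> n"
  shows "u d = 0"
  using assms
proof (induction n arbitrary: d)
  case 0
  thus ?case by simp
next
  case (Suc n)
  have mem: "u d \<in> QMd (int k) (Suc n)" if "d \<in> {..Suc n}" for d
    using level_QMd[OF Suc.prems(1)] that QMd_mono by (metis atMost_iff)
  have "(\<Sum>d\<le>Suc n. qcoeff (int k) (u d) (Suc n)) = qcoeff (int k) (\<Sum>d\<le>Suc n. u d) (Suc n)"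
    using sum_QMd[of "{..Suc n}" u "int k" "Suc n" "Suc n"] mem by simp
  also have "\<dots> = 0" by (simp only: Suc.prems(2) coeffs_of_0)
  also have "(\<Sum>d\<le>Suc n. qcoeff (int k) (u d) (Suc n)) = qcoeff (int k) (u (Suc n)) (Suc n)"
  proof -
    have "qcoeff (int k) (u d) (Suc n) = 0" if "d \<le> n" for d
      using coeffs_above_depth[OF level_QMd[OF Suc.prems(1)], of d "Suc n"] that by simp
    thus ?thesis by simp
  qed
  finally have top: "u (Suc n) = 0" by (intro level_coeff_eq_0[OF Suc.prems(1)[of "Suc n"]]) auto
  show ?case
  proof (cases "d = Suc n")
    case False
    thus ?thesis using Suc.IH[of d] Suc.prems top by simp
  qed (simp add: top)
qed

end

end

section \<open>Internal direct sums\<close>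

context vector_space
begin

lemma sum_support:
  assumes "finite S" "{i. w i \<noteq> 0} \<subseteq> S"
  shows "(\<Sum>i | w i \<noteq> 0. w i) = (\<Sum>i\<in>S. w i)"
  using assms by (intro sum.mono_neutral_left) auto

lemma internal_direct_sumI:
  assumes V: "subspace V" and W: "\<And>i. subspace (W i)" "\<And>i. W i \<subseteq> V"
    and ex: "\<And>v. v \<in> V \<Longrightarrow> \<exists>w S. (\<forall>i. w i \<in> W i) \<and> finite S \<and> {i. w i \<noteq> 0} \<subseteq> S \<and> v = (\<Sum>i\<in>S. w i)"
    and indep: "\<And>w S i. (\<And>i. w i \<in> W i) \<Longrightarrow> finite S \<Longrightarrow> {i. w i \<noteq> 0} \<subseteq> S \<Longrightarrow> (\<Sum>i\<in>S. w i) = 0 \<Longrightarrow> w i = 0"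
  shows "internal_direct_sum V W"
  unfolding internal_direct_sum_def
proof (intro conjI allI ballI)
  fix v assume "v \<in> V"
  then obtain w S where w: "\<forall>i. w i \<in> W i" "finite S" "{i. w i \<noteq> 0} \<subseteq> S" "v = (\<Sum>i\<in>S. w i)"
    using ex by blast
  show "\<exists>!w. (\<forall>i. w i \<in> W i) \<and> finite {i. w i \<noteq> 0} \<and> v = (\<Sum>i | w i \<noteq> 0. w i)"
  proof (rule ex1I[of _ w])
    show "(\<forall>i. w i \<in> W i) \<and> finite {i. w i \<noteq> 0} \<and> v = (\<Sum>i | w i \<noteq> 0. w i)"
      using w sum_support[OF w(2,3)] finite_subset by auto
  next
    fix u assume u: "(\<forall>i. u i \<in> W i) \<and> finite {i. u i \<noteq> 0} \<and> v = (\<Sum>i | u i \<noteq> 0. u i)"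
    define T where "T = S \<union> {i. u i \<noteq> 0}"
    have T: "finite T" using w(2) u by (simp add: T_def)
    have "(\<Sum>i\<in>T. u i - w i) = (\<Sum>i\<in>T. u i) - (\<Sum>i\<in>T. w i)" by (rule sum_subtractf)
    also have "(\<Sum>i\<in>T. u i) = v" using u sum_support[OF T, of u] by (simp add: T_def)
    also have "(\<Sum>i\<in>T. w i) = v"
    proof -
      have "{i. w i \<noteq> 0} \<subseteq> T" using w(3) by (auto simp: T_def)
      thus ?thesis using w(4) sum_support[OF w(2,3)] sum_support[OF T, of w] by simp
    qed
    finally have "(\<Sum>i\<in>T. u i - w i) = 0" by simp
    moreover have "{i. u i - w i \<noteq> 0} \<subseteq> T" using w(3) by (auto simp: T_def)
    ultimately have "u i - w i = 0" for i
      using indep[of "\<lambda>i. u i - w i" T i] T u w(1) subspace_diff[OF W(1)] by blast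
    thus "u = w" by (auto simp: fun_eq_iff)
  qed
qed (use V W in auto)

text \<open>
  Trivial summands may be dropped. This allows both cases of the theorem to be treated with one index set.
\<close>

lemma internal_direct_sum_reindex:
  assumes D: "internal_direct_sum V W" and inj: "inj h" and triv: "\<And>i. i \<notin> range h \<Longrightarrow> W i = {0}"
  shows "internal_direct_sum V (\<lambda>i. W (h i))"
proof (rule internal_direct_sumI)
  show "subspace V" and W: "\<And>i. subspace (W (h i))" and "\<And>i. W (h i) \<subseteq> V"
    using D by (auto simp: internal_direct_sum_def)
  fix v assume "v \<in> V"
  then obtain w where w: "\<forall>i. w i \<in> W i" "finite {i. w i \<noteq> 0}" "v = (\<Sum>i | w i \<noteq> 0. w i)"
    using D unfolding internal_direct_sum_def by blast
  have r: "{i. w i \<noteq> 0} \<subseteq> range h" using w(1) triv by blast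
  define S where "S = h -` {i. w i \<noteq> 0}"
  have S: "{i. w i \<noteq> 0} = h ` S" using r by (auto simp: S_def)
  have "finite S" unfolding S_def using w(2) inj by (rule finite_vimageI)
  moreover have "v = (\<Sum>i\<in>S. w (h i))"
    unfolding w(3) S using inj by (subst sum.reindex) (auto intro: inj_on_subset)
  ultimately show "\<exists>w S. (\<forall>i. w i \<in> W (h i)) \<and> finite S \<and> {i. w i \<noteq> 0} \<subseteq> S \<and> v = (\<Sum>i\<in>S. w i)"
    using w(1) by (intro exI[of _ "\<lambda>i. w (h i)"] exI[of _ S]) (auto simp: S_def)
next
  fix w S i
  assume w: "\<And>i. w i \<in> W (h i)" and S: "finite S" "{i. w i \<noteq> 0} \<subseteq> S" and sum: "(\<Sum>i\<in>S. w i) = 0"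
  have sub: "\<And>i. subspace (W i)" and V: "subspace V" using D by (auto simp: internal_direct_sum_def)
  define u where "u j = (if j \<in> range h then w (the_inv h j) else 0)" for j
  have uh: "u (h i) = w i" for i by (simp add: u_def the_inv_f_f[OF inj])
  have u: "u j \<in> W j" for j
  proof (cases "j \<in> range h")
    case True
    thus ?thesis using w uh by auto
  next
    case False
    thus ?thesis using subspace_0[OF sub] by (simp add: u_def)
  qed
  have supp: "{j. u j \<noteq> 0} \<subseteq> h ` S"
  proof
    fix j assume j: "j \<in> {j. u j \<noteq> 0}"
    then obtain i where "j = h i" by (auto simp: u_def split: if_splits)
    thus "j \<in> h ` S" using j uh S(2) by auto
  qed
  have "(\<Sum>j | u j \<noteq> 0. u j) = (\<Sum>j\<in>h ` S. u j)" using sum_support[OF _ supp] S(1) by simp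
  also have "\<dots> = (\<Sum>i\<in>S. w i)"
    using inj by (subst sum.reindex) (auto intro: inj_on_subset simp: uh)
  finally have s0: "0 = (\<Sum>j | u j \<noteq> 0. u j)" using sum by simp
  have fin: "finite {j. u j \<noteq> 0}" using supp S(1) finite_subset by blast
  define Q where "Q w \<longleftrightarrow> (\<forall>i. w i \<in> W i) \<and> finite {i. w i \<noteq> 0} \<and> 0 = (\<Sum>i | w i \<noteq> 0. w i)" for w
  have "\<exists>!w. Q w"
    using D subspace_0[OF V] unfolding internal_direct_sum_def Q_def by (elim conjE) (rule bspec)
  moreover have "Q (\<lambda>_. 0)" using subspace_0[OF sub] by (simp add: Q_def)
  moreover have "Q u" unfolding Q_def using u fin s0 by (intro conjI allI)
  ultimately have "u = (\<lambda>_. 0)" by metis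
  thus "w i = 0" using uh[of i] by simp
qed

end

section \<open>Graded families\<close>

lemma sum_fun_apply: "(\<Sum>i\<in>S. w i) x = (\<Sum>i\<in>S. w i x)" for w :: "'i \<Rightarrow> 'a \<Rightarrow> 'b::comm_monoid_add"
  by (induction S rule: infinite_finite_induct) auto

lemma graded_sumD: "F \<in> graded_sum W \<Longrightarrow> F k \<in> W k" "F \<in> graded_sum W \<Longrightarrow> finite {k. F k \<noteq> 0}"
  by (auto simp: graded_sum_def)

lemma subspace_graded_sum:
  assumes "\<And>k. cfun.subspace (W k)" shows "cgr.subspace (graded_sum W)"
  unfolding cgr.subspace_def
proof (intro conjI ballI allI)
  show "0 \<in> graded_sum W" using cfun.subspace_0[OF assms] by (simp add: graded_sum_def)
  fix F assume F: "F \<in> graded_sum W"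
  { fix H assume H: "H \<in> graded_sum W"
    have "{k. (F + H) k \<noteq> 0} \<subseteq> {k. F k \<noteq> 0} \<union> {k. H k \<noteq> 0}" by auto
    hence "finite {k. (F + H) k \<noteq> 0}"
      using finite_subset[OF _ finite_UnI[OF graded_sumD(2)[OF F] graded_sumD(2)[OF H]]] by blast
    moreover have "(F + H) k \<in> W k" for k
      using cfun.subspace_add[OF assms graded_sumD(1)[OF F] graded_sumD(1)[OF H]] by simp
    ultimately show "F + H \<in> graded_sum W" by (simp add: graded_sum_def) }
  fix c
  have "{k. gscale c F k \<noteq> 0} \<subseteq> {k. F k \<noteq> 0}" by (auto simp: gscale_def)
  hence "finite {k. gscale c F k \<noteq> 0}" using finite_subset[OF _ graded_sumD(2)[OF F]] by blast
  moreover have "gscale c F k \<in> W k" for k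
    using cfun.subspace_scale[OF assms graded_sumD(1)[OF F]] by (simp add: gscale_def)
  ultimately show "gscale c F \<in> graded_sum W" by (simp add: graded_sum_def)
qed

lemma graded_sum_mono: "(\<And>k. W k \<subseteq> W' k) \<Longrightarrow> graded_sum W \<subseteq> graded_sum W'"
  by (auto simp: graded_sum_def)

text \<open>
  A component of weight \<open>n\<close> is regarded as a graded family of subspaces, in order to treat all summands in the same way.
\<close>

lemma homog_image:
  "homog n ` S = graded_sum (\<lambda>k. if k = n then S else {0})"
proof (intro equalityI subsetI)
  fix F assume "F \<in> homog n ` S"
  then obtain f where f: "f \<in> S" "F = homog n f" by auto
  have "{k. F k \<noteq> 0} \<subseteq> {n}" by (auto simp: f homog_def)
  hence "finite {k. F k \<noteq> 0}" using finite_subset by blast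
  thus "F \<in> graded_sum (\<lambda>k. if k = n then S else {0})" using f by (auto simp: graded_sum_def homog_def)
next
  fix F assume F: "F \<in> graded_sum (\<lambda>k. if k = n then S else {0})"
  have n: "F n \<in> S" using graded_sumD(1)[OF F, of n] by simp
  have "F k = homog n (F n) k" for k using graded_sumD(1)[OF F, of k] by (simp add: homog_def split: if_splits)
  hence "F = homog n (F n)" by (simp add: fun_eq_iff)
  thus "F \<in> homog n ` S" using n by (rule image_eqI)
qed

lemma Dgr_pow: "(Dgr ^^ d) F k = (if k < 2 * d then 0 else (Dz ^^ d) (F (k - 2 * d)))"
proof (induction d arbitrary: k)
  case (Suc d)
  show ?case
  proof (cases "k < 2 * Suc d")
    case True
    show ?thesis
    proof (cases "k < 2")
      case False
      hence "k - 2 < 2 * d" using True by simp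
      hence "(Dgr ^^ d) F (k - 2) = 0" by (simp only: Suc.IH if_True)
      moreover have "(Dgr ^^ Suc d) F k = Dz ((Dgr ^^ d) F (k - 2))" using False by (simp add: Dgr_def)
      ultimately show ?thesis using True by (simp only: if_True Dz_0)
    qed (use True in \<open>simp add: Dgr_def\<close>)
  next
    case False
    hence "\<not> k < 2" "\<not> k - 2 < 2 * d" "k - 2 - 2 * d = k - 2 * Suc d" by auto
    thus ?thesis using False Suc.IH[of "k - 2"] by (simp add: Dgr_def)
  qed
qed simp

context fuchsian
begin

text \<open>
  Preimages under \<open>D\<^sup>d\<close> are chosen separately in each weight. They have to be \<open>0\<close> in the weights where the
  given family vanishes, as otherwise their support might be infinite.
\<close>

lemma Dgr_pow_modular_pos:
  "(Dgr ^^ d) ` modular_pos \<Gamma> =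
    graded_sum (\<lambda>k. if 2 * d < k then (Dz ^^ d) ` modular_forms \<Gamma> (int (k - 2 * d)) else {0})" (is "?L = graded_sum ?W")
proof (intro equalityI subsetI)
  fix X assume "X \<in> ?L"
  then obtain F where F: "F \<in> modular_pos \<Gamma>" "X = (Dgr ^^ d) F" by auto
  have Fk: "F k \<in> (if k > 0 then modular_forms \<Gamma> (int k) else {0})" for k
    using graded_sumD(1)[OF F(1)[unfolded modular_pos_def], of k] .
  have finF: "finite {k. F k \<noteq> 0}" using graded_sumD(2)[OF F(1)[unfolded modular_pos_def]] .
  have "{k. X k \<noteq> 0} \<subseteq> (\<lambda>k. k + 2 * d) ` {k. F k \<noteq> 0}"
  proof
    fix k assume "k \<in> {k. X k \<noteq> 0}"
    hence "\<not> k < 2 * d" "F (k - 2 * d) \<noteq> 0" by (auto simp: F(2) Dgr_pow split: if_splits)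
    thus "k \<in> (\<lambda>k. k + 2 * d) ` {k. F k \<noteq> 0}" by (intro image_eqI[of _ _ "k - 2 * d"]) auto
  qed
  hence "finite {k. X k \<noteq> 0}" using finF finite_subset by blast
  moreover have "X k \<in> ?W k" for k
  proof -
    consider "2 * d < k" | "k = 2 * d" | "k < 2 * d" by linarith
    thus ?thesis
    proof cases
      case 1
      thus ?thesis using Fk[of "k - 2 * d"] by (auto simp: F(2) Dgr_pow)
    next
      case 2
      thus ?thesis using Fk[of 0] by (simp add: F(2) Dgr_pow)
    next
      case 3
      thus ?thesis by (simp add: F(2) Dgr_pow)
    qed
  qed
  ultimately show "X \<in> graded_sum ?W" by (simp add: graded_sum_def)
next
  fix X assume X: "X \<in> graded_sum ?W"
  have "\<exists>f. f \<in> (if m > 0 then modular_forms \<Gamma> (int m) else {0}) \<and> X (m + 2 * d) = (Dz ^^ d) f \<and> (X (m + 2 * d) = 0 \<longrightarrow> f = 0)" for m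
  proof (cases "m > 0 \<and> X (m + 2 * d) \<noteq> 0")
    case True
    hence "X (m + 2 * d) \<in> (Dz ^^ d) ` modular_forms \<Gamma> (int m)"
      using graded_sumD(1)[OF X, of "m + 2 * d"] by simp
    thus ?thesis using True by auto
  next
    case False
    have "X (m + 2 * d) = 0" using False graded_sumD(1)[OF X, of "m + 2 * d"] by (cases "m = 0") auto
    moreover have "0 \<in> (if m > 0 then modular_forms \<Gamma> (int m) else {0})"
      using cfun.subspace_0[OF subspace_modular_forms] by simp
    ultimately show ?thesis by (intro exI[of _ 0]) (simp only: Dz_pow_0 simp_thms)
  qed
  then obtain F where F: "\<And>m. F m \<in> (if m > 0 then modular_forms \<Gamma> (int m) else {0})"
    "\<And>m. X (m + 2 * d) = (Dz ^^ d) (F m)" "\<And>m. X (m + 2 * d) = 0 \<Longrightarrow> F m = 0" by metis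
  have "{m. F m \<noteq> 0} \<subseteq> (\<lambda>m. m + 2 * d) -` {k. X k \<noteq> 0}" using F(3) by auto
  moreover have "finite ((\<lambda>m. m + 2 * d) -` {k. X k \<noteq> 0})"
    by (rule finite_vimageI[OF graded_sumD(2)[OF X]]) (simp add: inj_on_def)
  ultimately have "finite {m. F m \<noteq> 0}" using finite_subset by blast
  hence "F \<in> modular_pos \<Gamma>" using F(1) by (simp add: modular_pos_def graded_sum_def)
  moreover have "X k = (Dgr ^^ d) F k" for k
  proof (cases "k < 2 * d")
    case True
    thus ?thesis using graded_sumD(1)[OF X, of k] by (simp add: Dgr_pow)
  next
    case False
    thus ?thesis using F(2)[of "k - 2 * d"] by (simp add: Dgr_pow)
  qed
  hence "X = (Dgr ^^ d) F" by (simp add: fun_eq_iff)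
  ultimately show "X \<in> ?L" by blast
qed

text \<open>
  The index \<open>Inl d\<close> stands for \<open>D\<^sup>d(I)\<close>, and \<open>Inr d\<close> for the contribution of weight \<open>2d\<close> and depth \<open>d\<close>. In a fixed weight \<open>k\<close> the indices
  \<open>Inl d\<close> with \<open>d < k/2\<close> and \<open>Inr (k/2)\<close> give exactly the levels.
\<close>

definition summands :: "(nat \<Rightarrow> (complex \<Rightarrow> complex) set) \<Rightarrow> nat + nat \<Rightarrow> (nat \<Rightarrow> complex \<Rightarrow> complex) set" where
  "summands P s = (case s of Inl d \<Rightarrow> (Dgr ^^ d) ` modular_pos \<Gamma> | Inr d \<Rightarrow> homog (2 * d) ` P d)"

lemma summands_Inl: "summands P (Inl d) = graded_sum (\<lambda>k. if 2 * d < k then level P k d else {0})"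
  unfolding summands_def sum.case Dgr_pow_modular_pos by (rule arg_cong[of _ _ graded_sum]) (auto simp: level_def fun_eq_iff)

lemma summands_Inr: "summands P (Inr d) = graded_sum (\<lambda>k. if k = 2 * d then level P k d else {0})"
  unfolding summands_def sum.case homog_image by (rule arg_cong[of _ _ graded_sum]) (auto simp: level_def fun_eq_iff)

theorem summands_direct_sum:
  assumes P: "half_weight_family P"
  shows "cgr.internal_direct_sum (quasimodular_ring \<Gamma>) (summands P)"
proof (rule cgr.internal_direct_sumI)
  show "cgr.subspace (quasimodular_ring \<Gamma>)"
    unfolding quasimodular_ring_def by (rule subspace_graded_sum[OF subspace_QM])
  show "cgr.subspace (summands P s)" for s
    by (cases s) (auto simp: summands_Inl summands_Inr subspace_zero
        intro!: subspace_graded_sum subspace_level[OF P])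
  have lev: "level P k d \<subseteq> QM (int k)" for k d
    using level_QMd[OF P] QMd_subset_QM by blast
  have zero: "{0} \<subseteq> QM (int k)" for k using cfun.subspace_0[OF subspace_QM] by blast
  show "summands P s \<subseteq> quasimodular_ring \<Gamma>" for s
  proof (cases s)
    case (Inl d)
    show ?thesis unfolding Inl summands_Inl quasimodular_ring_def
      by (rule graded_sum_mono) (simp only: lev zero simp_thms split: if_split)
  next
    case (Inr d)
    show ?thesis unfolding Inr summands_Inr quasimodular_ring_def
      by (rule graded_sum_mono) (simp only: lev zero simp_thms split: if_split)
  qed
next
  fix F assume "F \<in> quasimodular_ring \<Gamma>"
  hence F: "F \<in> graded_sum (\<lambda>k. QM (int k))" by (simp add: quasimodular_ring_def)
  have "\<exists>u. (\<forall>d. u d \<in> level P k d) \<and> (\<forall>d>k. u d = 0) \<and> F k = (\<Sum>d\<le>k. u d) \<and> (F k = 0 \<longrightarrow> u = (\<lambda>_. 0))" for k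
  proof (cases "F k = 0")
    case True
    thus ?thesis using cfun.subspace_0[OF subspace_level[OF P]] by (intro exI[of _ "\<lambda>_. 0"]) auto
  next
    case False
    have "F k \<in> QMd (int k) k" using graded_sumD(1)[OF F, of k] by (rule QM_half_weight) simp
    from decompose[OF P this] False show ?thesis by blast
  qed
  then obtain u where u: "\<And>k d. u k d \<in> level P k d" "\<And>k d. d > k \<Longrightarrow> u k d = 0"
    "\<And>k. F k = (\<Sum>d\<le>k. u k d)" "\<And>k. F k = 0 \<Longrightarrow> u k = (\<lambda>_. 0)" by metis
  have u0: "u k d = 0" if "k < 2 * d" for k d using u(1)[of k d] that by (simp add: level_def)
  define w :: "nat + nat \<Rightarrow> nat \<Rightarrow> complex \<Rightarrow> complex" where
    "w s = (case s of Inl d \<Rightarrow> (\<lambda>k. if 2 * d < k then u k d else 0) | Inr d \<Rightarrow> (\<lambda>k. if k = 2 * d then u k d else 0))" for s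
  have fin: "finite {k. w s k \<noteq> 0}" for s
  proof -
    have "{k. w s k \<noteq> 0} \<subseteq> {k. F k \<noteq> 0}"
      using u(4) by (cases s) (auto simp: w_def split: if_splits)
    thus ?thesis using graded_sumD(2)[OF F] finite_subset by blast
  qed
  have w: "w s \<in> summands P s" for s
    using fin[of s] u(1) by (cases s) (auto simp: summands_Inl summands_Inr graded_sum_def w_def)
  obtain n where n: "\<And>k. F k \<noteq> 0 \<Longrightarrow> k \<le> n"
    using graded_sumD(2)[OF F] by (metis (mono_tags, lifting) finite_nat_set_iff_bounded_le mem_Collect_eq)
  define S :: "(nat + nat) set" where "S = Inl ` {..n} \<union> Inr ` {..n}"
  have S: "finite S" by (simp add: S_def)
  have supp: "{s. w s \<noteq> 0} \<subseteq> S"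
  proof
    fix s assume "s \<in> {s. w s \<noteq> 0}"
    then obtain k where k: "w s k \<noteq> 0" by (auto simp: fun_eq_iff)
    then obtain d where d: "s = Inl d \<or> s = Inr d" "u k d \<noteq> 0"
      by (cases s) (auto simp: w_def split: if_splits)
    have "k \<le> n" using n u(4) d(2) by metis
    moreover have "d \<le> k" using u(2) d(2) not_less by metis
    ultimately show "s \<in> S" using d(1) by (auto simp: S_def)
  qed
  have "F k = (\<Sum>s\<in>S. w s k)" for k
  proof -
    have "(\<Sum>s\<in>S. w s k) = (\<Sum>d\<le>n. w (Inl d) k) + (\<Sum>d\<le>n. w (Inr d) k)"
      unfolding S_def by (subst sum.union_disjoint) (auto simp: sum.reindex)
    also have "\<dots> = (\<Sum>d\<le>n. u k d)"
      unfolding sum.distrib[symmetric] by (rule sum.cong) (use u0 in \<open>auto simp: w_def not_less\<close>)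
    also have "\<dots> = F k"
    proof (cases "k \<le> n")
      case True
      hence "(\<Sum>d\<le>n. u k d) = (\<Sum>d\<le>k. u k d)" using u(2) by (intro sum.mono_neutral_right) auto
      thus ?thesis using u(3) by simp
    next
      case False
      hence "F k = 0" using n by blast
      thus ?thesis using u(4)[of k] by (simp only: sum.neutral_const)
    qed
    finally show ?thesis by simp
  qed
  hence "F = (\<Sum>s\<in>S. w s)" by (simp add: fun_eq_iff[of F] sum_fun_apply[of w S])
  thus "\<exists>w S. (\<forall>s. w s \<in> summands P s) \<and> finite S \<and> {s. w s \<noteq> 0} \<subseteq> S \<and> F = (\<Sum>s\<in>S. w s)"
    using w S supp by blast
next
  fix w :: "nat + nat \<Rightarrow> nat \<Rightarrow> complex \<Rightarrow> complex" and S s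
  assume w: "\<And>s. w s \<in> summands P s" and S: "finite S" "{s. w s \<noteq> 0} \<subseteq> S" and sum: "(\<Sum>s\<in>S. w s) = 0"
  have wl: "w (Inl d) k \<in> (if 2 * d < k then level P k d else {0})" for d k
    using w[of "Inl d"] graded_sumD(1) unfolding summands_Inl by blast
  have wr: "w (Inr d) k \<in> (if k = 2 * d then level P k d else {0})" for d k
    using w[of "Inr d"] graded_sumD(1) unfolding summands_Inr by blast
  have "finite (Inl -` S \<union> Inr -` S)" using S(1) by (intro finite_UnI finite_vimageI) auto
  then obtain n where n: "\<And>d. d \<in> Inl -` S \<union> Inr -` S \<Longrightarrow> d \<le> n"
    by (metis finite_nat_set_iff_bounded_le)
  define T :: "(nat + nat) set" where "T = Inl ` {..n} \<union> Inr ` {..n}"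
  have ST: "S \<subseteq> T"
  proof
    fix s assume "s \<in> S"
    thus "s \<in> T" using n by (cases s) (auto simp: T_def)
  qed
  have T: "finite T" by (simp add: T_def)
  have "(\<Sum>s\<in>T. w s) = (\<Sum>s\<in>S. w s)" using S(2) ST T by (intro sum.mono_neutral_right) auto
  hence sumT: "(\<Sum>s\<in>T. w s k) = 0" for k using sum sum_fun_apply[of w T k] by simp
  have *: "w (Inl d) k = 0 \<and> w (Inr d) k = 0" if "d \<le> n" for d k
  proof -
    define v where "v d = w (Inl d) k + w (Inr d) k" for d
    have v: "v d \<in> level P k d" for d
      using wl[of d k] wr[of d k] cfun.subspace_0[OF subspace_level[OF P]]
      by (auto simp: v_def split: if_splits)
    have "(\<Sum>s\<in>T. w s k) = (\<Sum>d\<le>n. w (Inl d) k) + (\<Sum>d\<le>n. w (Inr d) k)"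
      unfolding T_def by (subst sum.union_disjoint) (auto simp: sum.reindex)
    hence "(\<Sum>d\<le>n. v d) = 0" using sumT[of k] by (simp only: v_def sum.distrib)
    hence "v d = 0" using decompose_unique[OF P, of n v k d] v that by blast
    moreover have "w (Inl d) k = 0 \<or> w (Inr d) k = 0"
      using wl[of d k] wr[of d k] by (cases "2 * d < k") auto
    ultimately show ?thesis unfolding v_def by auto
  qed
  show "w s = 0"
  proof (cases "s \<in> T")
    case True
    thus ?thesis using * by (auto simp: T_def fun_eq_iff[of "w _"])
  next
    case False
    thus ?thesis using S(2) ST by blast
  qed
qed

section \<open>Weight 2 and the two cases of the decomposition\<close>

lemma delta_eq: "delta \<Gamma> k f = qcoeff k f 1"
  by (simp add: delta_def)

lemma delta_weight_2:
  assumes "f \<in> QM 2" obtains c where "delta \<Gamma> 2 f = const_hfun c"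
  using top_coeff_half_weight[of f 1] QM_half_weight[OF assms, of 1] by (auto simp: delta_eq)

lemma delta_add: "f \<in> QM k \<Longrightarrow> g \<in> QM k \<Longrightarrow> delta \<Gamma> k (f + g) = delta \<Gamma> k f + delta \<Gamma> k g"
  by (simp add: delta_eq QM_add(2))

lemma delta_fscale: "f \<in> QM k \<Longrightarrow> delta \<Gamma> k (fscale c f) = fscale c (delta \<Gamma> k f)"
  by (simp add: delta_eq QM_fscale(2))

lemma modular_iff_delta_eq_0: "f \<in> modular_forms \<Gamma> 2 \<longleftrightarrow> f \<in> QM 2 \<and> delta \<Gamma> 2 f = 0"
proof
  assume "f \<in> modular_forms \<Gamma> 2"
  hence "f \<in> QMd 2 0" by (simp add: modular_forms_eq_depth_0)
  thus "f \<in> QM 2 \<and> delta \<Gamma> 2 f = 0"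
    using QMd_subset_QM coeffs_above_depth[of f 2 0 1] by (simp add: delta_eq)
next
  assume f: "f \<in> QM 2 \<and> delta \<Gamma> 2 f = 0"
  have "f \<in> QMd 2 0"
  proof (rule QM_depthI)
    fix j :: nat assume "0 < j"
    show "qcoeff 2 f j = 0"
    proof (cases "j = 1")
      case False
      thus ?thesis using f \<open>0 < j\<close> by (intro coeffs_above_half_weight) auto
    qed (use f in \<open>simp add: delta_eq\<close>)
  qed (use f in simp)
  thus "f \<in> modular_forms \<Gamma> 2" by (simp add: modular_forms_eq_depth_0)
qed

lemma subspace_consts: "cfun.subspace (range const_hfun)"
  using subspace_QM[of 0] by (simp add: QM_0)

text \<open>
  In weight \<open>0\<close> the constants are the only forms, and the top coefficient of a constant is the constant itself.
\<close>

lemma const_family: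
  shows "cfun.subspace (range const_hfun)" "range const_hfun \<subseteq> QMd (2 * int 0) 0"
    "u \<in> range const_hfun \<Longrightarrow> qcoeff (2 * int 0) u 0 = 0 \<Longrightarrow> u = 0"
    "f \<in> QMd (2 * int 0) 0 \<Longrightarrow> \<exists>u\<in>range const_hfun. qcoeff (2 * int 0) u 0 = qcoeff (2 * int 0) f 0"
proof -
  show "cfun.subspace (range const_hfun)" by (rule subspace_consts)
  show "range const_hfun \<subseteq> QMd (2 * int 0) 0" using const_hfun_QMd by auto
  show "u = 0" if "u \<in> range const_hfun" "qcoeff (2 * int 0) u 0 = 0"
    using that coeffs_0[of u 0] by (simp add: QM_0)
  show "\<exists>u\<in>range const_hfun. qcoeff (2 * int 0) u 0 = qcoeff (2 * int 0) f 0" if f: "f \<in> QMd (2 * int 0) 0"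
  proof -
    have "f \<in> range const_hfun" using QMd_subset_QM[OF f] by (simp add: QM_0)
    thus ?thesis by (intro bexI[of _ f]) auto
  qed
qed

text \<open>
  The form \<open>D\<^sup>i \<phi>\<close> has weight \<open>2 (i+1)\<close> and depth \<open>i+1\<close>, whence the shift of the index.
\<close>

definition phi_family :: "(complex \<Rightarrow> complex) \<Rightarrow> nat \<Rightarrow> (complex \<Rightarrow> complex) set" where
  "phi_family \<phi> d = (case d of 0 \<Rightarrow> range const_hfun | Suc i \<Rightarrow> range (\<lambda>c. fscale c ((Dz ^^ i) \<phi>)))"

lemma phi_pow:
  assumes \<phi>: "\<phi> \<in> QM 2" "delta \<Gamma> 2 \<phi> = const_hfun 1"
  shows "(Dz ^^ i) \<phi> \<in> QMd (2 * int (Suc i)) (Suc i)"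
    and "qcoeff (2 * int (Suc i)) ((Dz ^^ i) \<phi>) (Suc i) = const_hfun (of_nat (fact i))"
proof -
  have \<phi>1: "\<phi> \<in> QMd 2 1" using QM_half_weight[OF \<phi>(1), of 1] by simp
  have k: "2 * int (Suc i) = 2 + 2 * int i" by simp
  have "(\<Prod>r<i. of_int (2 - int 1 + int r) :: complex) = of_nat (fact i)"
    by (induction i) (auto simp: algebra_simps)
  thus "(Dz ^^ i) \<phi> \<in> QMd (2 * int (Suc i)) (Suc i)"
    "qcoeff (2 * int (Suc i)) ((Dz ^^ i) \<phi>) (Suc i) = const_hfun (of_nat (fact i))"
    using Dz_pow_QMd[OF \<phi>1, of i] \<phi>(2) unfolding k by (auto simp: delta_eq fscale_const_hfun)
qed

lemma half_weight_family_phi: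
  assumes \<phi>: "\<phi> \<in> QM 2" "delta \<Gamma> 2 \<phi> = const_hfun 1"
  shows "half_weight_family (phi_family \<phi>)"
  unfolding half_weight_family_def
proof (intro allI, goal_cases)
  case (1 d)
  show ?case
  proof (cases d)
    case 0
    show ?thesis unfolding 0 phi_family_def nat.case using const_family by blast
  next
    case (Suc i)
    let ?h = "(Dz ^^ i) \<phi>" and ?k = "2 * int (Suc i)"
    note h = phi_pow[OF \<phi>, of i]
    have co: "qcoeff ?k (fscale c ?h) (Suc i) = const_hfun (c * of_nat (fact i))" for c
      by (simp only: QMd_fscale(2)[OF h(1)] h(2) fscale_const_hfun)
    have "cfun.subspace (range (\<lambda>c. fscale c ?h))"
    proof -
      have "fscale a ?h + fscale b ?h = fscale (a + b) ?h" for a b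
        by (simp add: fscale_def fun_eq_iff algebra_simps)
      moreover have "0 = fscale 0 ?h" by (simp add: fscale_def fun_eq_iff)
      ultimately show ?thesis unfolding cfun.subspace_def by (auto simp: fscale_fscale)
    qed
    moreover have "range (\<lambda>c. fscale c ?h) \<subseteq> QMd ?k (Suc i)" using QMd_fscale(1)[OF h(1)] by auto
    moreover have "u = 0" if u: "u \<in> range (\<lambda>c. fscale c ?h)" and "qcoeff ?k u (Suc i) = 0" for u
    proof -
      obtain c where c: "u = fscale c ?h" using u by blast
      have "c = 0" using that(2) unfolding c co const_hfun_eq_0_iff by simp
      thus ?thesis by (simp add: c fscale_def fun_eq_iff)
    qed
    moreover have "\<exists>u\<in>range (\<lambda>c. fscale c ?h). qcoeff ?k u (Suc i) = qcoeff ?k f (Suc i)" if f: "f \<in> QMd ?k (Suc i)" for f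
    proof -
      obtain e where e: "qcoeff ?k f (Suc i) = const_hfun e" by (rule top_coeff_half_weight[OF f])
      have "qcoeff ?k (fscale (e / of_nat (fact i)) ?h) (Suc i) = qcoeff ?k f (Suc i)"
        unfolding co e by simp
      thus ?thesis by blast
    qed
    ultimately show ?thesis unfolding Suc phi_family_def nat.case by blast
  qed
qed

text \<open>
  If \<open>\<delta>\<close> vanishes in weight \<open>2\<close>, there is nothing to remove in depth \<open>d = k/2 > 0\<close>: the coefficient \<open>f\<^sub>d\<^sub>-\<^sub>1\<close> has weight \<open>2\<close>,
  and its image under \<open>\<delta>\<close> is \<open>d f\<^sub>d\<close>.
\<close>

lemma half_weight_family_const:
  assumes "\<And>f. f \<in> QM 2 \<Longrightarrow> delta \<Gamma> 2 f = 0"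
  shows "half_weight_family (\<lambda>d. if d = 0 then range const_hfun else {0})"
  unfolding half_weight_family_def
proof (intro allI, goal_cases)
  case (1 d)
  show ?case
  proof (cases d)
    case 0
    show ?thesis unfolding 0 if_P[OF refl] using const_family by blast
  next
    case (Suc i)
    have "qcoeff (2 * int d) f d = 0" if f: "f \<in> QMd (2 * int d) d" for f
    proof -
      let ?g = "qcoeff (2 * int d) f i"
      have k: "2 * int d - 2 * int i = 2" using Suc by simp
      have g: "?g \<in> QM 2" "qcoeff 2 ?g 1 = fscale (of_nat ((1 + i) choose i)) (qcoeff (2 * int d) f (1 + i))"
        using coeffs_QMd[OF f, of i] Suc QMd_subset_QM unfolding k by auto
      have "fscale (of_nat ((1 + i) choose i)) (qcoeff (2 * int d) f (1 + i)) = 0"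
        using assms[OF g(1)] g(2) by (simp only: delta_eq)
      moreover have "(of_nat ((1 + i) choose i) :: complex) \<noteq> 0"
        by (simp only: of_nat_eq_0_iff) simp
      ultimately show ?thesis using Suc by (simp only: fscale_eq_0_iff) simp
    qed
    thus ?thesis using Suc by (auto simp: subspace_zero QMd_0 coeffs_of_0)
  qed
qed

lemma quasimodular_direct_sum_const:
  assumes "\<And>f. f \<in> QM 2 \<Longrightarrow> delta \<Gamma> 2 f = 0"
  shows "cgr.internal_direct_sum (quasimodular_ring \<Gamma>) (modular_summands \<Gamma>)"
proof -
  define P where "P d = (if d = 0 then range const_hfun else {0})" for d :: nat
  define h :: "nat option \<Rightarrow> nat + nat" where "h s = (case s of None \<Rightarrow> Inr 0 | Some d \<Rightarrow> Inl d)" for s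
  have "half_weight_family P" unfolding P_def[abs_def] by (rule half_weight_family_const[OF assms])
  from summands_direct_sum[OF this]
  have "cgr.internal_direct_sum (quasimodular_ring \<Gamma>) (\<lambda>s. summands P (h s))"
  proof (rule cgr.internal_direct_sum_reindex)
    show "inj h" by (rule injI) (auto simp: h_def split: option.splits)
    fix s assume s: "s \<notin> range h"
    have "h None = Inr 0" "\<And>d. h (Some d) = Inl d" by (auto simp: h_def)
    then obtain d where d: "s = Inr d" "d > 0" using s by (cases s) (metis rangeI, metis rangeI gr0I)
    have "homog (2 * d) 0 = 0" by (auto simp: homog_def fun_eq_iff)
    thus "summands P s = {0}" using d by (simp add: summands_def P_def)
  qed
  also have "(\<lambda>s. summands P (h s)) = modular_summands \<Gamma>"
    by (rule ext) (auto simp: summands_def modular_summands_def h_def P_def image_image split: option.splits)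
  finally show ?thesis .
qed

lemma quasimodular_direct_sum_phi:
  assumes \<phi>: "\<phi> \<in> QM 2" "delta \<Gamma> 2 \<phi> = const_hfun 1"
  shows "cgr.internal_direct_sum (quasimodular_ring \<Gamma>) (case_sum (modular_summands \<Gamma>) (phi_summands \<phi>))"
proof -
  define h :: "nat option + nat \<Rightarrow> nat + nat" where
    "h s = (case s of Inl s \<Rightarrow> (case s of None \<Rightarrow> Inr 0 | Some d \<Rightarrow> Inl d) | Inr i \<Rightarrow> Inr (Suc i))" for s
  have h: "h (Inl None) = Inr 0" "\<And>d. h (Inl (Some d)) = Inl d" "\<And>i. h (Inr i) = Inr (Suc i)"
    by (auto simp: h_def)
  from summands_direct_sum[OF half_weight_family_phi[OF \<phi>]]
  have "cgr.internal_direct_sum (quasimodular_ring \<Gamma>) (\<lambda>s. summands (phi_family \<phi>) (h s))"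
  proof (rule cgr.internal_direct_sum_reindex)
    show "inj h" by (rule injI) (auto simp: h_def split: option.splits sum.splits)
    fix s assume "s \<notin> range h"
    hence False using h by (cases s) (metis rangeI, metis rangeI not0_implies_Suc)
    thus "summands (phi_family \<phi>) s = {0}" ..
  qed
  also have "(\<lambda>s. summands (phi_family \<phi>) (h s)) = case_sum (modular_summands \<Gamma>) (phi_summands \<phi>)"
  proof
    fix s
    show "summands (phi_family \<phi>) (h s) = case_sum (modular_summands \<Gamma>) (phi_summands \<phi>) s"
    proof (cases s)
      case (Inl t)
      thus ?thesis
        by (cases t) (simp_all add: h summands_def modular_summands_def phi_family_def image_image)
    next
      case (Inr i)
      have "homog (2 * Suc i) (fscale c ((Dz ^^ i) \<phi>)) = gscale c ((Dgr ^^ i) (homog 2 \<phi>))" for c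
      proof
        fix k
        consider "k = 2 * Suc i" | "k \<noteq> 2 * Suc i" "2 * i \<le> k" | "k < 2 * i" by linarith
        thus "homog (2 * Suc i) (fscale c ((Dz ^^ i) \<phi>)) k = gscale c ((Dgr ^^ i) (homog 2 \<phi>)) k"
        proof cases
          case 1
          thus ?thesis by (simp add: homog_def gscale_def Dgr_pow)
        next
          case 2
          hence "k - 2 * i \<noteq> 2" by auto
          hence "homog 2 \<phi> (k - 2 * i) = 0" by (simp add: homog_def)
          hence "(Dgr ^^ i) (homog 2 \<phi>) k = 0" using 2(2) by (simp only: Dgr_pow Dz_pow_0 if_cancel)
          thus ?thesis using 2(1) by (simp only: homog_def gscale_def fscale_0 if_False)
        next
          case 3
          hence "(Dgr ^^ i) (homog 2 \<phi>) k = 0" "k \<noteq> 2 * Suc i" by (simp_all only: Dgr_pow if_True) simp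
          thus ?thesis by (simp only: homog_def gscale_def fscale_0 if_False)
        qed
      qed
      thus ?thesis by (simp add: Inr h summands_def phi_family_def phi_summands_def image_image)
    qed
  qed
  finally show ?thesis .
qed

lemma exact_sequence:
  "exact_seq
     ([add_group (range const_hfun), add_group (QM 2), add_group (modular_forms \<Gamma> 2), add_group {0}],
      [delta \<Gamma> 2, (\<lambda>f. f), (\<lambda>_. 0)])"
proof -
  have grp: "group (add_group V)" if V: "cfun.subspace V" for V
  proof (rule groupI)
    fix x assume "x \<in> carrier (add_group V)"
    hence "- x \<in> V" using cfun.subspace_neg[OF V] by (simp add: add_group_def)
    thus "\<exists>y\<in>carrier (add_group V). y \<otimes>\<^bsub>add_group V\<^esub> x = \<one>\<^bsub>add_group V\<^esub>"
      by (intro bexI[of _ "- x"]) (simp_all add: add_group_def)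
  qed (use cfun.subspace_0[OF V] cfun.subspace_add[OF V] in \<open>auto simp: add_group_def add.assoc\<close>)
  have M: "group (add_group (modular_forms \<Gamma> 2))" by (rule grp[OF subspace_modular_forms])
  have 1: "exact_seq ([add_group (modular_forms \<Gamma> 2), add_group {0}], [\<lambda>_. 0])"
  proof (rule exact_seq.unity)
    show "group_hom (add_group {0}) (add_group (modular_forms \<Gamma> 2)) (\<lambda>_. 0)"
      using grp[OF subspace_zero] M cfun.subspace_0[OF subspace_modular_forms]
      by (auto simp: group_hom_def group_hom_axioms_def hom_def add_group_def)
  qed
  have 2: "exact_seq ([add_group (QM 2), add_group (modular_forms \<Gamma> 2), add_group {0}], [\<lambda>f. f, \<lambda>_. 0])"
  proof (rule exact_seq.extension[OF 1 grp[OF subspace_QM]])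
    show "(\<lambda>f. f) \<in> hom (add_group (modular_forms \<Gamma> 2)) (add_group (QM 2))"
      using modular_iff_delta_eq_0 by (auto simp: hom_def add_group_def)
    show "kernel (add_group (modular_forms \<Gamma> 2)) (add_group (QM 2)) (\<lambda>f. f) = (\<lambda>_. 0) ` carrier (add_group {0})"
      using cfun.subspace_0[OF subspace_modular_forms] by (auto simp: kernel_def add_group_def)
  qed
  show ?thesis
  proof (rule exact_seq.extension[OF 2 grp[OF subspace_consts]])
    show "delta \<Gamma> 2 \<in> hom (add_group (QM 2)) (add_group (range const_hfun))"
    proof (rule homI)
      fix f assume "f \<in> carrier (add_group (QM 2))"
      hence "f \<in> QM 2" by (simp add: add_group_def)
      then obtain c where "delta \<Gamma> 2 f = const_hfun c" by (rule delta_weight_2)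
      thus "delta \<Gamma> 2 f \<in> carrier (add_group (range const_hfun))" by (simp add: add_group_def)
    qed (simp add: add_group_def delta_add)
    show "kernel (add_group (QM 2)) (add_group (range const_hfun)) (delta \<Gamma> 2) = (\<lambda>f. f) ` carrier (add_group (modular_forms \<Gamma> 2))"
      using modular_iff_delta_eq_0 by (auto simp: kernel_def add_group_def)
  qed
qed

lemma delta_normalise:
  assumes "f \<in> QM 2" "delta \<Gamma> 2 f \<noteq> 0"
  shows "\<exists>\<phi>\<in>QM 2. delta \<Gamma> 2 \<phi> = const_hfun 1"
proof -
  obtain c where c: "delta \<Gamma> 2 f = const_hfun c" by (rule delta_weight_2[OF assms(1)])
  have "c \<noteq> 0" using assms(2) c const_hfun_eq_0_iff by simp
  hence "delta \<Gamma> 2 (fscale (1 / c) f) = const_hfun 1"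
    by (simp add: delta_fscale[OF assms(1)] c fscale_const_hfun)
  thus ?thesis using QM_fscale(1)[OF assms(1)] by blast
qed

text \<open>
  An infinite dimension would be \<open>0\<close> by convention. This does not occur, because the image consists of constants.
\<close>

lemma dim_delta_eq_0_iff:
  "cfun.dim (delta \<Gamma> 2 ` QM 2) = 0 \<longleftrightarrow> (\<forall>f\<in>QM 2. delta \<Gamma> 2 f = 0)"
proof
  assume *: "\<forall>f\<in>QM 2. delta \<Gamma> 2 f = 0"
  have "0 \<in> QM 2" by (rule cfun.subspace_0[OF subspace_QM])
  hence "delta \<Gamma> 2 ` QM 2 = {0}" using * by auto
  hence "cfun.dim (delta \<Gamma> 2 ` QM 2) = card ({} :: (complex \<Rightarrow> complex) set)"
    by (intro cfun.dim_eq_card) (auto simp: cfun.span_empty cfun.independent_empty cfun.span_insert_0)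
  thus "cfun.dim (delta \<Gamma> 2 ` QM 2) = 0" by simp
next
  assume d: "cfun.dim (delta \<Gamma> 2 ` QM 2) = 0"
  show "\<forall>f\<in>QM 2. delta \<Gamma> 2 f = 0"
  proof (rule ccontr)
    assume "\<not> (\<forall>f\<in>QM 2. delta \<Gamma> 2 f = 0)"
    then obtain \<phi> where \<phi>: "\<phi> \<in> QM 2" "delta \<Gamma> 2 \<phi> = const_hfun 1" using delta_normalise by blast
    have "cfun.span {const_hfun 1} = cfun.span (delta \<Gamma> 2 ` QM 2)"
    proof (rule equalityI)
      show "cfun.span {const_hfun 1} \<subseteq> cfun.span (delta \<Gamma> 2 ` QM 2)"
        by (rule cfun.span_mono) (use \<phi> in force)
      show "cfun.span (delta \<Gamma> 2 ` QM 2) \<subseteq> cfun.span {const_hfun 1}"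
      proof (rule cfun.span_minimal)
        show "delta \<Gamma> 2 ` QM 2 \<subseteq> cfun.span {const_hfun 1}"
        proof
          fix g assume "g \<in> delta \<Gamma> 2 ` QM 2"
          then obtain f where f: "f \<in> QM 2" "g = delta \<Gamma> 2 f" by blast
          obtain c where "delta \<Gamma> 2 f = const_hfun c" by (rule delta_weight_2[OF f(1)])
          hence "g = fscale c (const_hfun 1)" by (simp add: f fscale_const_hfun)
          thus "g \<in> cfun.span {const_hfun 1}" by (auto intro: cfun.span_scale cfun.span_base)
        qed
      qed simp
    qed
    moreover have "cfun.independent {const_hfun 1}"
      using const_hfun_eq_0_iff[of 1] by simp
    ultimately have "cfun.dim (delta \<Gamma> 2 ` QM 2) = card {const_hfun 1}" by (rule cfun.dim_eq_card)
    thus False using d by simp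
  qed
qed

end

theorem theorem2:
  fixes \<Gamma> :: "(real^2^2) set set"
  assumes "discrete_finite_covolume \<Gamma>"
  shows
    "cfun.subspace (modular_forms \<Gamma> 2) \<and> cfun.subspace (quasimodular_forms \<Gamma> 2) \<and>
     exact_seq
       ([add_group (range const_hfun), add_group (quasimodular_forms \<Gamma> 2),
         add_group (modular_forms \<Gamma> 2), add_group {0}],
        [delta \<Gamma> 2, (\<lambda>f. f), (\<lambda>_. 0)]) \<and>
     (\<forall>c. \<forall>f\<in>quasimodular_forms \<Gamma> 2. delta \<Gamma> 2 (fscale c f) = fscale c (delta \<Gamma> 2 f)) \<and>
     (cfun.dim (delta \<Gamma> 2 ` quasimodular_forms \<Gamma> 2) = 0 \<or>
        (\<exists>\<phi>\<in>quasimodular_forms \<Gamma> 2. delta \<Gamma> 2 \<phi> = const_hfun 1)) \<and>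
     (cfun.dim (delta \<Gamma> 2 ` quasimodular_forms \<Gamma> 2) = 0 \<longrightarrow>
        cgr.internal_direct_sum (quasimodular_ring \<Gamma>) (modular_summands \<Gamma>)) \<and>
     (\<forall>\<phi>\<in>quasimodular_forms \<Gamma> 2. delta \<Gamma> 2 \<phi> = const_hfun 1 \<longrightarrow>
        cgr.internal_direct_sum (quasimodular_ring \<Gamma>)
          (case_sum (modular_summands \<Gamma>) (phi_summands \<phi>)))"
proof -
  interpret fuchsian \<Gamma> by unfold_locales (rule assms)
  show ?thesis
  proof (intro conjI allI ballI impI)
    show "cfun.subspace (modular_forms \<Gamma> 2)" by (rule subspace_modular_forms)
    show "cfun.subspace (QM 2)" by (rule subspace_QM)
    show "exact_seq
       ([add_group (range const_hfun), add_group (QM 2), add_group (modular_forms \<Gamma> 2), add_group {0}],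
        [delta \<Gamma> 2, (\<lambda>f. f), (\<lambda>_. 0)])" by (rule exact_sequence)
    show "delta \<Gamma> 2 (fscale c f) = fscale c (delta \<Gamma> 2 f)" if "f \<in> QM 2" for c f
      by (rule delta_fscale[OF that])
    show "cfun.dim (delta \<Gamma> 2 ` QM 2) = 0 \<or> (\<exists>\<phi>\<in>QM 2. delta \<Gamma> 2 \<phi> = const_hfun 1)"
      using dim_delta_eq_0_iff delta_normalise by blast
    show "cgr.internal_direct_sum (quasimodular_ring \<Gamma>) (modular_summands \<Gamma>)"
      if "cfun.dim (delta \<Gamma> 2 ` QM 2) = 0"
      using that dim_delta_eq_0_iff by (intro quasimodular_direct_sum_const) blast
    show "cgr.internal_direct_sum (quasimodular_ring \<Gamma>) (case_sum (modular_summands \<Gamma>) (phi_summands \<phi>))"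
      if "\<phi> \<in> QM 2" "delta \<Gamma> 2 \<phi> = const_hfun 1" for \<phi>
      by (rule quasimodular_direct_sum_phi[OF that])
  qed
qed

end
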